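(* Let $j,\ell$ be integers with $1\le j\le\ell$ and $\gcd(j,\ell)=1$. Then, as $x\to\infty$, $$M_{\omega^2}(x,j,\ell):=\sum_{\substack{2\le n\le x\\ p_1(n)\equiv j\ (\mathrm{mod}\ \ell)}}\mu(n)\omega(n)^2\ll\frac{x(\log\log x)^5}{\log x}.$$
   Context: $\mu$ is the Möbius function, $\omega(n)$ the number of distinct prime factors of $n$, and $p_1(n)$ the smallest prime factor of $n\ge2$. Implied constants may depend on $\ell$. *)

theory Defs
  imports Complex_Main
    "HOL-Computational_Algebra.Squarefree"
    "HOL-Number_Theory.Cong"
begin

text \<open>Number of distinct prime factors; \<open>prime_factors n\<close> is a set, so there is no multiplicity.\<close>

definition omega :: "nat \<Rightarrow> nat" where
  "omega n = card (prime_factors n)"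

definition moebius_mu :: "nat \<Rightarrow> int" where
  "moebius_mu n = (if squarefree n then (-1) ^ card (prime_factors n) else 0)"

text \<open>Only meaningful for \<open>n \<ge> 2\<close>, where the set of prime factors is nonempty.\<close>

definition smallest_prime_factor :: "nat \<Rightarrow> nat" where
  "smallest_prime_factor n = Min (prime_factors n)"

definition M_omega_sq :: "real \<Rightarrow> nat \<Rightarrow> nat \<Rightarrow> real" where
  "M_omega_sq x j l =
     (\<Sum>n | 2 \<le> n \<and> real n \<le> x \<and> [smallest_prime_factor n = j] (mod l).
        of_int (moebius_mu n) * (real (omega n))\<^sup>2)"

end

theory Submission
  imports Defs
    "HOL-Number_Theory.Number_Theory"
    "HOL-Complex_Analysis.Complex_Analysis"
    "HOL-Probability.Probability"
    "HOL-Real_Asymp.Real_Asymp"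
begin

text \<open>
  Write \<open>n = p m\<close> with \<open>p\<close> the smallest prime factor and expand \<open>\<omega>(n)\<^sup>2\<close> over the prime factors of
  \<open>m\<close>. For \<open>p\<close> up to \<open>x powr (c / ln (ln x))\<close> this leaves sums of \<open>\<mu>(b)\<close> over \<open>b \<le> Y\<close> that avoid all
  primes up to \<open>p\<close> and at most two further ones. If \<open>Y\<close> is large compared with \<open>p\<close>, the bound
  \<open>O(t / (ln t) ^ 8)\<close> for the sum of \<open>\<mu>\<close> up to \<open>t\<close> and Rankin's trick apply, otherwise an upper bound sieve
  does. For larger \<open>p\<close> the sieve and \<open>\<omega>(n) = O(ln (ln x))\<close> suffice.

  The bound for the sum of \<open>\<mu>\<close> comes from the derivatives of \<open>1 / \<zeta>\<close>, which grow at most like a power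
  of \<open>ln \<bar>t\<bar>\<close> to the right of the line \<open>\<sigma> = 1\<close>: their coefficients are \<open>\<mu>(n) (- ln n) ^ k\<close>, so that
  a Perron formula for a fixed large \<open>k\<close> saves powers of \<open>ln x\<close> without any shift of contour.
\<close>

section \<open>Chebyshev and Mertens estimates\<close>

text \<open>The exponents are fixed backwards. In Rankin's trick the Euler product over the primes
  up to \<open>p\<close> costs \<open>(ln p + 1) ^ 6\<close>, and the summation over logarithmic
  scales of \<open>Y\<close> needs a convergent \<open>1 / (ln Y)\<^sup>2\<close>; hence the eighth
  power in the bound for the sum of \<mu>. With k derivatives the smoothing saves 2k/3 powers of the
  logarithm, so k = 12. Rankin's exponent is of size \<open>1 / ln p\<close>, and its gain reaches
  \<open>(ln x) ^ 8\<close> only once \<open>ln Y\<close> exceeds a multiple of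
  \<open>ln p * ln (ln x)\<close>. On the scales below that the sieve saves just
  \<open>ln p\<close>, which leaves one factor \<open>ln (ln x)\<close>. A second one comes from the
  pairs of extra primes, a third one from the sum of \<open>1 / p\<close>. The range of
  \<open>p\<close> is chosen so that these short scales fill at most half of \<open>ln X\<close>.
  For larger \<open>p\<close> there is again a cube: two factors from \<omega> and one from the
  density of rough numbers. Absolute convergence of the Perron integral is bought with half a power
  of the smoothing length \<open>h\<close>, and this is why only 2k/3 of the k powers
  survive.\<close>

lemma finite_primes_le [simp]: "finite {p::nat. prime p \<and> real p \<le> t}"
  by (rule finite_subset[of _ "{..nat \<lfloor>t\<rfloor>}"]) (auto simp: le_nat_floor)

lemma finite_primes_between [simp]: "finite {p::nat. prime p \<and> s < real p \<and> real p \<le> t}"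
  by (rule finite_subset[OF _ finite_primes_le[of t]]) auto

section \<open>Chebyshev's upper bound for the product of the primes\<close>

lemma prod_primes_dvd:
  fixes n :: nat
  assumes "finite A" "\<And>p. p \<in> A \<Longrightarrow> prime p" "\<And>p. p \<in> A \<Longrightarrow> p dvd n"
  shows "\<Prod>A dvd n"
  using assms
proof (induction A rule: finite_induct)
  case (insert p A)
  have "coprime p (\<Prod>A)"
    using insert by (intro prod_coprime_right primes_coprime) auto
  then show ?case using insert by (auto intro!: divides_mult)
qed auto

text \<open>Erdos' argument: for \<open>n = 2 * m + 1\<close> the primes above \<open>m + 1\<close>
  divide \<open>2 * m + 1 choose m\<close>, which is at most \<open>4 ^ m\<close> because it occurs
  twice in a row of sum \<open>2 ^ (2 * m + 1)\<close>. An even \<open>n > 2\<close> is not prime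
  and adds no factor.\<close>

lemma primorial_le: "(\<Prod>p | prime p \<and> p \<le> n. p) \<le> (4::nat) ^ n"
proof (induction n rule: less_induct)
  case (less n)
  have fin: "finite {p::nat. prime p \<and> p \<le> k}" for k by simp
  show ?case
  proof (cases "n > 2")
    case False
    have "p = 2 \<and> n = 2" if "prime p" "p \<le> n" for p
      using prime_ge_2_nat[OF that(1)] that(2) False by linarith
    then have sub: "{p::nat. prime p \<and> p \<le> n} \<subseteq> (if n = 2 then {2} else {})" by auto
    show ?thesis
    proof (cases "n = 2")
      case True
      then have "{p::nat. prime p \<and> p \<le> n} \<subseteq> {2}" using sub by simp
      then have "\<Prod>{p::nat. prime p \<and> p \<le> n} dvd \<Prod>{2}" by (intro prod_dvd_prod_subset) simp_all
      then have "\<Prod>{p::nat. prime p \<and> p \<le> n} \<le> 2" by (intro dvd_imp_le) simp_all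
      then show ?thesis using True by simp
    next
      case False
      have "{p::nat. prime p \<and> p \<le> n} = {}"
        using sub unfolding if_not_P[OF False] subset_empty .
      then show ?thesis by (simp only: prod.empty one_le_power one_le_numeral)
    qed
  next
    case True
    show ?thesis
    proof (cases "even n")
      case even: True
      have "\<not> prime n" using True even prime_odd_nat by blast
      then have "p \<noteq> n" if "prime p" for p using that by blast
      then have "{p::nat. prime p \<and> p \<le> n} = {p::nat. prime p \<and> p \<le> n - 1}"
        using True by (auto simp: le_less)
      then have "(\<Prod>p | prime p \<and> p \<le> n. p) \<le> 4 ^ (n - 1)" using less[of "n - 1"] True by simp
      also have "\<dots> \<le> 4 ^ n" by (rule power_increasing) auto
      finally show ?thesis .
    next
      case False
      then obtain m where "n = 2 * m + 1" by (elim oddE)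
      with True have m: "n = 2 * m + 1" "m \<ge> 1" by auto
      let ?A = "{p::nat. prime p \<and> p \<le> m + 1}" and ?B = "{p::nat. prime p \<and> m + 1 < p \<and> p \<le> 2 * m + 1}"
      have finB: "finite ?B" by (rule finite_subset[OF _ fin[of "2*m+1"]]) auto
      have split: "{p::nat. prime p \<and> p \<le> n} = ?A \<union> ?B" using m by auto
      have dvd: "(\<Prod>p\<in>?B. p) dvd (2*m+1 choose m)"
      proof (rule prod_primes_dvd)
        show "p dvd (2*m+1 choose m)" if "p \<in> ?B" for p
        proof -
          have p: "prime p" "m + 1 < p" "p \<le> 2*m+1" using that by auto
          have "fact m * fact (m + 1) * (2*m+1 choose m) = (fact (2*m+1)::nat)"
            using binomial_fact_lemma[of m "2*m+1"] by simp
          moreover have "p dvd (fact (2*m+1)::nat)" using p by (simp add: prime_dvd_fact_iff del: fact_Suc)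
          moreover have "\<not> p dvd (fact m::nat)" "\<not> p dvd (fact (m+1)::nat)" using p by (simp_all add: prime_dvd_fact_iff del: fact_Suc)
          ultimately show ?thesis using p(1) by (metis prime_dvd_mult_nat)
        qed
      qed (use finB in auto)
      have "2 * (2*m+1 choose m) = (2*m+1 choose m) + (2*m+1 choose (m+1))"
        using binomial_symmetric[of m "2*m+1"] by simp
      also have "\<dots> = (\<Sum>k\<in>{m,m+1}. (2*m+1 choose k))" by simp
      also have "\<dots> \<le> (\<Sum>k\<le>2*m+1. (2*m+1 choose k))" by (rule sum_mono2) auto
      also have "\<dots> = 2 ^ (2*m+1)" by (rule choose_row_sum)
      also have "\<dots> = 2 * 4 ^ m" by (simp add: power_mult)
      finally have "(2*m+1 choose m) \<le> 4 ^ m" by simp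
      moreover have "(2*m+1 choose m) > 0" by simp
      ultimately have B: "(\<Prod>p\<in>?B. p) \<le> 4 ^ m" using dvd by (meson dvd_imp_le le_trans)
      have "(\<Prod>p | prime p \<and> p \<le> n. p) = (\<Prod>p\<in>?A. p) * (\<Prod>p\<in>?B. p)"
        unfolding split by (rule prod.union_disjoint) (use finB in auto)
      also have "\<dots> \<le> 4 ^ (m+1) * 4 ^ m"
        using less[of "m+1"] m B by (intro mult_mono) auto
      also have "\<dots> = 4 ^ n" using m by (simp add: power_add[symmetric] mult_2)
      finally show ?thesis .
    qed
  qed
qed

lemma theta_le:
  assumes "t \<ge> 0"
  shows "(\<Sum>p | prime p \<and> real p \<le> t. ln (real p)) \<le> ln 4 * t"
proof -
  have eq: "{p::nat. prime p \<and> real p \<le> t} = {p. prime p \<and> p \<le> nat \<lfloor>t\<rfloor>}"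
    using assms by (auto simp: le_nat_floor) linarith
  have "(\<Sum>p | prime p \<and> real p \<le> t. ln (real p)) = ln (real (\<Prod>p | prime p \<and> real p \<le> t. p))"
    unfolding of_nat_prod by (subst ln_prod) (auto dest: prime_gt_0_nat)
  also have "\<dots> \<le> ln (real (4 ^ nat \<lfloor>t\<rfloor>))"
  proof (rule ln_mono)
    show "0 < real (\<Prod>p | prime p \<and> real p \<le> t. p)" 
      by (subst of_nat_0_less_iff, rule prod_pos) (auto dest: prime_gt_0_nat)
    show "real (\<Prod>p | prime p \<and> real p \<le> t. p) \<le> real (4 ^ nat \<lfloor>t\<rfloor>)"
      unfolding eq of_nat_le_iff by (rule primorial_le)
  qed
  also have "\<dots> = real (nat \<lfloor>t\<rfloor>) * ln 4" by (simp add: ln_realpow)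
  also have "\<dots> \<le> t * ln 4" using assms by (intro mult_right_mono) auto
  finally show ?thesis by (simp add: mult.commute)
qed

section \<open>Mertens' estimates for sums over primes\<close>

lemma card_multiples:
  assumes "d > 0"
  shows "card {m\<in>{1..n::nat}. d dvd m} = n div d"
proof -
  have "{m\<in>{1..n}. d dvd m} = (*) d ` {1..n div d}"
    using assms by (auto simp: image_iff dvd_def less_eq_div_iff_mult_less_eq mult.commute)
  moreover have "inj_on ((*) d) {1..n div d}" using assms by (auto simp: inj_on_def)
  ultimately show ?thesis by (simp add: card_image)
qed

lemma sum_ln_prime_factors_le:
  assumes "m > 0"
  shows "(\<Sum>p\<in>prime_factors m. ln (real p)) \<le> ln (real m)"
proof -
  have "(\<Prod>p\<in>prime_factors m. p) dvd m"
    by (rule prod_primes_dvd) (auto simp: prime_factors_dvd)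
  then have "(\<Prod>p\<in>prime_factors m. p) \<le> m" using assms by (simp add: dvd_imp_le)
  then have "real (\<Prod>p\<in>prime_factors m. p) \<le> real m" by (rule of_nat_mono)
  then have "ln (real (\<Prod>p\<in>prime_factors m. p)) \<le> ln (real m)"
    using assms by (intro ln_mono) (auto intro!: prod_pos simp: prime_factors_gt_0_nat simp del: of_nat_prod)
  moreover have "ln (real (\<Prod>p\<in>prime_factors m. p)) = (\<Sum>p\<in>prime_factors m. ln (real p))"
    unfolding of_nat_prod by (subst ln_prod) (auto simp: prime_factors_gt_0_nat)
  ultimately show ?thesis by simp
qed

text \<open>The sum of \<open>ln p\<close> over all pairs of a prime \<open>p\<close> and a multiple
  \<open>m \<le> n\<close> is evaluated twice: for fixed \<open>p\<close> by counting multiples, for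
  fixed \<open>m\<close> by \<open>ln m\<close>. Replacing \<open>n div p\<close> by
  \<open>n / p\<close> costs another sum of \<open>ln p\<close>, which \<open>theta_le\<close>
  bounds.\<close>

lemma mertens_first_upper:
  fixes n :: nat
  assumes "n \<ge> 1"
  shows "(\<Sum>p | prime p \<and> p \<le> n. ln (real p) / real p) \<le> ln (real n) + ln 4"
proof -
  let ?P = "{p. prime p \<and> p \<le> n}"
  have "(\<Sum>p\<in>?P. ln (real p) * real (n div p)) = (\<Sum>p\<in>?P. \<Sum>m | m \<in> {1..n} \<and> p dvd m. ln (real p))"
    by (rule sum.cong) (auto simp: card_multiples[simplified] dest: prime_gt_0_nat)
  also have "\<dots> = (\<Sum>m\<in>{1..n}. \<Sum>p | p \<in> ?P \<and> p dvd m. ln (real p))"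
    by (rule sum.swap_restrict) auto
  also have "\<dots> = (\<Sum>m\<in>{1..n}. \<Sum>p\<in>prime_factors m. ln (real p))"
    by (rule sum.cong, simp, rule sum.cong) (auto simp: prime_factors_dvd dest: dvd_imp_le)
  also have "\<dots> \<le> (\<Sum>m\<in>{1..n}. ln (real n))"
  proof (rule sum_mono)
    fix m assume m: "m \<in> {1..n}"
    have "(\<Sum>p\<in>prime_factors m. ln (real p)) \<le> ln (real m)" using m by (intro sum_ln_prime_factors_le) auto
    also have "\<dots> \<le> ln (real n)" using m by (intro ln_mono) auto
    finally show "(\<Sum>p\<in>prime_factors m. ln (real p)) \<le> ln (real n)" .
  qed
  also have "\<dots> = real n * ln (real n)" by simp
  finally have 1: "(\<Sum>p\<in>?P. ln (real p) * real (n div p)) \<le> real n * ln (real n)" .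
  have "real n * (\<Sum>p\<in>?P. ln (real p) / real p) = (\<Sum>p\<in>?P. ln (real p) * (real n / real p))"
    by (simp add: sum_distrib_left mult.commute)
  also have "\<dots> \<le> (\<Sum>p\<in>?P. ln (real p) * (real (n div p) + 1))"
  proof (intro sum_mono mult_left_mono)
    fix p assume "p \<in> ?P"
    then have "p > 0" by (auto dest: prime_gt_0_nat)
    then have "n < p * (n div p + 1)"
      by (metis Suc_eq_plus1 dividend_less_times_div mult_Suc_right add.commute)
    then have "real n \<le> real (p * (n div p + 1))" by (intro of_nat_mono) simp
    then show "real n / real p \<le> real (n div p) + 1"
      using \<open>p > 0\<close> by (simp add: divide_le_eq algebra_simps)
  qed (auto dest: prime_gt_0_nat)
  also have "\<dots> = (\<Sum>p\<in>?P. ln (real p) * real (n div p)) + (\<Sum>p\<in>?P. ln (real p))"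
    by (simp add: algebra_simps sum.distrib)
  also have "\<dots> \<le> real n * ln (real n) + ln 4 * real n"
    using 1 theta_le[of "real n"] by simp
  finally have "real n * (\<Sum>p\<in>?P. ln (real p) / real p) \<le> real n * (ln (real n) + ln 4)"
    by (simp add: algebra_simps)
  then show ?thesis using assms by simp
qed

text \<open>Partial summation with weight \<open>1 / ln N\<close>, run as an induction on
  \<open>N\<close>: the first term on the right is the boundary term, and the other two absorb its
  change. Upper bounds for the partial sums suffice because the weight decreases.\<close>

lemma sum_prime_recip_nat:
  fixes m N :: nat
  assumes "2 \<le> m" "m \<le> N"
  shows "(\<Sum>p::nat | prime p \<and> m < p \<and> p \<le> N. 1 / real p)
           \<le> (\<Sum>p | prime p \<and> p \<le> N. ln (real p) / real p) / ln N + (ln (ln N) - ln (ln m)) + ln 4 * (1 / ln m - 1 / ln N)"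
  using assms(2)
proof (induction N rule: dec_induct)
  case base
  have "{p. prime p \<and> m < p \<and> p \<le> m} = {}" by auto
  moreover have "(\<Sum>p | prime p \<and> p \<le> m. ln (real p) / real p) / ln m \<ge> 0"
    using assms by (intro divide_nonneg_nonneg sum_nonneg) (auto dest: prime_gt_0_nat)
  ultimately show ?case by (simp only: sum.empty) simp
next
  case (step N)
  let ?S = "\<lambda>N. (\<Sum>p | prime p \<and> p \<le> N. ln (real p) / real p)"
  have N: "N \<ge> 2" using step assms by simp
  define b where "b = 1 / ln (real N)"
  define b' where "b' = 1 / ln (real (Suc N))"
  define a where "a = (if prime (Suc N) then ln (real (Suc N)) / real (Suc N) else 0)"
  have lnN: "ln (real N) > 0" "ln (real (Suc N)) > 0" "ln (real N) < ln (real (Suc N))" using N by auto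
  have S: "?S (Suc N) = ?S N + a"
  proof (cases "prime (Suc N)")
    case True
    then have "{p. prime p \<and> p \<le> Suc N} = insert (Suc N) {p. prime p \<and> p \<le> N}" by (auto simp: le_Suc_eq)
    then show ?thesis using True by (simp add: a_def)
  next
    case False
    then have "{p. prime p \<and> p \<le> Suc N} = {p. prime p \<and> p \<le> N}" by (auto simp: le_Suc_eq)
    then show ?thesis using False by (simp add: a_def)
  qed
  have R: "(\<Sum>p::nat | prime p \<and> m < p \<and> p \<le> Suc N. 1 / real p) = (\<Sum>p | prime p \<and> m < p \<and> p \<le> N. 1 / real p) + a * b'"
  proof (cases "prime (Suc N)")
    case True
    then have "{p. prime p \<and> m < p \<and> p \<le> Suc N} = insert (Suc N) {p. prime p \<and> m < p \<and> p \<le> N}" using step by (auto simp: le_Suc_eq)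
    then show ?thesis using True lnN by (simp add: a_def b'_def)
  next
    case False
    then have "{p. prime p \<and> m < p \<and> p \<le> Suc N} = {p. prime p \<and> m < p \<and> p \<le> N}" by (auto simp: le_Suc_eq)
    then show ?thesis using False by (simp add: a_def)
  qed
  have bb: "b - b' \<ge> 0" using lnN unfolding b_def b'_def by (simp add: frac_le)
  have "?S N * (b - b') \<le> (ln N + ln 4) * (b - b')"
    using mertens_first_upper[of N] N bb by (intro mult_right_mono) auto
  \<comment> \<open>Discrete form of the derivative of \<open>ln (ln u)\<close>, from
    \<open>ln v \<le> v - 1\<close> at \<open>v = ln N / ln (Suc N)\<close>.\<close>
  moreover have "ln N * (b - b') \<le> ln (ln (Suc N)) - ln (ln N)"
  proof -
    have "ln N * (b - b') = 1 - ln N / ln (Suc N)" using lnN unfolding b_def b'_def by (simp add: field_simps)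
    moreover have "ln (ln N / ln (Suc N)) \<le> ln N / ln (Suc N) - 1" using lnN by (intro ln_le_minus_one) auto
    moreover have "ln (ln N / ln (Suc N)) = ln (ln N) - ln (ln (Suc N))" using lnN by (subst ln_div) auto
    ultimately show ?thesis by linarith
  qed
  ultimately have *: "?S N * (b - b') \<le> ln (ln (Suc N)) - ln (ln N) + ln 4 * (b - b')" by (simp add: algebra_simps)
  have IH: "(\<Sum>p::nat | prime p \<and> m < p \<and> p \<le> N. 1 / real p) \<le> ?S N * b + (ln (ln N) - ln (ln m)) + ln 4 * (1 / ln m - b)"
    using step.IH by (simp add: b_def)
  have "?S (Suc N) / ln (Suc N) = (?S N + a) * b'" using S by (simp add: b'_def)
  then show ?case using R IH * unfolding b'_def[symmetric] by (simp add: algebra_simps)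
qed

lemma sum_prime_recip_between:
  assumes "2 \<le> y" "y \<le> x"
  shows "(\<Sum>p | prime p \<and> y < real p \<and> real p \<le> x. 1 / real p) \<le> ln (ln x) - ln (ln y) + 6"
proof -
  define m where "m = nat \<lfloor>y\<rfloor>"
  define N where "N = nat \<lfloor>x\<rfloor>"
  have m: "2 \<le> m" "real m \<le> y" "y < real m + 1" and N: "real N \<le> x" "x < real N + 1"
    using assms unfolding m_def N_def by linarith+
  have mN: "m \<le> N" using assms unfolding m_def N_def by (intro nat_mono floor_mono) auto
  have "{p. prime p \<and> y < real p \<and> real p \<le> x} \<subseteq> {p. prime p \<and> m < p \<and> p \<le> N}"
    using m N by auto
  then have "(\<Sum>p | prime p \<and> y < real p \<and> real p \<le> x. 1 / real p) \<le> (\<Sum>p | prime p \<and> m < p \<and> p \<le> N. 1 / real p)"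
    by (intro sum_mono2) auto
  also have "\<dots> \<le> (\<Sum>p | prime p \<and> p \<le> N. ln (real p) / real p) / ln N + (ln (ln N) - ln (ln m)) + ln 4 * (1 / ln m - 1 / ln N)"
    using m mN by (intro sum_prime_recip_nat) auto
  also have "\<dots> \<le> (ln N + ln 4) / ln N + (ln (ln N) - ln (ln m)) + ln 4 * (1 / ln m - 1 / ln N)"
    using m mN by (intro add_mono divide_right_mono mertens_first_upper order_refl) auto
  also have "\<dots> = 1 + (ln (ln N) - ln (ln m)) + ln 4 / ln m"
    using m mN by (simp add: field_simps)
  also have "\<dots> \<le> 1 + (ln (ln x) - ln (ln m)) + 2"
  proof -
    have "ln (ln N) \<le> ln (ln x)" using m mN N by (intro ln_mono) auto
    moreover have "ln 4 / ln m \<le> 2"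
    proof -
      have "ln 4 = 2 * ln (2::real)" using ln_realpow[of "2::real" 2] by simp
      moreover have "ln 2 \<le> ln (real m)" using m by simp
      ultimately show ?thesis using m by (simp add: field_simps)
    qed
    ultimately show ?thesis by linarith
  qed
  finally have main: "(\<Sum>p | prime p \<and> y < real p \<and> real p \<le> x. 1 / real p) \<le> 1 + (ln (ln x) - ln (ln m)) + 2" .
  \<comment> \<open>Rounding \<open>y\<close> down to \<open>m \<ge> 2\<close> still leaves
    \<open>y \<le> m * m\<close>, so the double logarithm drops by at most
    \<open>ln 2\<close>.\<close>
  have "ln (ln m) \<ge> ln (ln y) - ln 2"
  proof -
    have "2 * real m \<le> real m * real m" using m by (intro mult_right_mono) auto
    moreover have "y \<le> 2 * real m" using m by simp
    ultimately have "y \<le> real m * real m" by linarith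
    then have "ln y \<le> ln (real m * real m)" using assms by (intro ln_mono) auto
    then have "ln y \<le> 2 * ln m" using m by (simp add: ln_mult)
    then have "ln (ln y) \<le> ln (2 * ln m)" using assms by (intro ln_mono) auto
    then show ?thesis using m by (simp add: ln_mult)
  qed
  then show ?thesis using main ln_2_less_1 by linarith
qed

lemma ln_2_ge_half: "ln (2::real) \<ge> 1/2"
proof -
  have "ln (1/2::real) \<le> 1/2 - 1" by (rule ln_le_minus_one) auto
  then show ?thesis by (simp add: ln_div)
qed

lemma sum_prime_recip_le:
  assumes "2 \<le> x"
  shows "(\<Sum>p | prime p \<and> real p \<le> x. 1 / real p) \<le> ln (ln x) + 8"
proof -
  have eq: "{p. prime p \<and> real p \<le> x} = insert 2 {p. prime p \<and> 2 < real p \<and> real p \<le> x}"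
    using assms by (auto dest: prime_ge_2_nat simp: le_eq_less_or_eq)
  have "(\<Sum>p | prime p \<and> real p \<le> x. 1 / real p) = 1/2 + (\<Sum>p | prime p \<and> 2 < real p \<and> real p \<le> x. 1 / real p)"
    unfolding eq by (subst sum.insert[OF finite_primes_between]) auto
  also have "\<dots> \<le> 1/2 + (ln (ln x) - ln (ln 2) + 6)" (is "_ \<le> ?R")
    using sum_prime_recip_between[of 2 x] assms by simp
  finally have main: "(\<Sum>p | prime p \<and> real p \<le> x. 1 / real p) \<le> 1/2 + (ln (ln x) - ln (ln 2) + 6)" .
  have "ln (ln (2::real)) \<ge> - 1"
  proof -
    have "ln (1/2::real) \<le> ln (ln 2)" using ln_2_ge_half by (intro ln_mono) auto
    then show ?thesis using ln_2_less_1 by (simp add: ln_div)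
  qed
  then show ?thesis using main by linarith
qed

lemma ln_le_2_sqrt: "t > 0 \<Longrightarrow> ln t \<le> 2 * (sqrt t - 1)"
  using ln_le_minus_one[of "sqrt t"] by (simp add: ln_sqrt)

text \<open>Primes up to \<open>sqrt t\<close> are counted trivially; every larger one contributes
  at least \<open>ln t / 2\<close> to the sum in \<open>theta_le\<close>. The denominator
  \<open>1 + ln t\<close> keeps the bound meaningful down to \<open>t = 1\<close>.\<close>

lemma card_primes_le:
  assumes "t \<ge> 1"
  shows "real (card {p. prime p \<and> real p \<le> t}) \<le> 10 * t / (1 + ln t)"
proof -
  let ?P = "{p. prime p \<and> real p \<le> t}"
  have l0: "ln t \<ge> 0" using assms by simp
  let ?A = "{p\<in>?P. real p \<le> sqrt t}" and ?B = "{p\<in>?P. real p > sqrt t}"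
  have "card ?A \<le> card {1..nat \<lfloor>sqrt t\<rfloor>}"
    by (rule card_mono) (auto simp: le_nat_floor dest: prime_gt_0_nat)
  also have "\<dots> = nat \<lfloor>sqrt t\<rfloor>" by simp
  finally have "real (card ?A) \<le> real (nat \<lfloor>sqrt t\<rfloor>)" by (rule of_nat_mono)
  also have "\<dots> \<le> sqrt t" using assms by simp
  finally have A: "real (card ?A) \<le> sqrt t" .
  have "real (card ?B) * (ln t / 2) = (\<Sum>p\<in>?B. ln t / 2)" by simp
  also have "\<dots> \<le> (\<Sum>p\<in>?B. ln (real p))"
  proof (rule sum_mono)
    fix p assume "p \<in> ?B"
    then have "ln (sqrt t) \<le> ln (real p)" using assms by (intro ln_mono) auto
    then show "ln t / 2 \<le> ln (real p)" using assms by (simp add: ln_sqrt)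
  qed
  also have "\<dots> \<le> (\<Sum>p\<in>?P. ln (real p))" by (rule sum_mono2) (auto dest: prime_gt_0_nat)
  also have "\<dots> \<le> ln 4 * t" using assms by (intro theta_le) auto
  finally have B: "real (card ?B) * ln t \<le> 2 * ln 4 * t" by simp
  have fin: "finite ?A" "finite ?B" by (rule finite_subset[OF _ finite_primes_le[of t]], blast)+
  have "card ?P \<le> card (?A \<union> ?B)" by (rule card_mono, use fin in blast) auto
  also have "\<dots> \<le> card ?A + card ?B" by (rule card_Un_le)
  finally have c: "real (card ?P) \<le> sqrt t + real (card ?B)" using A by linarith
  have "card ?P \<le> card {1..nat \<lfloor>t\<rfloor>}"
    by (rule card_mono) (auto simp: le_nat_floor dest: prime_gt_0_nat)
  also have "\<dots> = nat \<lfloor>t\<rfloor>" by simp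
  finally have "real (card ?P) \<le> real (nat \<lfloor>t\<rfloor>)" by (rule of_nat_mono)
  also have "\<dots> \<le> t" using assms by simp
  finally have c': "real (card ?P) \<le> t" .
  have "real (card ?P) * (1 + ln t) \<le> t + (sqrt t + real (card ?B)) * ln t"
    using c c' mult_right_mono[OF c l0] by (simp add: algebra_simps)
  also have "\<dots> \<le> t + sqrt t * (2 * sqrt t) + 2 * ln 4 * t"
  proof -
    have "sqrt t * ln t \<le> sqrt t * (2 * sqrt t)"
      using ln_le_2_sqrt[of t] assms by (intro mult_left_mono) auto
    then show ?thesis using B by (simp add: algebra_simps)
  qed
  also have "\<dots> \<le> 10 * t"
  proof -
    have "ln 4 = 2 * ln (2::real)" using ln_realpow[of "2::real" 2] by simp
    then have "ln (4::real) \<le> 2" using ln_2_less_1 by simp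
    then have "ln 4 * t \<le> 2 * t" using assms by (intro mult_right_mono) auto
    moreover have "sqrt t * (2 * sqrt t) = 2 * t" using assms by simp
    moreover have "2 * ln 4 * t = 2 * (ln 4 * t)" by simp
    ultimately show ?thesis using assms by linarith
  qed
  finally show ?thesis using l0 by (simp add: field_simps)
qed

section \<open>Rough numbers\<close>

lemma prod_prime_factors_squarefree:
  assumes "squarefree (n::nat)"
  shows "\<Prod>(prime_factors n) = n"
proof -
  have n: "n \<noteq> 0" using assms by (metis not_squarefree_0)
  have "n = (\<Prod>p\<in>prime_factors n. p ^ multiplicity p n)" using n by (intro prime_factorization_nat) auto
  also have "\<dots> = (\<Prod>p\<in>prime_factors n. p)"
  proof (rule prod.cong)
    fix p assume p: "p \<in> prime_factors n"
    then have "multiplicity p n > 0" by (simp add: prime_factors_multiplicity)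
    moreover have "multiplicity p n \<le> 1" using assms p n
      by (simp add: squarefree_factorial_semiring'' in_prime_factors_imp_prime)
    ultimately have "multiplicity p n = 1" by linarith
    then show "p ^ multiplicity p n = p" by simp
  qed auto
  finally show ?thesis by simp
qed

lemma squarefree_prime_factors_inj: "inj_on prime_factors {n::nat. squarefree n}"
  by (rule inj_onI) (metis mem_Collect_eq prod_prime_factors_squarefree)

lemma squarefree_div: "squarefree (n::nat) \<Longrightarrow> q dvd n \<Longrightarrow> squarefree (n div q)"
  by (metis dvd_div_mult_self dvd_triv_left squarefree_mono)

lemma prime_factors_div_subset: "(n::nat) > 0 \<Longrightarrow> q dvd n \<Longrightarrow> prime_factors (n div q) \<subseteq> prime_factors n"
  by (intro dvd_prime_factors) (auto simp: div_dvd_iff_mult)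

definition rough :: "real \<Rightarrow> real \<Rightarrow> nat set" where
  "rough y x = {n. 1 \<le> n \<and> real n \<le> x \<and> squarefree n \<and> (\<forall>p\<in>prime_factors n. y < real p)}"

lemma finite_nat_real_le [simp]: "finite {n::nat. P n \<and> real n \<le> x}" "finite {n::nat. real n \<le> x}"
  "finite {n::nat. P n \<and> real n \<le> x \<and> Q n}"
  by (rule finite_subset[of _ "{..nat \<lfloor>x\<rfloor>}"]; auto simp: le_nat_floor)+

lemma finite_rough [simp]: "finite (rough y x)"
  unfolding rough_def by (rule finite_subset[of _ "{..nat \<lfloor>x\<rfloor>}"]) (auto simp: le_nat_floor)

text \<open>A squarefree number is determined by its set of prime factors, so the sum is a part of
  the expanded product of \<open>1 + 1 / p\<close>.\<close>

lemma sum_recip_rough_le: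
  "(\<Sum>m\<in>rough y x. 1 / real m) \<le> exp (\<Sum>p | prime p \<and> y < real p \<and> real p \<le> x. 1 / real p)"
proof -
  let ?P = "{p. prime p \<and> y < real p \<and> real p \<le> x}"
  have inj: "inj_on prime_factors (rough y x)"
    by (rule inj_on_subset[OF squarefree_prime_factors_inj]) (auto simp: rough_def)
  have sub: "prime_factors ` rough y x \<subseteq> Pow ?P"
  proof (intro subsetI PowI, elim imageE)
    fix A n p assume *: "A = prime_factors n" "n \<in> rough y x" "p \<in> A"
    then have "p \<le> n" by (auto simp: rough_def intro!: dvd_imp_le)
    then show "p \<in> ?P" using * by (auto simp: rough_def)
  qed
  have "(\<Sum>m\<in>rough y x. 1 / real m) = (\<Sum>m\<in>rough y x. \<Prod>p\<in>prime_factors m. 1 / real p)"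
  proof (rule sum.cong)
    fix m assume "m \<in> rough y x"
    then have "\<Prod>(prime_factors m) = m" by (intro prod_prime_factors_squarefree) (auto simp: rough_def)
    from arg_cong[OF this, of real] have "real m = (\<Prod>p\<in>prime_factors m. real p)" by simp
    then show "1 / real m = (\<Prod>p\<in>prime_factors m. 1 / real p)" by (simp add: prod_dividef)
  qed auto
  also have "\<dots> = (\<Sum>A\<in>prime_factors ` rough y x. \<Prod>p\<in>A. 1 / real p)"
    using sum.reindex[OF inj, of "\<lambda>A. \<Prod>p\<in>A. 1 / real p"] by simp
  also have "\<dots> \<le> (\<Sum>A\<in>Pow ?P. \<Prod>p\<in>A. 1 / real p)"
    using sub by (intro sum_mono2) (auto intro!: prod_nonneg)
  also have "\<dots> = (\<Prod>p\<in>?P. 1 / real p + 1)"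
    by (subst prod_add) auto
  also have "\<dots> \<le> (\<Prod>p\<in>?P. exp (1 / real p))"
    by (intro prod_mono) (auto simp: add.commute intro: exp_ge_add_one_self)
  also have "\<dots> = exp (\<Sum>p\<in>?P. 1 / real p)" by (rule exp_sum[symmetric]) auto
  finally show ?thesis .
qed

text \<open>\<open>ln n\<close> is distributed over the prime factors \<open>q\<close> of
  \<open>n\<close>, and the pair \<open>(n, q)\<close> is traded for the cofactor
  \<open>m = n div q\<close>, which is again rough, and \<open>q \<le> x / m\<close>. Chebyshev's
  bound then sums over \<open>q\<close>.\<close>

lemma sum_ln_rough_le:
  assumes "x \<ge> 0"
  shows "(\<Sum>n\<in>rough y x. ln (real n)) \<le> ln 4 * x * (\<Sum>m\<in>rough y x. 1 / real m)"
proof -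
  let ?P = "\<lambda>t. {p. prime p \<and> real p \<le> t}"
  let ?S = "Sigma (rough y x) prime_factors"
  have "(\<Sum>n\<in>rough y x. ln (real n)) = (\<Sum>n\<in>rough y x. \<Sum>q\<in>prime_factors n. ln (real q))"
  proof (rule sum.cong)
    fix n assume n: "n \<in> rough y x"
    then have "\<Prod>(prime_factors n) = n" by (intro prod_prime_factors_squarefree) (auto simp: rough_def)
    from arg_cong[OF this, of real] have "ln (real n) = ln (\<Prod>q\<in>prime_factors n. real q)" by simp
    also have "\<dots> = (\<Sum>q\<in>prime_factors n. ln (real q))" by (subst ln_prod) (auto simp: prime_factors_gt_0_nat)
    finally show "ln (real n) = (\<Sum>q\<in>prime_factors n. ln (real q))" .
  qed auto
  also have "\<dots> = (\<Sum>(n,q)\<in>?S. ln (real q))" by (subst sum.Sigma) auto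
  also have "\<dots> = (\<Sum>(m,q)\<in>(\<lambda>(n,q). (n div q, q)) ` ?S. ln (real q))"
  proof -
    have "inj_on (\<lambda>(n,q). (n div q, q)) ?S"
      by (rule inj_on_inverseI[where g = "\<lambda>(m,q). (m * q, q)"]) (auto simp: dvd_div_mult_self in_prime_factors_imp_dvd)
    then show ?thesis by (subst sum.reindex) (auto simp: case_prod_beta comp_def)
  qed
  also have "\<dots> \<le> (\<Sum>(m,q)\<in>Sigma (rough y x) (\<lambda>m. ?P (x / real m)). ln (real q))"
  proof (rule sum_mono2)
    show "finite (Sigma (rough y x) (\<lambda>m. ?P (x / real m)))" by (intro finite_SigmaI) auto
    show "(\<lambda>(n,q). (n div q, q)) ` ?S \<subseteq> Sigma (rough y x) (\<lambda>m. ?P (x / real m))"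
    proof (rule subsetI)
      fix z assume "z \<in> (\<lambda>(n,q). (n div q, q)) ` ?S"
      then obtain n q where z: "z = (n div q, q)" and n: "n \<in> rough y x" and q: "q \<in># prime_factorization n"
        by auto
      have q': "prime q" "q dvd n" "q > 0" using q by (auto intro: prime_gt_0_nat)
      have n': "n \<ge> 1" "squarefree n" "real n \<le> x" using n by (auto simp: rough_def)
      have d: "n div q > 0" using q' n' by (auto simp: div_greater_zero_iff dvd_imp_le)
      have "real (n div q) * real q = real n" using q' by (metis dvd_div_mult_self of_nat_mult)
      then have 1: "real q \<le> x / real (n div q)" using d n' by (simp add: field_simps)
      have "real (n div q) \<le> real n" by (intro of_nat_mono div_le_dividend)
      then have "real (n div q) \<le> x" using n' by linarith
      moreover have "squarefree (n div q)" using n' q' by (intro squarefree_div)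
      moreover have "prime_factors (n div q) \<subseteq> prime_factors n" using n' q' by (intro prime_factors_div_subset) auto
      ultimately have "n div q \<in> rough y x" using d n unfolding rough_def by auto
      then show "z \<in> Sigma (rough y x) (\<lambda>m. ?P (x / real m))" using 1 q' z by auto
    qed
    fix z assume "z \<in> Sigma (rough y x) (\<lambda>m. ?P (x / real m)) - (\<lambda>(n,q). (n div q, q)) ` ?S"
    then obtain m q where "z = (m, q)" "prime q" by blast
    then show "0 \<le> (case z of (m, q) \<Rightarrow> ln (real q))" using prime_gt_0_nat[of q] by simp
  qed
  also have "\<dots> = (\<Sum>m\<in>rough y x. \<Sum>q\<in>?P (x / real m). ln (real q))" by (subst sum.Sigma) auto
  also have "\<dots> \<le> (\<Sum>m\<in>rough y x. ln 4 * (x / real m))"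
    using assms by (intro sum_mono theta_le) auto
  also have "\<dots> = ln 4 * x * (\<Sum>m\<in>rough y x. 1 / real m)"
    by (simp add: sum_distrib_left)
  finally show ?thesis .
qed

text \<open>This is the upper bound sieve. The sum of \<open>ln n\<close> is at most a multiple of
  \<open>x\<close> times the sum of reciprocals, which by Mertens is of order
  \<open>ln x / ln y\<close>; since all \<open>n > sqrt x\<close> have
  \<open>ln n \<ge> ln x / 2\<close>, the factor \<open>ln x\<close> cancels.\<close>

lemma card_rough_le:
  assumes "2 \<le> y" "y \<le> x"
  shows "real (card (rough y x)) \<le> (2 + 4 * exp 6) * x / ln y"
proof -
  have ly: "ln y > 0" "ln x > 0" "ln y \<le> ln x" using assms by auto
  have "(\<Sum>m\<in>rough y x. 1 / real m) \<le> exp (ln (ln x) - ln (ln y) + 6)"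
    using sum_recip_rough_le sum_prime_recip_between[OF assms] by (meson exp_le_cancel_iff order_trans)
  also have "\<dots> = exp 6 * ln x / ln y" using ly by (simp add: exp_add exp_diff)
  finally have 1: "(\<Sum>m\<in>rough y x. 1 / real m) \<le> exp 6 * ln x / ln y" .
  have ln4: "ln (4::real) \<le> 2" using ln_realpow[of "2::real" 2] ln_2_less_1 by simp
  have "(\<Sum>n\<in>rough y x. ln (real n)) \<le> ln 4 * x * (\<Sum>m\<in>rough y x. 1 / real m)"
    using assms by (intro sum_ln_rough_le) auto
  also have "\<dots> \<le> 2 * x * (exp 6 * ln x / ln y)"
    using 1 ln4 assms ly by (intro mult_mono) (auto intro!: sum_nonneg)
  finally have 2: "(\<Sum>n\<in>rough y x. ln (real n)) \<le> 2 * x * (exp 6 * ln x / ln y)" .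
  let ?A = "{n\<in>rough y x. real n \<le> sqrt x}" and ?B = "{n\<in>rough y x. real n > sqrt x}"
  have "card ?A \<le> card {1..nat \<lfloor>sqrt x\<rfloor>}"
    by (rule card_mono) (auto simp: le_nat_floor rough_def)
  also have "\<dots> = nat \<lfloor>sqrt x\<rfloor>" by simp
  finally have "real (card ?A) \<le> real (nat \<lfloor>sqrt x\<rfloor>)" by (rule of_nat_mono)
  also have "\<dots> \<le> sqrt x" using assms by simp
  also have "\<dots> \<le> 2 * x / ln x"
  proof -
    have "sqrt x * ln x \<le> sqrt x * (2 * sqrt x)"
      using ln_le_2_sqrt[of x] assms by (intro mult_left_mono) auto
    also have "\<dots> = 2 * x" using assms by simp
    finally show ?thesis using ly by (simp add: field_simps)
  qed
  also have "\<dots> \<le> 2 * x / ln y" using ly assms by (intro divide_left_mono) auto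
  finally have A: "real (card ?A) \<le> 2 * x / ln y" .
  have "real (card ?B) * (ln x / 2) = (\<Sum>n\<in>?B. ln x / 2)" by simp
  also have "\<dots> \<le> (\<Sum>n\<in>?B. ln (real n))"
  proof (rule sum_mono)
    fix n assume "n \<in> ?B"
    then have "ln (sqrt x) \<le> ln (real n)" using assms by (intro ln_mono) (auto simp: rough_def)
    then show "ln x / 2 \<le> ln (real n)" using assms by (simp add: ln_sqrt)
  qed
  also have "\<dots> \<le> (\<Sum>n\<in>rough y x. ln (real n))" by (rule sum_mono2) (auto simp: rough_def)
  also note 2
  finally have B: "real (card ?B) \<le> 4 * exp 6 * x / ln y" using ly by (simp add: field_simps)
  have "card (rough y x) \<le> card (?A \<union> ?B)" by (rule card_mono) auto
  also have "\<dots> \<le> card ?A + card ?B" by (rule card_Un_le)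
  finally have "real (card (rough y x)) \<le> real (card ?A) + real (card ?B)" by linarith
  also have "\<dots> \<le> 2 * x / ln y + 4 * exp 6 * x / ln y" using A B by linarith
  also have "\<dots> = (2 + 4 * exp 6) * x / ln y" by (simp add: algebra_simps add_divide_distrib)
  finally show ?thesis .
qed

section \<open>The Moebius sum over integers free of given primes\<close>

lemma abs_moebius_mu_le: "\<bar>moebius_mu n\<bar> \<le> 1"
  by (simp add: moebius_mu_def power_abs)

lemma moebius_mu_prime_mult:
  assumes "prime q" "b > 0"
  shows "moebius_mu (q * b) = (if q dvd b then 0 else - moebius_mu b)"
proof (cases "q dvd b")
  case True
  then have "q\<^sup>2 dvd q * b" by (simp add: power2_eq_square)
  then have "\<not> squarefree (q * b)" using assms(1) not_prime_unit by (intro not_squarefreeI) auto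
  then show ?thesis using True by (simp add: moebius_mu_def)
next
  case False
  then have cop: "coprime q b" using assms by (simp add: prime_imp_coprime)
  have sq: "squarefree (q * b) \<longleftrightarrow> squarefree b"
    using squarefree_mult_coprime[OF cop] squarefree_prime[OF assms(1)] squarefree_mono[of b "q * b"] by auto
  have "prime_factors (q * b) = insert q (prime_factors b)"
    using assms by (subst prime_factors_product) (auto simp: prime_prime_factors)
  moreover have "q \<notin> prime_factors b" using False by auto
  ultimately show ?thesis using False sq by (simp add: moebius_mu_def)
qed

definition free_of :: "nat set \<Rightarrow> nat set" where
  "free_of T = {n. n \<ge> 1 \<and> (\<forall>q\<in>T. \<not> q dvd n)}"

lemma multiples_free_of:
  assumes q: "prime q" "q \<notin> T" and T: "\<And>r. r \<in> T \<Longrightarrow> prime r"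
  shows "{n\<in>free_of T. q dvd n} = (*) q ` free_of T"
proof (intro equalityI subsetI)
  fix n assume n: "n \<in> {n\<in>free_of T. q dvd n}"
  then obtain m where m: "n = q * m" by (auto elim: dvdE)
  have "m \<in> free_of T" using n unfolding m free_of_def by auto
  then show "n \<in> (*) q ` free_of T" using m by auto
next
  fix n assume "n \<in> (*) q ` free_of T"
  then obtain m where m: "n = q * m" "m \<in> free_of T" by auto
  have "\<not> r dvd q * m" if "r \<in> T" for r
  proof -
    have "\<not> r dvd q" using that T q primes_dvd_imp_eq by blast
    moreover have "\<not> r dvd m" using m that by (auto simp: free_of_def)
    ultimately show ?thesis using T[OF that] by (simp add: prime_dvd_mult_iff)
  qed
  then show "n \<in> {n\<in>free_of T. q dvd n}" using m q prime_gt_0_nat by (auto simp: free_of_def Suc_le_eq)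
qed

definition free_upto :: "nat set \<Rightarrow> real \<Rightarrow> nat set" where
  "free_upto T X = {b. 1 \<le> b \<and> real b \<le> X \<and> (\<forall>q\<in>T. \<not> q dvd b)}"

lemma free_upto_eq: "free_upto T X = {n\<in>free_of T. real n \<le> X}"
  by (auto simp: free_upto_def free_of_def)

definition mertens_free :: "nat set \<Rightarrow> real \<Rightarrow> real" where
  "mertens_free T X = (\<Sum>b\<in>free_upto T X. of_int (moebius_mu b))"

lemma finite_free_upto [simp]: "finite (free_upto T X)"
  unfolding free_upto_def by (rule finite_subset[of _ "{..nat \<lfloor>X\<rfloor>}"]) (auto simp: le_nat_floor)

text \<open>With \<open>n = q * m\<close>, \<mu> vanishes when \<open>q\<close> divides
  \<open>m\<close>, so multiples of \<open>q\<close> turn into integers that avoid \<open>q\<close>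
  as well, with a change of sign. The weight \<open>f\<close> is carried along because later sums
  contain \<omega> or divisibility conditions.\<close>

lemma sum_moebius_multiples:
  fixes f :: "nat \<Rightarrow> real"
  assumes q: "prime q" "q \<notin> T" and T: "\<And>r. r \<in> T \<Longrightarrow> prime r"
  shows "(\<Sum>n | n \<in> free_upto T X \<and> q dvd n. of_int (moebius_mu n) * f n)
           = - (\<Sum>m\<in>free_upto (insert q T) (X / real q). of_int (moebius_mu m) * f (q * m))"
proof -
  have q0: "q > 0" using q prime_gt_0_nat by auto
  have mult: "{n\<in>free_of T. q dvd n} = (*) q ` free_of T"
    using q T by (rule multiples_free_of)
  have "{n. n \<in> free_upto T X \<and> q dvd n} = {n \<in> (*) q ` free_of T. real n \<le> X}"
    unfolding mult[symmetric] free_upto_eq by auto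
  also have "\<dots> = (*) q ` free_upto T (X / real q)"
  proof -
    have "real (q * n) \<le> X \<longleftrightarrow> real n \<le> X / real q" for n using q0 by (simp add: field_simps)
    moreover have "q * n \<in> free_of T" if "n \<in> free_of T" for n using that mult by blast
    ultimately show ?thesis by (auto simp: free_upto_eq simp del: of_nat_mult)
  qed
  finally have img: "{n. n \<in> free_upto T X \<and> q dvd n} = (*) q ` free_upto T (X / real q)" .
  have "(\<Sum>n | n \<in> free_upto T X \<and> q dvd n. of_int (moebius_mu n) * f n)
      = (\<Sum>m\<in>free_upto T (X / real q). of_int (moebius_mu (q * m)) * f (q * m))"
    unfolding img using q0 by (subst sum.reindex) (auto simp: inj_on_def)
  also have "\<dots> = (\<Sum>m\<in>free_upto (insert q T) (X / real q). of_int (moebius_mu (q * m)) * f (q * m))"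
    using q by (intro sum.mono_neutral_right) (auto simp: free_upto_def moebius_mu_prime_mult)
  also have "\<dots> = (\<Sum>m\<in>free_upto (insert q T) (X / real q). - (of_int (moebius_mu m) * f (q * m)))"
    using q by (intro sum.cong) (auto simp: free_upto_def moebius_mu_prime_mult)
  finally show ?thesis by (simp add: sum_negf)
qed

text \<open>The recursion behind Rankin's trick: iterated, it writes the sum avoiding
  \<open>q\<close> as the sum over \<open>k\<close> of \<open>mertens_free T (X / q ^ k)\<close>,
  and this is a geometric series once the bound for \<open>T\<close> is a power of the
  argument.\<close>

lemma mertens_free_insert:
  assumes q: "prime q" "q \<notin> T" and T: "\<And>r. r \<in> T \<Longrightarrow> prime r"
  shows "mertens_free (insert q T) X = mertens_free T X + mertens_free (insert q T) (X / real q)"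
proof -
  have "free_upto T X = free_upto (insert q T) X \<union> {n. n \<in> free_upto T X \<and> q dvd n}"
    by (auto simp: free_upto_def)
  moreover have "free_upto (insert q T) X \<inter> {n. n \<in> free_upto T X \<and> q dvd n} = {}"
    by (auto simp: free_upto_def)
  ultimately have "mertens_free T X = mertens_free (insert q T) X + (\<Sum>n | n \<in> free_upto T X \<and> q dvd n. of_int (moebius_mu n))"
    unfolding mertens_free_def by (metis (no_types, lifting) sum.union_disjoint finite_Un finite_free_upto)
  then show ?thesis
    using sum_moebius_multiples[OF q T, where X = X and f = "\<lambda>_. 1"] by (simp add: mertens_free_def)
qed

lemma free_upto_empty: "X < 1 \<Longrightarrow> free_upto T X = {}"
  by (auto simp: free_upto_def)

lemma abs_mertens_free_le_card:
  "\<bar>mertens_free T X\<bar> \<le> real (card (free_upto T X))"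
proof -
  have "\<bar>mertens_free T X\<bar> \<le> (\<Sum>b\<in>free_upto T X. \<bar>of_int (moebius_mu b)\<bar>)"
    unfolding mertens_free_def by (rule sum_abs)
  also have "\<dots> \<le> (\<Sum>b\<in>free_upto T X. 1)"
  proof (rule sum_mono)
    fix b show "\<bar>of_int (moebius_mu b) :: real\<bar> \<le> 1" using abs_moebius_mu_le[of b] by linarith
  qed
  finally show ?thesis by simp
qed

lemma abs_mertens_free_le:
  assumes "X \<ge> 0"
  shows "\<bar>mertens_free T X\<bar> \<le> X"
proof -
  have "card (free_upto T X) \<le> card {1..nat \<lfloor>X\<rfloor>}"
    by (rule card_mono) (auto simp: free_upto_def le_nat_floor)
  also have "\<dots> = nat \<lfloor>X\<rfloor>" by simp
  finally have "real (card (free_upto T X)) \<le> real (nat \<lfloor>X\<rfloor>)" by (rule of_nat_mono)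
  also have "\<dots> \<le> X" using assms by simp
  finally show ?thesis using abs_mertens_free_le_card[of T X] by linarith
qed

text \<open>Rankin's trick in inductive form: removing one prime \<open>q\<close> at a time costs a geometric series
  with ratio \<open>q powr (d - 1)\<close>.\<close>

lemma mertens_free_rankin:
  fixes K d X :: real
  assumes "finite T" and T: "\<And>r. r \<in> T \<Longrightarrow> prime r" and X: "X > 0" and d: "d < 1" and K: "K \<ge> 0"
    and base: "\<And>z. z \<ge> 1 \<Longrightarrow> \<bar>mertens_free {} (X / z)\<bar> \<le> K * z powr (d - 1)"
    and "z \<ge> 1"
  shows "\<bar>mertens_free T (X / z)\<bar> \<le> K * z powr (d - 1) * (\<Prod>q\<in>T. 1 / (1 - real q powr (d - 1)))"
  using assms(1) T \<open>z \<ge> 1\<close>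
proof (induction T arbitrary: z rule: finite_induct)
  case empty
  then show ?case using base by simp
next
  case (insert q T)
  define P where "P = (\<Prod>q\<in>T. 1 / (1 - real q powr (d - 1)))"
  define \<rho> where "\<rho> = real q powr (d - 1)"
  have q: "prime q" using insert by auto
  then have q2: "real q \<ge> 2" using prime_ge_2_nat by force
  have \<rho>: "0 < \<rho>" "\<rho> < 1"
    unfolding \<rho>_def using q2 d by (auto intro: powr_less_one)
  have lt1: "real r powr (d - 1) < 1" if "r \<in> T" for r
  proof -
    have "prime r" using that insert by auto
    then have "real r \<ge> 2" using prime_ge_2_nat by force
    then show ?thesis using d by (intro powr_less_one) auto
  qed
  have P: "P \<ge> 0" unfolding P_def by (intro prod_nonneg) (use lt1 in \<open>auto simp: less_imp_le\<close>)
  \<comment> \<open>An inner induction for fixed \<open>q\<close>: division by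
    \<open>q \<ge> 2\<close> lowers the integer part of \<open>X / z\<close> as long as it is
    positive, and below 1 the sum is empty.\<close>
  have "\<bar>mertens_free (insert q T) (X / z)\<bar> \<le> K * z powr (d - 1) * (P / (1 - \<rho>))" if "z \<ge> 1" for z
    using that
  proof (induction "nat \<lfloor>X / z\<rfloor>" arbitrary: z rule: less_induct)
    case less
    show ?case
    proof (cases "X / z < 1")
      case True
      then have "mertens_free (insert q T) (X / z) = 0" by (simp add: mertens_free_def free_upto_empty)
      then show ?thesis using K P \<rho> by simp
    next
      case False
      have zq: "z * real q \<ge> 1" using less(2) q2 mult_mono[of 1 z 1 "real q"] by simp
      have "X / (z * real q) \<le> (X / z) / 2" using q2 X less(2) by (simp add: field_simps)
      moreover have "nat \<lfloor>v\<rfloor> < nat \<lfloor>u\<rfloor>" if "v \<le> u / 2" "1 \<le> u" for u v :: real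
      proof (cases "u \<ge> 2")
        case True
        then show ?thesis using that by linarith
      next
        case False
        then have "\<lfloor>v\<rfloor> < 1" "1 \<le> \<lfloor>u\<rfloor>" using that by (simp_all add: floor_less_iff le_floor_iff)
        then show ?thesis by linarith
      qed
      ultimately have "nat \<lfloor>X / (z * real q)\<rfloor> < nat \<lfloor>X / z\<rfloor>" using False by (meson not_le)
      from less(1)[OF this zq]
      have 1: "\<bar>mertens_free (insert q T) (X / (z * real q))\<bar> \<le> K * (z * real q) powr (d - 1) * (P / (1 - \<rho>))" .
      have 2: "\<bar>mertens_free T (X / z)\<bar> \<le> K * z powr (d - 1) * P"
        unfolding P_def using insert less(2) by auto
      have "mertens_free (insert q T) (X / z) = mertens_free T (X / z) + mertens_free (insert q T) (X / (z * real q))"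
        using mertens_free_insert[of q T "X / z"] insert q by simp
      then have "\<bar>mertens_free (insert q T) (X / z)\<bar> \<le> K * z powr (d - 1) * P + K * (z * real q) powr (d - 1) * (P / (1 - \<rho>))"
        using 1 2 by linarith
      also have "(z * real q) powr (d - 1) = z powr (d - 1) * \<rho>" using less(2) by (simp add: powr_mult \<rho>_def)
      \<comment> \<open>The geometric series closes up, since
        \<open>P + \<rho> * (P / (1 - \<rho>)) = P / (1 - \<rho>)\<close>.\<close>
      also have "K * z powr (d - 1) * P + K * (z powr (d - 1) * \<rho>) * (P / (1 - \<rho>)) = K * z powr (d - 1) * (P / (1 - \<rho>))"
        using \<rho> by (simp add: field_simps)
      finally show ?thesis .
    qed
  qed
  from this[OF insert.prems(2)] show ?case
    using insert by (simp add: P_def \<rho>_def mult.commute)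
qed

text \<open>As \<open>d\<close> is of size \<open>1 / ln p\<close>, every prime
  \<open>q \<le> p\<close> has \<open>q powr d \<le> exp (1/4)\<close>, so the product stays within
  a fixed power of the Mertens product at \<open>d = 0\<close>. The extra primes in \<open>Q\<close>
  may be of any size; each costs a factor of at most 4 because
  \<open>q powr (d - 1) \<le> 3/4\<close> for all primes.\<close>

lemma euler_factor_le:
  fixes p :: nat
  assumes "p \<ge> 2" "T = {q. prime q \<and> q \<le> p} \<union> Q" "finite Q" "card Q \<le> 2" "\<And>q. q \<in> Q \<Longrightarrow> prime q"
  defines "d \<equiv> 1 / (4 * (ln (real p) + 1))"
  shows "(\<Prod>q\<in>T. 1 / (1 - real q powr (d - 1))) \<le> 16 * exp 48 * (ln (real p) + 1) ^ 6"
proof -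
  have lp: "ln (real p) > 0" using assms by simp
  have d: "d > 0" "d \<le> 1/4" unfolding d_def using lp by (auto simp: field_simps)
  have z34: "real q powr (d - 1) \<le> 3/4" if "prime q" for q :: nat
  proof -
    have q2: "real q \<ge> 2" using prime_ge_2_nat[OF that] by simp
    have "real q powr (d - 1) \<le> real q powr (-(1/2))" using q2 d by (intro powr_mono) auto
    also have "\<dots> \<le> 2 powr (-(1/2))" using q2 by (intro powr_mono2') auto
    also have "\<dots> = 1 / sqrt 2" by (simp add: powr_minus powr_half_sqrt inverse_eq_divide)
    also have "\<dots> \<le> 3/4"
    proof -
      have "(4/3)\<^sup>2 \<le> (2::real)" by (simp add: power2_eq_square)
      then have "4/3 \<le> sqrt (2::real)" by (intro real_le_rsqrt)
      then show ?thesis by (simp add: field_simps)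
    qed
    finally show ?thesis .
  qed
  have finT: "finite {q::nat. prime q \<and> q \<le> p}" using finite_primes_le[of "real p"] by simp
  let ?g = "\<lambda>q. 1 / (1 - real q powr (d - 1))"
  have g1: "?g q \<ge> 1" "?g q \<le> 4" if "prime q" for q using z34[OF that] by (auto simp: field_simps)
  have z1: "real q powr (d - 1) \<le> 1" if "prime q" for q :: nat using z34[OF that] by simp
  have exp14: "exp (1/4::real) \<le> 4/3"
  proof -
    have "1 + (-(1/4)) \<le> exp (-(1/4)::real)" by (rule exp_ge_add_one_self)
    then have "3/4 \<le> 1 / exp (1/4::real)" by (simp add: exp_minus inverse_eq_divide)
    then show ?thesis by (simp add: field_simps)
  qed
  \<comment> \<open>From \<open>1 / (1 - z) \<le> 1 + 4 * z\<close> on [0, 3/4] and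
    \<open>z \<le> 4 / (3 * q)\<close> comes the exponent \<open>16 / (3 * q)\<close>, rounded up to
    \<open>6 / q\<close>. This 6 becomes the power of \<open>ln p\<close> in the result.\<close>
  have small: "?g q \<le> exp (6 / real q)" if q: "prime q" "q \<le> p" for q
  proof -
    define z where "z = real q powr (d - 1)"
    have q0: "real q \<ge> 2" using prime_ge_2_nat[OF q(1)] by simp
    have "real q powr d = exp (d * ln (real q))" using q0 by (simp add: powr_def)
    also have "d * ln (real q) \<le> d * (ln (real p) + 1)"
    proof -
      have "ln (real q) \<le> ln (real p)" using q0 q(2) by (intro ln_mono) auto
      then show ?thesis using d by (intro mult_left_mono) auto
    qed
    also have "d * (ln (real p) + 1) = 1/4" unfolding d_def using lp by simp
    finally have "real q powr d \<le> 4/3" using exp14 by simp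
    moreover have "z = real q powr d / real q" unfolding z_def using q0 by (simp add: powr_diff)
    ultimately have z: "z \<le> 4 / (3 * real q)" using q0 by (simp add: field_simps)
    have z0: "0 \<le> z" "z \<le> 3/4" unfolding z_def using z34[OF q(1)] by auto
    have "1 / (1 - z) \<le> 1 + 4 * z" 
    proof -
      have "z * (3 - 4 * z) \<ge> 0" using z0 by (intro mult_nonneg_nonneg) auto
      then have "1 \<le> (1 + 4 * z) * (1 - z)" by (simp add: algebra_simps)
      then show ?thesis using z0 by (simp add: pos_divide_le_eq)
    qed
    also have "\<dots> \<le> exp (4 * z)" by (rule exp_ge_add_one_self)
    also have "\<dots> \<le> exp (6 / real q)" using z q0 by (simp add: field_simps)
    finally show ?thesis by (simp add: z_def)
  qed
  have e2: "(\<Prod>q\<in>Q - {q. prime q \<and> q \<le> p}. 4::real) \<le> 16"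
  proof -
    have "card (Q - {q. prime q \<and> q \<le> p}) \<le> card Q" using assms by (intro card_mono) auto
    then have "(4::real) ^ card (Q - {q. prime q \<and> q \<le> p}) \<le> 4 ^ 2" using assms by (intro power_increasing) auto
    then show ?thesis by simp
  qed
  have "(\<Prod>q\<in>{q. prime q \<and> q \<le> p}. exp (6 / real q)) = exp (6 * (\<Sum>q | prime q \<and> q \<le> p. 1 / real q))"
    using finT by (simp add: exp_sum sum_distrib_left)
  also have "\<dots> \<le> exp (6 * (ln (ln (real p)) + 8))"
    using sum_prime_recip_le[of "real p"] assms by simp
  also have "\<dots> = (ln (real p)) ^ 6 * exp 48"
  proof -
    have "exp (6 * ln (ln (real p))) = (ln (real p)) ^ 6"
      using lp exp_of_nat_mult[of 6 "ln (ln (real p))"] by simp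
    then show ?thesis by (simp add: exp_add ring_distribs)
  qed
  also have "\<dots> \<le> (ln (real p) + 1) ^ 6 * exp 48" using lp by (intro mult_right_mono power_mono) auto
  finally have e1: "(\<Prod>q\<in>{q. prime q \<and> q \<le> p}. exp (6 / real q)) \<le> (ln (real p) + 1) ^ 6 * exp 48" .
  have "(\<Prod>q\<in>T. ?g q) = (\<Prod>q\<in>{q. prime q \<and> q \<le> p}. ?g q) * (\<Prod>q\<in>Q - {q. prime q \<and> q \<le> p}. ?g q)"
  proof -
    have "T = {q. prime q \<and> q \<le> p} \<union> (Q - {q. prime q \<and> q \<le> p})" using assms by auto
    then show ?thesis using finT assms by (metis (no_types, lifting) Diff_disjoint finite_Diff prod.union_disjoint)
  qed
  also have "\<dots> \<le> (\<Prod>q\<in>{q. prime q \<and> q \<le> p}. exp (6 / real q)) * (\<Prod>q\<in>Q - {q. prime q \<and> q \<le> p}. 4)"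
    using small g1 z1 assms(1-5) by (intro mult_mono prod_mono conjI prod_nonneg) auto
  also have "\<dots> \<le> ((ln (real p) + 1) ^ 6 * exp 48) * 16"
    using e1 e2 lp by (intro mult_mono) (auto intro!: prod_nonneg)
  finally show ?thesis by (simp add: mult_ac)
qed

text \<open>Relaxing \<open>1 / z\<close> to \<open>z powr (d - 1)\<close> is harmless for
  \<open>z \<le> sqrt Y\<close>, where the bound for the full sum of \<mu> is strong, and for larger
  \<open>z\<close> the trivial bound gains \<open>Y powr (- d / 2)\<close>. The condition on
  \<open>ln Y\<close> makes this gain at least \<open>(ln x) ^ 8\<close>. The Euler factors take
  back six powers of \<open>ln Y\<close>.\<close>

lemma mertens_free_long:
  fixes p :: nat and Y L CM :: real
  assumes p: "p \<ge> 2" "T = {q. prime q \<and> q \<le> p} \<union> Q" "finite Q" "card Q \<le> 2" "\<And>q. q \<in> Q \<Longrightarrow> prime q"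
    and CM: "CM \<ge> 0" "\<And>t. t \<ge> 2 \<Longrightarrow> \<bar>mertens_free {} t\<bar> \<le> CM * t / (ln t) ^ 8"
    and Y: "Y \<ge> 4" "Y \<le> x" "ln Y \<ge> 64 * ln (ln x) * (ln (real p) + 1)" "ln (ln x) \<ge> 1"
  shows "\<bar>mertens_free T Y\<bar> \<le> 16 * exp 48 * (256 * CM + 1) * Y / (ln Y)\<^sup>2"
proof -
  define L where "L = ln (real p) + 1"
  define d where "d = 1 / (4 * L)"
  have lp: "ln (real p) > 0" using p by simp
  have L: "L > 1" unfolding L_def using lp by simp
  have d: "d > 0" "d < 1" unfolding d_def using L by (auto simp: field_simps)
  have lY: "ln Y > 1" using Y(3,4) L mult_mono[of 1 "ln (ln x)" 1 L] unfolding L_def[symmetric] by simp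
  have lx: "ln x > 0" using lY Y by (smt (verit) ln_mono)
  \<comment> \<open>One quantity for both ranges of \<open>z\<close>: \<open>256 = 2 ^ 8\<close>
    stems from \<open>ln (Y / z) \<ge> ln Y / 2\<close> when \<open>z \<le> sqrt Y\<close>, the
    power of \<open>Y\<close> from the trivial bound beyond.\<close>
  define W where "W = CM * 256 / (ln Y) ^ 8 + Y powr (- d / 2)"
  have W0: "W \<ge> 0" unfolding W_def using CM lY by simp
  have fin: "finite T" using p finite_primes_le[of "real p"] by simp
  have base: "\<bar>mertens_free {} (Y / z)\<bar> \<le> (Y * W) * z powr (d - 1)" if z: "z \<ge> 1" for z
  proof (cases "z \<le> sqrt Y")
    case True
    have sq: "sqrt Y \<le> Y / z" 
    proof -
      have "sqrt Y * z \<le> sqrt Y * sqrt Y" using True Y by (intro mult_left_mono) auto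
      then show ?thesis using z Y by (simp add: pos_le_divide_eq)
    qed
    have s2: "sqrt Y \<ge> 2" using Y real_le_rsqrt[of 2 Y] by simp
    have l: "ln (Y / z) \<ge> ln Y / 2"
    proof -
      have "ln (sqrt Y) \<le> ln (Y / z)" using sq s2 Y(1) by (intro ln_mono) auto
      then show ?thesis using Y by (simp add: ln_sqrt)
    qed
    have "\<bar>mertens_free {} (Y / z)\<bar> \<le> CM * (Y / z) / (ln (Y / z)) ^ 8"
      using sq s2 by (intro CM(2)) linarith
    also have "\<dots> \<le> CM * (Y / z) / (ln Y / 2) ^ 8"
    proof (rule divide_left_mono)
      show "(ln Y / 2) ^ 8 \<le> ln (Y / z) ^ 8" using l lY by (intro power_mono) auto
      show "0 \<le> CM * (Y / z)" using CM Y z by simp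
      show "0 < ln (Y / z) ^ 8 * (ln Y / 2) ^ 8" using l lY by simp
    qed
    also have "\<dots> = Y * (CM * 256 / (ln Y) ^ 8) * (1 / z)" by (simp add: power_divide mult_ac)
    also have "\<dots> \<le> Y * W * z powr (d - 1)"
    proof (intro mult_mono)
      show "1 / z \<le> z powr (d - 1)" using z d powr_mono[of "-1" "d - 1" z] by (simp add: powr_minus inverse_eq_divide)
    qed (use Y CM lY z W0 in \<open>auto simp: W_def\<close>)
    finally show ?thesis .
  next
    case False
    have zY: "z \<ge> sqrt Y" using False by simp
    have "\<bar>mertens_free {} (Y / z)\<bar> \<le> Y / z" using Y z by (intro abs_mertens_free_le) auto
    also have "\<dots> = Y * (z powr (- d) * z powr (d - 1))"
      using z by (simp add: powr_minus powr_diff field_simps)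
    also have "\<dots> \<le> Y * (W * z powr (d - 1))"
    proof (intro mult_left_mono mult_right_mono)
      have "z powr (- d) \<le> (sqrt Y) powr (- d)" using zY Y d by (intro powr_mono2') auto
      also have "\<dots> = Y powr (- d / 2)" using Y by (simp add: powr_half_sqrt[symmetric] powr_powr)
      also have "\<dots> \<le> W" unfolding W_def using CM lY by simp
      finally show "z powr (- d) \<le> W" .
    qed (use Y in auto)
    finally show ?thesis by (simp add: mult_ac)
  qed
  have "\<bar>mertens_free T (Y / 1)\<bar> \<le> (Y * W) * 1 powr (d - 1) * (\<Prod>q\<in>T. 1 / (1 - real q powr (d - 1)))"
    using fin p Y d W0 base by (intro mertens_free_rankin) auto
  also have "\<dots> \<le> (Y * W) * (16 * exp 48 * L ^ 6)"
    using euler_factor_le[OF p] W0 Y unfolding d_def[symmetric] L_def[symmetric] by (simp add: mult_left_mono)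
  also have "\<dots> \<le> Y * ((256 * CM + 1) / (ln Y) ^ 8) * (16 * exp 48 * (ln Y) ^ 6)"
  proof (intro mult_mono)
    have "Y powr (- d / 2) = exp (- (ln Y / (8 * L)))" using Y by (simp add: powr_def d_def)
    \<comment> \<open>Since \<open>d / 2 = 1 / (8 * L)\<close>, the constant 64 in the hypothesis is
      what produces the eighth power of \<open>ln x\<close>.\<close>
    also have "\<dots> \<le> exp (- (8 * ln (ln x)))"
      using Y(3) L unfolding L_def[symmetric] by (simp add: field_simps)
    also have "\<dots> = 1 / (ln x) ^ 8"
      using lx exp_of_nat_mult[of 8 "ln (ln x)"] by (simp add: exp_minus inverse_eq_divide)
    also have "\<dots> \<le> 1 / (ln Y) ^ 8"
      using lY Y by (intro divide_left_mono power_mono ln_mono) auto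
    finally show "W \<le> (256 * CM + 1) / (ln Y) ^ 8" unfolding W_def by (simp add: add_divide_distrib mult.commute)
    have "L \<le> 64 * ln (ln x) * L" using Y(4) L by simp
    then have "L \<le> ln Y" using Y(3) unfolding L_def by linarith
    then show "L ^ 6 \<le> (ln Y) ^ 6" using L by (intro power_mono) auto
  qed (use Y W0 CM lY L in auto)
  also have "\<dots> = 16 * exp 48 * (256 * CM + 1) * Y / (ln Y)\<^sup>2"
    using lY by (simp add: divide_simps power_add[symmetric])
  finally show ?thesis by simp
qed

text \<open>Only squarefree \<open>b\<close> count, and free of all primes up to \<open>p\<close>
  they are rough, so the sieve applies for \<open>Y \<ge> p\<close>. For smaller \<open>Y\<close>
  just \<open>b = 1\<close> can be left, whence the summand 1.\<close>

lemma mertens_free_short: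
  fixes p :: nat
  assumes p: "p \<ge> 2" "{q. prime q \<and> q \<le> p} \<subseteq> T" and Y: "Y \<ge> 0"
  shows "\<bar>mertens_free T Y\<bar> \<le> 1 + (2 + 4 * exp 6) * Y / ln (real p)"
proof -
  have lp: "ln (real p) > 0" using p by simp
  let ?S = "{b\<in>free_upto T Y. squarefree b}"
  have "mertens_free T Y = (\<Sum>b\<in>?S. of_int (moebius_mu b))"
    unfolding mertens_free_def by (rule sum.mono_neutral_right) (auto simp: moebius_mu_def)
  then have "\<bar>mertens_free T Y\<bar> \<le> (\<Sum>b\<in>?S. \<bar>of_int (moebius_mu b)\<bar>)" by (simp only: sum_abs)
  also have "\<dots> \<le> (\<Sum>b\<in>?S. 1)"
  proof (rule sum_mono)
    fix b show "\<bar>of_int (moebius_mu b) :: real\<bar> \<le> 1" using abs_moebius_mu_le[of b] by linarith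
  qed
  finally have 1: "\<bar>mertens_free T Y\<bar> \<le> real (card ?S)" by simp
  have gt: "p < q" if "b \<in> ?S" "q \<in> prime_factors b" for b q
  proof (rule ccontr)
    assume "\<not> p < q"
    then have "q \<in> T" using that p by auto
    then show False using that by (auto simp: free_upto_def)
  qed
  show ?thesis
  proof (cases "Y \<ge> real p")
    case True
    have "?S \<subseteq> rough (real p) Y" using gt by (auto simp: rough_def free_upto_def)
    then have "real (card ?S) \<le> real (card (rough (real p) Y))" by (intro of_nat_mono card_mono) auto
    also have "\<dots> \<le> (2 + 4 * exp 6) * Y / ln (real p)" using p True by (intro card_rough_le) auto
    finally show ?thesis using 1 by linarith
  next
    case False
    have "?S \<subseteq> {1}"
    proof
      fix b assume b: "b \<in> ?S"
      show "b \<in> {1}"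
      proof (rule ccontr)
        assume "b \<notin> {1}"
        then obtain q where q: "prime q" "q dvd b" using prime_factor_nat[of b] by auto
        have b0: "b > 0" "real b \<le> Y" using b by (auto simp: free_upto_def)
        then have "p < q" using gt[OF b] q by (auto simp: prime_factors_dvd)
        moreover have "q \<le> b" using q b0 by (auto intro: dvd_imp_le)
        ultimately show False using b0 False by linarith
      qed
    qed
    then have "card ?S \<le> 1" using card_mono[of "{1::nat}" ?S] by simp
    moreover have "(2 + 4 * exp 6) * Y / ln (real p) \<ge> 0" using lp Y by simp
    ultimately show ?thesis using 1 by linarith
  qed
qed

section \<open>Summation over the prime factors\<close>

lemma sum_inverse_squares_le: "(\<Sum>v=1..n. 1 / (real v)\<^sup>2) \<le> 2"
proof -
  have "(\<Sum>v=1..n. 1 / (real v)\<^sup>2) \<le> 2 - 1 / real n" if "n \<ge> 1"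
    using that
  proof (induction n rule: dec_induct)
    case (step n)
    have "1 / (real (Suc n))\<^sup>2 \<le> 1 / (real n * real (Suc n))"
      using step by (intro divide_left_mono) (auto simp: power2_eq_square)
    also have "\<dots> = 1 / real n - 1 / real (Suc n)" using step by (simp add: field_simps)
    finally have "1 / (real (Suc n))\<^sup>2 \<le> 1 / real n - 1 / real (Suc n)" .
    then show ?case using step by simp
  qed auto
  then show ?thesis by (cases "n \<ge> 1") (auto intro: order_trans)
qed

text \<open>The summands are grouped by \<open>\<lfloor>ln (X / a i)\<rfloor>\<close>.\<close>

lemma sum_by_counting:
  fixes a G :: "'i \<Rightarrow> real" and X K C l v0 :: real
  assumes I: "finite I" "\<And>i. i \<in> I \<Longrightarrow> 1 \<le> a i \<and> a i \<le> X"
    and N: "\<And>t. 1 \<le> t \<Longrightarrow> t \<le> X \<Longrightarrow> real (card {i\<in>I. a i \<le> t}) \<le> K * t / (1 + ln t)"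
    and G1: "\<And>i. i \<in> I \<Longrightarrow> G i \<le> 1 + C * (X / a i) / l"
    and G2: "\<And>i. i \<in> I \<Longrightarrow> ln (X / a i) \<ge> v0 \<Longrightarrow> G i \<le> C * (X / a i) / (ln (X / a i))\<^sup>2"
    and par: "C \<ge> 0" "K \<ge> 0" "l > 0" "v0 \<ge> 1" "2 * v0 \<le> ln X" "X > 0"
  shows "(\<Sum>i\<in>I. G i) \<le> exp 1 * K * X / ln X * (2 + 4 * C * (v0 / l) + 8 * C)"
proof -
  define V where "V = nat \<lfloor>ln X\<rfloor>"
  define cl where "cl i = nat \<lfloor>ln (X / a i)\<rfloor>" for i
  have LX: "ln X \<ge> 2" using par by simp
  have X1: "1 < X" using LX ln_gt_zero_iff[of X] par by linarith
  have V: "real V \<le> ln X" "ln X < real V + 1" unfolding V_def using LX by linarith+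
  have lnY: "0 \<le> ln (X / a i)" "ln (X / a i) \<le> ln X" if "i \<in> I" for i
    using I(2)[OF that] par by (auto intro!: ln_mono simp: field_simps)
  have cl: "real (cl i) \<le> ln (X / a i)" "ln (X / a i) < real (cl i) + 1" if "i \<in> I" for i
    unfolding cl_def using lnY[OF that] by linarith+
  have clV: "cl i \<in> {0..V}" if "i \<in> I" for i
    using cl[OF that] lnY[OF that] V by auto
  \<comment> \<open>Every \<open>G i\<close> in class \<open>v\<close> is at most
    \<open>exp (v + 1) * g v\<close>. The summand 1 of the short bound is written as
    \<open>exp (v + 1) * exp (- v - 1)\<close> so that it shares this factor.\<close>
  define g where "g v = (if real v < v0 then exp (- real v - 1) + C / l else C / (real v)\<^sup>2)" for v :: nat
  have g0: "g v \<ge> 0" for v unfolding g_def using par by simp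
  have G: "G i \<le> exp (real v + 1) * g v" if i: "i \<in> I" "cl i = v" for i v
  proof -
    have Y: "X / a i > 0" using I(2)[OF i(1)] par by simp
    have "X / a i = exp (ln (X / a i))" using Y by simp
    also have "\<dots> \<le> exp (real v + 1)" using cl[OF i(1)] i(2) by simp
    finally have up: "X / a i \<le> exp (real v + 1)" .
    show ?thesis
    proof (cases "real v < v0")
      case True
      have "G i \<le> 1 + C * (X / a i) / l" using G1 i by auto
      also have "\<dots> \<le> 1 + C * exp (real v + 1) / l"
        using up par by (intro add_left_mono divide_right_mono mult_left_mono) auto
      also have "\<dots> = exp (real v + 1) * g v"
        using True by (simp add: g_def ring_distribs mult_exp_exp)
      finally show ?thesis .
    next
      case False
      have v0: "ln (X / a i) \<ge> v0" "ln (X / a i) \<ge> real v" "real v \<ge> 1" using False cl[OF i(1)] i par by auto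
      have "G i \<le> C * (X / a i) / (ln (X / a i))\<^sup>2" using G2[OF i(1) v0(1)] .
      also have "\<dots> \<le> C * exp (real v + 1) / (real v)\<^sup>2"
        using up par v0 Y by (intro frac_le mult_left_mono power_mono mult_nonneg_nonneg) auto
      finally show ?thesis using False by (simp add: g_def mult_ac)
    qed
  qed
  \<comment> \<open>Class \<open>v\<close> lies in \<open>a i \<le> X * exp (- v)\<close>, so its
    size carries a factor \<open>exp (- v)\<close> that cancels \<open>exp (v + 1)\<close> up to
    \<open>exp 1\<close>. What remains of a class is \<open>g v\<close> over the logarithm in the
    denominator.\<close>
  have cnt: "real (card {i\<in>I. cl i = v}) \<le> K * (X * exp (- real v)) / (1 + ln X - real v)" if v: "v \<le> V" for v
  proof -
    define t where "t = X * exp (- real v)"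
    have lt: "ln t = ln X - real v" unfolding t_def using par by (simp add: ln_mult)
    have "ln t \<ge> 0" using lt V v by simp
    then have t1: "1 \<le> t" unfolding t_def using par by simp
    have tX: "t \<le> X" unfolding t_def using par by simp
    have "{i\<in>I. cl i = v} \<subseteq> {i\<in>I. a i \<le> t}"
    proof safe
      fix i assume i: "i \<in> I" "v = cl i"
      have a: "a i > 0" using I(2)[OF i(1)] by simp
      have "ln (a i) \<le> ln t" using cl[OF i(1)] i lt a par by (simp add: ln_div)
      then show "a i \<le> t" using a t1 by simp
    qed
    then have "real (card {i\<in>I. cl i = v}) \<le> real (card {i\<in>I. a i \<le> t})"
      using I by (intro of_nat_mono card_mono) auto
    also have "\<dots> \<le> K * t / (1 + ln t)" using N t1 tX by auto
    finally show ?thesis unfolding lt by (simp add: t_def add_diff_eq)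
  qed
  have "(\<Sum>i\<in>I. G i) = (\<Sum>v\<in>{0..V}. \<Sum>i | i \<in> I \<and> cl i = v. G i)"
    using I clV by (intro sum.group[symmetric]) auto
  also have "\<dots> \<le> (\<Sum>v\<in>{0..V}. exp 1 * K * X * (g v / (1 + ln X - real v)))"
  proof (rule sum_mono)
    fix v assume v: "v \<in> {0..V}"
    have den: "1 + ln X - real v > 0" using v V by auto
    have "(\<Sum>i | i \<in> I \<and> cl i = v. G i) \<le> (\<Sum>i | i \<in> I \<and> cl i = v. exp (real v + 1) * g v)"
      using G by (intro sum_mono) auto
    also have "\<dots> = real (card {i\<in>I. cl i = v}) * (exp (real v + 1) * g v)" by simp
    also have "\<dots> \<le> K * (X * exp (- real v)) / (1 + ln X - real v) * (exp (real v + 1) * g v)"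
      using cnt v g0 by (intro mult_right_mono) auto
    also have "\<dots> = (exp (- real v) * exp (real v + 1)) * (K * X * (g v / (1 + ln X - real v)))"
      using den by (simp add: field_simps)
    also have "exp (- real v) * exp (real v + 1) = exp 1" by (simp add: mult_exp_exp)
    finally show "(\<Sum>i | i \<in> I \<and> cl i = v. G i) \<le> exp 1 * K * X * (g v / (1 + ln X - real v))" by (simp add: mult_ac)
  qed
  also have "\<dots> = exp 1 * K * X * (\<Sum>v\<in>{0..V}. g v / (1 + ln X - real v))" by (simp add: sum_distrib_left)
  also have "(\<Sum>v\<in>{0..V}. g v / (1 + ln X - real v)) \<le> (2 + 4 * C * (v0 / l) + 8 * C) / ln X"
  proof -
    define A where "A = {v\<in>{0..V}. real v < v0}"
    define B where "B = {v\<in>{0..V}. \<not> real v < v0}"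
    have AB: "{0..V} = A \<union> B" "A \<inter> B = {}" "finite A" "finite B" unfolding A_def B_def by auto
    \<comment> \<open>For \<open>v < v0 \<le> ln X / 2\<close> the denominator has full size. The
      terms \<open>exp (- v - 1)\<close> sum to at most 1, and there are at most
      \<open>v0 + 1 \<le> 2 * v0\<close> classes that pay \<open>C / l\<close>.\<close>
    have "(\<Sum>v\<in>A. g v / (1 + ln X - real v)) \<le> (\<Sum>v\<in>A. (2 / ln X) * (exp (- real v - 1) + C / l))"
    proof (rule sum_mono)
      fix v assume v: "v \<in> A"
      then have "ln X / 2 \<le> 1 + ln X - real v" using par by (auto simp: A_def)
      then have "g v / (1 + ln X - real v) \<le> g v / (ln X / 2)"
        using g0 LX by (intro divide_left_mono) auto
      then show "g v / (1 + ln X - real v) \<le> (2 / ln X) * (exp (- real v - 1) + C / l)"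
        using v by (simp add: g_def A_def mult.commute)
    qed
    also have "\<dots> = (2 / ln X) * ((\<Sum>v\<in>A. exp (- real v - 1)) + real (card A) * (C / l))"
      by (simp only: sum_distrib_left[symmetric] sum.distrib sum_constant)
    also have "\<dots> \<le> (2 / ln X) * (1 + 2 * v0 * (C / l))"
    proof (intro mult_left_mono add_mono mult_right_mono)
      have geo: "(\<Sum>v\<in>{0..n}. exp (- real v - 1)) \<le> 1 - exp (- real n - 1)" for n :: nat
      proof (induction n)
        case 0
        have "2 * exp (-1::real) \<le> 1"
          using exp_ge_add_one_self[of "1::real"] by (simp add: exp_minus field_simps)
        then show ?case by simp
      next
        case (Suc n)
        have "2 * exp (-1::real) \<le> 1"
          using exp_ge_add_one_self[of "1::real"] by (simp add: exp_minus field_simps)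
        then have "2 * exp (-1) * exp (- real n - 1) \<le> 1 * exp (- real n - 1)" by (intro mult_right_mono) auto
        also have "2 * exp (-1) * exp (- real n - 1) = 2 * exp (- real (Suc n) - 1)" by (simp add: mult_exp_exp)
        finally show ?case using Suc by simp
      qed
      have "(\<Sum>v\<in>A. exp (- real v - 1)) \<le> (\<Sum>v\<in>{0..V}. exp (- real v - 1))"
        by (rule sum_mono2) (auto simp: A_def)
      also have "\<dots> \<le> 1" using geo[of V] exp_gt_zero[of "- real V - 1"] by linarith
      finally show "(\<Sum>v\<in>A. exp (- real v - 1)) \<le> 1" .
      have "A \<subseteq> {0..nat \<lfloor>v0\<rfloor>}" by (auto simp: A_def le_nat_floor)
      then have "card A \<le> card {0..nat \<lfloor>v0\<rfloor>}" by (intro card_mono) auto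
      then have "real (card A) \<le> real (nat \<lfloor>v0\<rfloor>) + 1" by simp
      then show "real (card A) \<le> 2 * v0" using par by linarith
    qed (use par X1 in auto)
    finally have SA: "(\<Sum>v\<in>A. g v / (1 + ln X - real v)) \<le> (2 / ln X) * (1 + 2 * v0 * (C / l))" .
    have "(\<Sum>v\<in>B. g v / (1 + ln X - real v)) \<le> (\<Sum>v\<in>B. C * (2 / ln X * (1 / (real v)\<^sup>2) + 4 / (ln X)\<^sup>2))"
    proof (rule sum_mono)
      fix v assume v: "v \<in> B"
      have v1: "real v \<ge> 1" "real v \<le> ln X" using v par V by (auto simp: B_def)
      \<comment> \<open>Up to \<open>ln X / 2\<close> the denominator is large. Beyond,
        \<open>1 / v\<^sup>2\<close> is at most \<open>4 / (ln X)\<^sup>2\<close>, and with at most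
        \<open>ln X\<close> values of \<open>v\<close> this again sums to the order
        \<open>1 / ln X\<close>.\<close>
      have "1 / (real v)\<^sup>2 * (1 / (1 + ln X - real v)) \<le> 2 / ln X * (1 / (real v)\<^sup>2) + 4 / (ln X)\<^sup>2"
      proof (cases "real v \<le> ln X / 2")
        case True
        have "1 / (1 + ln X - real v) \<le> 1 / (ln X / 2)" using True LX by (intro divide_left_mono) auto
        then have "1 / (real v)\<^sup>2 * (1 / (1 + ln X - real v)) \<le> 1 / (real v)\<^sup>2 * (1 / (ln X / 2))" by (intro mult_left_mono) auto
        moreover have "4 / (ln X)\<^sup>2 \<ge> 0" by simp
        moreover have "1 / (real v)\<^sup>2 * (1 / (ln X / 2)) = 2 / ln X * (1 / (real v)\<^sup>2)" by simp
        ultimately show ?thesis by linarith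
      next
        case False
        have "1 / (real v)\<^sup>2 \<le> 1 / (ln X / 2)\<^sup>2" using False LX by (intro divide_left_mono power_mono) auto
        moreover have "1 / (1 + ln X - real v) \<le> 1" using v1 by simp
        ultimately have "1 / (real v)\<^sup>2 * (1 / (1 + ln X - real v)) \<le> 1 / (ln X / 2)\<^sup>2 * 1"
          using v1 by (intro mult_mono) auto
        moreover have "2 / ln X * (1 / (real v)\<^sup>2) \<ge> 0" using X1 by simp
        moreover have "1 / (ln X / 2)\<^sup>2 * 1 = 4 / (ln X)\<^sup>2" by (simp add: power_divide)
        ultimately show ?thesis by linarith
      qed
      then have "C * (1 / (real v)\<^sup>2 * (1 / (1 + ln X - real v))) \<le> C * (2 / ln X * (1 / (real v)\<^sup>2) + 4 / (ln X)\<^sup>2)"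
        using par by (intro mult_left_mono) auto
      then show "g v / (1 + ln X - real v) \<le> C * (2 / ln X * (1 / (real v)\<^sup>2) + 4 / (ln X)\<^sup>2)"
        using v by (simp add: g_def B_def)
    qed
    also have "\<dots> \<le> (\<Sum>v\<in>{1..V}. C * (2 / ln X * (1 / (real v)\<^sup>2) + 4 / (ln X)\<^sup>2))"
    proof (rule sum_mono2)
      show "B \<subseteq> {1..V}" using par by (auto simp: B_def Suc_le_eq intro!: Nat.gr0I)
      show "0 \<le> C * (2 / ln X * (1 / (real v)\<^sup>2) + 4 / (ln X)\<^sup>2)" for v :: nat
        by (intro mult_nonneg_nonneg add_nonneg_nonneg divide_nonneg_nonneg)
          (rule zero_le_power2 | use par LX in linarith)+
    qed simp
    also have "\<dots> = C * (2 / ln X * (\<Sum>v\<in>{1..V}. 1 / (real v)\<^sup>2) + real (card {1..V}) * (4 / (ln X)\<^sup>2))"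
      by (simp only: sum_distrib_left[symmetric] sum.distrib sum_constant)
    also have "\<dots> = C * (2 / ln X * (\<Sum>v\<in>{1..V}. 1 / (real v)\<^sup>2) + real V * (4 / (ln X)\<^sup>2))" by simp
    also have "\<dots> \<le> C * (2 / ln X * 2 + ln X * (4 / (ln X)\<^sup>2))"
      using par X1 LX V sum_inverse_squares_le by (intro mult_left_mono add_mono mult_right_mono) auto
    also have "\<dots> = 8 * C / ln X" using LX by (simp add: field_simps power2_eq_square)
    finally have SB: "(\<Sum>v\<in>B. g v / (1 + ln X - real v)) \<le> 8 * C / ln X" .
    have "(\<Sum>v\<in>{0..V}. g v / (1 + ln X - real v)) = (\<Sum>v\<in>A. g v / (1 + ln X - real v)) + (\<Sum>v\<in>B. g v / (1 + ln X - real v))"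
      unfolding AB(1) using AB by (intro sum.union_disjoint) auto
    also have "\<dots> \<le> (2 / ln X) * (1 + 2 * v0 * (C / l)) + 8 * C / ln X" using SA SB by linarith
    also have "\<dots> = (2 + 4 * C * (v0 / l) + 8 * C) / ln X" by (simp add: add_divide_distrib ring_distribs mult_ac)
    finally show ?thesis .
  qed
  then have "exp 1 * K * X * (\<Sum>v\<in>{0..V}. g v / (1 + ln X - real v)) \<le> exp 1 * K * X * ((2 + 4 * C * (v0 / l) + 8 * C) / ln X)"
    using par by (intro mult_left_mono) auto
  finally show ?thesis by simp
qed

text \<open>Hyperbola method: one of the two primes is at most \<open>sqrt t\<close>, and for this
  one fixed the other is counted by \<open>card_primes_le\<close>, where
  \<open>ln (t / q) \<ge> ln t / 2\<close>. The factor \<open>ln (ln x)\<close> is the sum of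
  \<open>1 / q\<close>, and \<open>360 = 2 * 20 * 9\<close>.\<close>

lemma card_prime_pairs_le:
  assumes "1 \<le> t" "t \<le> x" "ln (ln x) \<ge> 1"
  shows "real (card {(q, r). prime q \<and> prime r \<and> real (q * r) \<le> t}) \<le> 360 * ln (ln x) * t / (1 + ln t)"
proof -
  let ?P = "\<lambda>t. {p::nat. prime p \<and> real p \<le> t}"
  let ?S = "Sigma (?P (sqrt t)) (\<lambda>q. ?P (t / real q))"
  have finS: "finite ?S" by (intro finite_SigmaI) auto
  have lt: "ln t \<ge> 0" using assms by simp
  have sub: "{(q, r). prime q \<and> prime r \<and> real (q * r) \<le> t} \<subseteq> ?S \<union> prod.swap ` ?S"
  proof clarify
    fix q r :: nat assume qr: "prime q" "prime r" "real (q * r) \<le> t" "(q, r) \<notin> prod.swap ` ?S"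
    have pos: "real q > 0" "real r > 0" using qr prime_gt_0_nat by auto
    have 1: "real r \<le> t / real q" "real q \<le> t / real r" using qr pos by (auto simp: field_simps)
    have "real q \<le> sqrt t \<or> real r \<le> sqrt t"
    proof (rule ccontr)
      assume "\<not> ?thesis"
      then have "sqrt t * sqrt t < real q * real r" using pos assms by (intro mult_strict_mono) auto
      then show False using qr assms by simp
    qed
    moreover have "\<not> real r \<le> sqrt t"
    proof
      assume "real r \<le> sqrt t"
      then have "(r, q) \<in> ?S" using qr 1 by auto
      then have "(q, r) \<in> prod.swap ` ?S" by force
      then show False using qr by blast
    qed
    ultimately show "q \<in> ?P (sqrt t) \<and> r \<in> ?P (t / real q)" using qr 1 by auto
  qed
  have "card {(q, r). prime q \<and> prime r \<and> real (q * r) \<le> t} \<le> card (?S \<union> prod.swap ` ?S)"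
    using finS sub by (intro card_mono) auto
  also have "\<dots> \<le> card ?S + card (prod.swap ` ?S)" by (rule card_Un_le)
  also have "\<dots> \<le> card ?S + card ?S" by (intro add_left_mono card_image_le finS)
  finally have "real (card {(q, r). prime q \<and> prime r \<and> real (q * r) \<le> t}) \<le> 2 * real (card ?S)" by linarith
  also have "real (card ?S) = (\<Sum>q\<in>?P (sqrt t). real (card (?P (t / real q))))"
    by (subst card_SigmaI) auto
  also have "\<dots> \<le> (\<Sum>q\<in>?P (sqrt t). 20 * t / (1 + ln t) * (1 / real q))"
  proof (rule sum_mono)
    fix q assume q: "q \<in> ?P (sqrt t)"
    then have pos: "real q > 0" using prime_gt_0_nat by auto
    have s1: "sqrt t \<ge> 1" using assms by simp
    have "sqrt t * real q \<le> sqrt t * sqrt t" using q s1 by (intro mult_left_mono) auto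
    then have sq: "sqrt t \<le> t / real q" using pos assms by (simp add: field_simps)
    have "ln (sqrt t) \<le> ln (t / real q)" using sq s1 assms by (intro ln_mono) auto
    then have l: "ln t / 2 \<le> ln (t / real q)" using assms by (simp add: ln_sqrt)
    have "real (card (?P (t / real q))) \<le> 10 * (t / real q) / (1 + ln (t / real q))"
      by (rule card_primes_le) (rule order_trans[OF s1 sq])
    also have "\<dots> \<le> 10 * (t / real q) / ((1 + ln t) / 2)"
    proof (rule divide_left_mono)
      have "0 < 1 + ln t" "0 < 1 + ln (t / real q)" using l lt by linarith+
      then show "0 < (1 + ln (t / real q)) * ((1 + ln t) / 2)" by simp
    qed (use l pos assms in auto)
    also have "\<dots> = 20 * t / (1 + ln t) * (1 / real q)" using lt pos by (simp add: field_simps)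
    finally show "real (card (?P (t / real q))) \<le> 20 * t / (1 + ln t) * (1 / real q)" .
  qed
  also have "\<dots> = 20 * t / (1 + ln t) * (\<Sum>q\<in>?P (sqrt t). 1 / real q)" by (simp add: sum_distrib_left)
  also have "\<dots> \<le> 20 * t / (1 + ln t) * (9 * ln (ln x))"
  proof (rule mult_left_mono)
    show "(\<Sum>q\<in>?P (sqrt t). 1 / real q) \<le> 9 * ln (ln x)"
    proof (cases "sqrt t \<ge> 2")
      case True
      have "(\<Sum>q\<in>?P (sqrt t). 1 / real q) \<le> ln (ln (sqrt t)) + 8" by (rule sum_prime_recip_le[OF True])
      also have "ln (ln (sqrt t)) \<le> ln (ln x)"
      proof -
        have "0 < ln (sqrt t)" by (rule ln_gt_zero) (use True in linarith)
        moreover have "sqrt t \<le> t" using assms by (intro real_le_lsqrt self_le_power) auto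
        ultimately show ?thesis using True assms by (intro ln_mono) auto
      qed
      finally show ?thesis using assms by simp
    next
      case False
      have "\<not> real p \<le> sqrt t" if "prime p" for p
        using prime_ge_2_nat[OF that] False by linarith
      then have "?P (sqrt t) = {}" by blast
      then have "(\<Sum>q\<in>?P (sqrt t). 1 / real q) = 0" by (simp only: sum.empty)
      then show ?thesis using assms by linarith
    qed
  qed (use assms lt in auto)
  finally show ?thesis by (simp add: mult_ac)
qed

section \<open>Decomposition by the smallest prime factor\<close>

lemma omega_prime_mult:
  assumes "prime p" "m > 0" "\<not> p dvd m"
  shows "omega (p * m) = omega m + 1"
proof -
  have "prime_factors (p * m) = insert p (prime_factors m)"
    using assms by (subst prime_factors_product) (auto simp: prime_prime_factors)
  moreover have "p \<notin> prime_factors m" using assms by auto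
  ultimately show ?thesis by (simp add: omega_def)
qed

lemma smallest_prime_factor_in:
  "n \<ge> 2 \<Longrightarrow> smallest_prime_factor n \<in> prime_factors n"
  unfolding smallest_prime_factor_def using prime_factor_nat[of n]
  by (intro Min_in) (auto simp: prime_factors_dvd)

lemma smallest_prime_factor_eq_iff:
  assumes "prime p"
  shows "{n. 2 \<le> n \<and> real n \<le> x \<and> smallest_prime_factor n = p}
           = {n. n \<in> free_upto {q. prime q \<and> q < p} x \<and> p dvd n}"
proof (intro equalityI subsetI)
  fix n assume n: "n \<in> {n. 2 \<le> n \<and> real n \<le> x \<and> smallest_prime_factor n = p}"
  then have "p \<in> prime_factors n" using smallest_prime_factor_in[of n] by auto
  moreover have "\<not> q dvd n" if "prime q" "q < p" for q
  proof
    assume "q dvd n"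
    then have "q \<in> prime_factors n" using n that by (auto simp: prime_factors_dvd)
    then have "p \<le> q" using n by (auto simp: smallest_prime_factor_def)
    then show False using that by simp
  qed
  ultimately show "n \<in> {n. n \<in> free_upto {q. prime q \<and> q < p} x \<and> p dvd n}"
    using n by (auto simp: free_upto_def)
next
  fix n assume n: "n \<in> {n. n \<in> free_upto {q. prime q \<and> q < p} x \<and> p dvd n}"
  then have n0: "n > 0" "p dvd n" by (auto simp: free_upto_def)
  have "2 \<le> p" using assms prime_ge_2_nat by auto
  also have "p \<le> n" using n0 by (auto intro: dvd_imp_le)
  finally have "n \<ge> 2" .
  moreover have "smallest_prime_factor n = p"
    unfolding smallest_prime_factor_def
  proof (rule Min_eqI)
    show "p \<in> prime_factors n" using assms n0 by (auto simp: prime_factors_dvd)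
    show "p \<le> q" if "q \<in> prime_factors n" for q
    proof (rule ccontr)
      assume "\<not> p \<le> q"
      then show False using n that by (auto simp: free_upto_def prime_factors_dvd)
    qed
  qed auto
  ultimately show "n \<in> {n. 2 \<le> n \<and> real n \<le> x \<and> smallest_prime_factor n = p}"
    using n by (auto simp: free_upto_def)
qed

text \<open>With \<open>n = p * m\<close>, the cofactors divisible by \<open>p\<close> drop out
  under \<mu>; the others avoid all primes up to and including \<open>p\<close> and have one prime
  factor less than \<open>n\<close>.\<close>

lemma sum_smallest_prime_factor_eq:
  assumes "prime p"
  shows "(\<Sum>n | 2 \<le> n \<and> real n \<le> x \<and> smallest_prime_factor n = p. of_int (moebius_mu n) * (real (omega n))\<^sup>2)
           = - (\<Sum>m\<in>free_upto {q. prime q \<and> q \<le> p} (x / real p). of_int (moebius_mu m) * (real (omega m) + 1)\<^sup>2)"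
proof -
  have ins: "insert p {q. prime q \<and> q < p} = {q. prime q \<and> q \<le> p}" using assms by auto
  have "(\<Sum>n | 2 \<le> n \<and> real n \<le> x \<and> smallest_prime_factor n = p. of_int (moebius_mu n) * (real (omega n))\<^sup>2)
      = - (\<Sum>m\<in>free_upto {q. prime q \<and> q \<le> p} (x / real p). of_int (moebius_mu m) * (real (omega (p * m)))\<^sup>2)"
    unfolding smallest_prime_factor_eq_iff[OF assms]
    by (subst sum_moebius_multiples) (use assms ins in auto)
  also have "(\<Sum>m\<in>free_upto {q. prime q \<and> q \<le> p} (x / real p). of_int (moebius_mu m) * (real (omega (p * m)))\<^sup>2)
      = (\<Sum>m\<in>free_upto {q. prime q \<and> q \<le> p} (x / real p). of_int (moebius_mu m) * (real (omega m) + 1)\<^sup>2)"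
    by (intro sum.cong refl) (use assms in \<open>auto simp: free_upto_def omega_prime_mult add.commute\<close>)
  finally show ?thesis .
qed

text \<open>All prime factors of the \<open>m\<close> in question lie in \<open>P\<close>, so
  \<omega> is a sum \<open>w\<close> of divisibility indicators. As \<open>w\<^sup>2\<close> equals
  \<open>w\<close> plus the sum over ordered pairs of distinct primes,
  \<open>(w + 1)\<^sup>2\<close> has the coefficients 1, 3 and 1. Every prime pulled out of \<mu>
  changes the sign once.\<close>

lemma sum_moebius_omega_square_free:
  fixes p :: nat and X :: real
  defines "T \<equiv> {q. prime q \<and> q \<le> p}" and "P \<equiv> {q. prime q \<and> real p < real q \<and> real q \<le> X}"
  shows "(\<Sum>m\<in>free_upto T X. of_int (moebius_mu m) * (real (omega m) + 1)\<^sup>2)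
    = mertens_free T X - 3 * (\<Sum>q\<in>P. mertens_free (insert q T) (X / real q))
      + (\<Sum>(q,r)\<in>Sigma P (\<lambda>q. P - {q}). mertens_free (insert r (insert q T)) (X / real (q * r)))"
proof -
  let ?b = "\<lambda>q m::nat. of_bool (q dvd m) :: real"
  let ?F = "free_upto T X"
  have finP: "finite P" unfolding P_def by simp
  have TP: "prime r" if "r \<in> T" for r using that by (simp add: T_def)
  have PP: "prime q" "q \<notin> T" if "q \<in> P" for q using that by (auto simp: P_def T_def)
  have om: "real (omega m) = (\<Sum>q\<in>P. ?b q m)" if m: "m \<in> ?F" for m
  proof -
    have "prime_factors m = {q\<in>P. q dvd m}"
    proof (intro equalityI subsetI)
      fix q assume q: "q \<in> prime_factors m"
      have "q \<notin> T" using q m by (auto simp: free_upto_def)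
      moreover have "q \<le> m" using q m by (auto simp: free_upto_def intro!: dvd_imp_le)
      ultimately show "q \<in> {q\<in>P. q dvd m}" using q m by (auto simp: T_def P_def free_upto_def)
    qed (use m in \<open>auto simp: P_def free_upto_def prime_factors_dvd\<close>)
    then show ?thesis using finP by (simp add: omega_def of_bool_def sum.If_cases Int_def)
  qed
  have sq: "(real (omega m) + 1)\<^sup>2 = 1 + 3 * (\<Sum>q\<in>P. ?b q m) + (\<Sum>q\<in>P. \<Sum>r\<in>P - {q}. ?b q m * ?b r m)"
    if m: "m \<in> ?F" for m
  proof -
    have "(real (omega m))\<^sup>2 = (\<Sum>q\<in>P. \<Sum>r\<in>P. ?b q m * ?b r m)"
      by (simp add: om[OF m] power2_eq_square sum_product)
    also have "\<dots> = (\<Sum>q\<in>P. ?b q m + (\<Sum>r\<in>P - {q}. ?b q m * ?b r m))"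
    proof (rule sum.cong[OF refl])
      fix q assume "q \<in> P"
      then have "(\<Sum>r\<in>P. ?b q m * ?b r m) = ?b q m * ?b q m + (\<Sum>r\<in>P - {q}. ?b q m * ?b r m)"
        by (rule sum.remove[OF finP])
      moreover have "?b q m * ?b q m = ?b q m" by (simp only: of_bool_conj[symmetric] conj_absorb)
      ultimately show "(\<Sum>r\<in>P. ?b q m * ?b r m) = ?b q m + (\<Sum>r\<in>P - {q}. ?b q m * ?b r m)" by (simp only:)
    qed
    also have "\<dots> = (\<Sum>q\<in>P. ?b q m) + (\<Sum>q\<in>P. \<Sum>r\<in>P - {q}. ?b q m * ?b r m)" by (rule sum.distrib)
    finally show ?thesis using om[OF m] by (simp add: power2_sum)
  qed
  have filt: "(\<Sum>m\<in>?F. of_int (moebius_mu m) * (?b q m * f m)) = (\<Sum>m | m \<in> ?F \<and> q dvd m. of_int (moebius_mu m) * f m)" for q f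
    by (rule sum.mono_neutral_cong_right) auto
  have one: "(\<Sum>m\<in>?F. of_int (moebius_mu m) * ?b q m) = - mertens_free (insert q T) (X / real q)" if "q \<in> P" for q
    using filt[of q "\<lambda>_. 1"] sum_moebius_multiples[OF PP(1)[OF that] PP(2)[OF that] TP, where X = X and f = "\<lambda>_. 1"]
    by (simp add: mertens_free_def)
  have two: "(\<Sum>m\<in>?F. of_int (moebius_mu m) * (?b q m * ?b r m)) = mertens_free (insert r (insert q T)) (X / real (q * r))"
    if q: "q \<in> P" and r: "r \<in> P - {q}" for q r
  proof -
    have pr: "prime r" "r \<notin> insert q T" using PP q r by auto
    then have pr': "\<not> r dvd q" using PP(1)[OF q] primes_dvd_imp_eq by blast
    have "(\<Sum>m\<in>?F. of_int (moebius_mu m) * (?b q m * ?b r m))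
        = - (\<Sum>m\<in>free_upto (insert q T) (X / real q). of_int (moebius_mu m) * ?b r (q * m))"
      unfolding filt by (rule sum_moebius_multiples[OF PP(1)[OF q] PP(2)[OF q] TP])
    also have "\<dots> = - (\<Sum>m\<in>free_upto (insert q T) (X / real q). of_int (moebius_mu m) * (?b r m * 1))"
      using pr(1) pr' by (simp add: prime_dvd_mult_iff)
    also have "\<dots> = - (\<Sum>m | m \<in> free_upto (insert q T) (X / real q) \<and> r dvd m. of_int (moebius_mu m) * 1)"
      by (subst sum.mono_neutral_cong_right[where S = "{m. m \<in> free_upto (insert q T) (X / real q) \<and> r dvd m}"]) auto
    also have "\<dots> = (\<Sum>m\<in>free_upto (insert r (insert q T)) (X / real q / real r). of_int (moebius_mu m) * 1)"
      using PP q TP by (subst sum_moebius_multiples[OF pr(1,2)]) auto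
    finally show ?thesis by (simp add: mertens_free_def)
  qed
  have "(\<Sum>m\<in>?F. of_int (moebius_mu m) * (real (omega m) + 1)\<^sup>2)
     = (\<Sum>m\<in>?F. of_int (moebius_mu m) + 3 * (\<Sum>q\<in>P. of_int (moebius_mu m) * ?b q m)
         + (\<Sum>q\<in>P. \<Sum>r\<in>P - {q}. of_int (moebius_mu m) * (?b q m * ?b r m)))"
    by (intro sum.cong refl) (simp add: sq ring_distribs sum_distrib_left mult_ac)
  also have "\<dots> = mertens_free T X + 3 * (\<Sum>q\<in>P. \<Sum>m\<in>?F. of_int (moebius_mu m) * ?b q m)
        + (\<Sum>q\<in>P. \<Sum>r\<in>P - {q}. \<Sum>m\<in>?F. of_int (moebius_mu m) * (?b q m * ?b r m))"
  proof -
    have "(\<Sum>m\<in>?F. \<Sum>q\<in>P. of_int (moebius_mu m) * ?b q m) = (\<Sum>q\<in>P. \<Sum>m\<in>?F. of_int (moebius_mu m) * ?b q m)"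
      by (rule sum.swap)
    then have a: "(\<Sum>m\<in>?F. 3 * (\<Sum>q\<in>P. of_int (moebius_mu m) * ?b q m)) = 3 * (\<Sum>q\<in>P. \<Sum>m\<in>?F. of_int (moebius_mu m) * ?b q m)"
      unfolding sum_distrib_left[symmetric, where r = 3] by (simp only:)
    have "(\<Sum>m\<in>?F. \<Sum>q\<in>P. \<Sum>r\<in>P - {q}. of_int (moebius_mu m) * (?b q m * ?b r m))
        = (\<Sum>q\<in>P. \<Sum>m\<in>?F. \<Sum>r\<in>P - {q}. of_int (moebius_mu m) * (?b q m * ?b r m))"
      by (rule sum.swap)
    also have "\<dots> = (\<Sum>q\<in>P. \<Sum>r\<in>P - {q}. \<Sum>m\<in>?F. of_int (moebius_mu m) * (?b q m * ?b r m))"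
      by (intro sum.cong refl sum.swap)
    finally show ?thesis unfolding sum.distrib mertens_free_def a by (simp only:)
  qed
  also have "\<dots> = mertens_free T X + 3 * (\<Sum>q\<in>P. - mertens_free (insert q T) (X / real q))
        + (\<Sum>q\<in>P. \<Sum>r\<in>P - {q}. mertens_free (insert r (insert q T)) (X / real (q * r)))"
    using one two by simp
  also have "(\<Sum>q\<in>P. \<Sum>r\<in>P - {q}. mertens_free (insert r (insert q T)) (X / real (q * r)))
     = (\<Sum>(q,r)\<in>Sigma P (\<lambda>q. P - {q}). mertens_free (insert r (insert q T)) (X / real (q * r)))"
    using finP by (subst sum.Sigma) auto
  finally show ?thesis by (simp add: sum_negf)
qed

text \<open>The three parts of the expansion, with zero, one or two extra primes, all satisfy the
  hypotheses of \<open>sum_by_counting\<close> with the same constants and are therefore bounded by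
  one quantity \<open>E\<close>. The hypothesis \<open>small\<close> places the threshold
  \<open>v0\<close> of the long bound below \<open>ln X / 2\<close>.\<close>

lemma sum_smallest_prime_factor_bound:
  fixes p :: nat and x CM :: real
  assumes CM: "CM \<ge> 0" "\<And>t. t \<ge> 2 \<Longrightarrow> \<bar>mertens_free {} t\<bar> \<le> CM * t / (ln t) ^ 8"
    and p: "prime p" and LL: "ln (ln x) \<ge> 1" and small: "64 * ln (ln x) * (ln (real p) + 1) \<le> ln x / 4" and x: "x > 1"
  defines "C \<equiv> 2 + 4 * exp 6 + 16 * exp 48 * (256 * CM + 1)"
  shows "\<bar>\<Sum>n | 2 \<le> n \<and> real n \<le> x \<and> smallest_prime_factor n = p. of_int (moebius_mu n) * (real (omega n))\<^sup>2\<bar>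
           \<le> 3600 * exp 1 * (2 + 776 * C) * (ln (ln x))\<^sup>2 * x / (ln x) * (1 / real p)"
proof -
  define T where "T = {q. prime q \<and> q \<le> p}"
  define X where "X = x / real p"
  define P where "P = {q. prime q \<and> real p < real q \<and> real q \<le> X}"
  define LLx where "LLx = ln (ln x)"
  define v0 where "v0 = 64 * LLx * (ln (real p) + 1)"
  have p2: "p \<ge> 2" using p prime_ge_2_nat by auto
  have lp: "ln (real p) \<ge> 1/2" using p2 ln_2_ge_half ln_mono[of 2 "real p"] by linarith
  have lx: "ln x > 0" using x by simp
  have LL1: "LLx \<ge> 1" using LL by (simp add: LLx_def)
  have v0: "v0 \<ge> 64" unfolding v0_def using mult_mono[of 1 LLx 1 "ln (real p) + 1"] LL1 lp by simp
  have v0x: "v0 \<le> ln x / 4" using small by (simp add: v0_def LLx_def)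
  have "ln (real p) \<le> v0" unfolding v0_def using mult_mono[of 1 "64 * LLx" "ln (real p)" "ln (real p) + 1"] LL1 lp by simp
  moreover have "ln X = ln x - ln (real p)" unfolding X_def using x p2 by (simp add: ln_div)
  ultimately have lX: "ln X \<ge> ln x / 2" using v0x lx by linarith
  have X0: "X > 0" unfolding X_def using x p2 by simp
  have Xx: "X \<le> x" unfolding X_def using x p2 by (simp add: field_simps)
  have finP: "finite P" unfolding P_def by simp
  have C: "C \<ge> 2 + 4 * exp 6" "C \<ge> 16 * exp 48 * (256 * CM + 1)" "C \<ge> 0" unfolding C_def using CM by auto
  have G1: "\<bar>mertens_free (T \<union> Q) (X / a)\<bar> \<le> 1 + C * (X / a) / ln (real p)" if "a \<ge> 1" for a :: real and Q
  proof -
    have "\<bar>mertens_free (T \<union> Q) (X / a)\<bar> \<le> 1 + (2 + 4 * exp 6) * (X / a) / ln (real p)"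
      using p2 X0 that by (intro mertens_free_short) (auto simp: T_def)
    also have "\<dots> \<le> 1 + C * (X / a) / ln (real p)"
      using C lp X0 that by (intro add_left_mono divide_right_mono mult_right_mono) auto
    finally show ?thesis .
  qed
  have G2: "\<bar>mertens_free (T \<union> Q) (X / a)\<bar> \<le> C * (X / a) / (ln (X / a))\<^sup>2"
    if "a \<ge> 1" and l: "ln (X / a) \<ge> v0" and Q: "finite Q" "card Q \<le> 2" "\<And>q. q \<in> Q \<Longrightarrow> prime q" for a :: real and Q
  proof -
    have Y0: "X / a > 0" using X0 that by simp
    have "ln 4 \<le> ln (X / a)" using l v0 ln_le_minus_one[of "4::real"] by simp
    then have "4 \<le> X / a" using Y0 by simp
    moreover have "X / a \<le> x"
    proof -
      have "X / a \<le> X" using X0 that by (simp add: field_simps)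
      then show ?thesis using Xx by linarith
    qed
    ultimately have "\<bar>mertens_free (T \<union> Q) (X / a)\<bar> \<le> 16 * exp 48 * (256 * CM + 1) * (X / a) / (ln (X / a))\<^sup>2"
      using Q l LL by (intro mertens_free_long[OF p2 _ _ _ _ CM, where Q = Q and x = x]) (auto simp: T_def v0_def LLx_def)
    also have "\<dots> \<le> C * (X / a) / (ln (X / a))\<^sup>2"
      using C Y0 by (intro divide_right_mono mult_right_mono) auto
    finally show ?thesis .
  qed
  define E where "E = exp 1 * (360 * LLx) * X / ln X * (2 + 4 * C * (v0 / ln (real p)) + 8 * C)"
  have par: "C \<ge> 0" "360 * LLx \<ge> 0" "ln (real p) > 0" "v0 \<ge> 1" "2 * v0 \<le> ln X" "X > 0"
    using C LL1 lp v0 v0x lX X0 by auto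
  have X1': "X > 1" using ln_gt_zero_iff[of X] X0 lX lx by linarith
  then have X1: "X \<ge> 1" by simp
  have lnt: "1 + ln t \<le> t" "1 + ln t > 0" if "t \<ge> 1" for t :: real using ln_le_minus_one[of t] that by (auto simp: add_pos_nonneg)
  have B0: "\<bar>mertens_free T X\<bar> \<le> E"
  proof -
    \<comment> \<open>A single sum is treated as a family with one index, so that it falls under the
      same counting lemma.\<close>
    have "(\<Sum>i\<in>{()}. \<bar>mertens_free (T \<union> {}) (X / 1)\<bar>) \<le> E"
      unfolding E_def
    proof (rule sum_by_counting[where a = "\<lambda>_. 1"])
      fix t :: real assume t: "1 \<le> t" "t \<le> X"
      have "1 * (1 + ln t) \<le> (360 * LLx) * t" using lnt[OF t(1)] LL1 t by (intro mult_mono) auto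
      then show "real (card {i \<in> {()}. 1 \<le> t}) \<le> 360 * LLx * t / (1 + ln t)"
        using t lnt[OF t(1)] by (simp add: field_simps)
    next
      show "\<bar>mertens_free (T \<union> {}) (X / 1)\<bar> \<le> 1 + C * (X / 1) / ln (real p)" by (rule G1) simp
      show "\<bar>mertens_free (T \<union> {}) (X / 1)\<bar> \<le> C * (X / 1) / (ln (X / 1))\<^sup>2" if "ln (X / 1) \<ge> v0"
        by (rule G2) (use that in auto)
    qed (use par X1 in auto)
    then show ?thesis by simp
  qed
  have B1: "(\<Sum>q\<in>P. \<bar>mertens_free (insert q T) (X / real q)\<bar>) \<le> E"
    unfolding E_def
  proof (rule sum_by_counting[where a = real])
    fix t :: real assume t: "1 \<le> t" "t \<le> X"
    have "card {q\<in>P. real q \<le> t} \<le> card {q. prime q \<and> real q \<le> t}" by (rule card_mono) (auto simp: P_def)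
    then have "real (card {q\<in>P. real q \<le> t}) \<le> 10 * t / (1 + ln t)" using card_primes_le[OF t(1)] by linarith
    also have "\<dots> \<le> (360 * LLx) * t / (1 + ln t)"
      using LL1 t lnt[OF t(1)] by (intro divide_right_mono mult_right_mono) auto
    finally show "real (card {q\<in>P. real q \<le> t}) \<le> 360 * LLx * t / (1 + ln t)" .
  next
    fix q assume q: "q \<in> P"
    have q1: "real q \<ge> 1" using q prime_gt_0_nat[of q] by (auto simp: P_def Suc_le_eq)
    show "1 \<le> real q \<and> real q \<le> X" using q q1 by (auto simp: P_def)
    show "\<bar>mertens_free (insert q T) (X / real q)\<bar> \<le> 1 + C * (X / real q) / ln (real p)"
      using G1[OF q1, of "{q}"] by simp
    show "\<bar>mertens_free (insert q T) (X / real q)\<bar> \<le> C * (X / real q) / (ln (X / real q))\<^sup>2" if "v0 \<le> ln (X / real q)"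
      using G2[OF q1 that, of "{q}"] q by (simp add: P_def)
  qed (use par finP in auto)
  let ?S = "Sigma P (\<lambda>q. P - {q})"
  \<comment> \<open>Pairs with \<open>q * r > X\<close> have to be set aside because the counting
    lemma requires \<open>a i \<le> X\<close>; their inner sums are empty, so they are put back
    afterwards at no cost.\<close>
  let ?S' = "{i \<in> ?S. real (fst i * snd i) \<le> X}"
  have finS: "finite ?S" using finP by auto
  have finS': "finite ?S'" by (rule finite_subset[OF _ finS]) auto
  have B2': "(\<Sum>(q,r)\<in>?S'. \<bar>mertens_free (insert r (insert q T)) (X / real (q * r))\<bar>) \<le> E"
    unfolding E_def case_prod_beta
  proof (rule sum_by_counting[where a = "\<lambda>i. real (fst i * snd i)"])
    fix t :: real assume t: "1 \<le> t" "t \<le> X"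
    let ?Q = "{(q, r). prime q \<and> prime r \<and> real (q * r) \<le> t}"
    have "?Q \<subseteq> {..nat \<lfloor>t\<rfloor>} \<times> {..nat \<lfloor>t\<rfloor>}"
    proof clarify
      fix q r :: nat assume qr: "prime q" "prime r" "real (q * r) \<le> t"
      have "q \<le> q * r" "r \<le> q * r" using qr prime_gt_0_nat by (auto simp: Suc_le_eq)
      then have "real q \<le> t" "real r \<le> t" using qr(3) by (meson of_nat_mono order_trans)+
      then show "q \<in> {..nat \<lfloor>t\<rfloor>} \<and> r \<in> {..nat \<lfloor>t\<rfloor>}" by (auto simp: le_nat_floor)
    qed
    then have "finite ?Q" by (rule finite_subset) auto
    then have "card {i\<in>?S'. real (fst i * snd i) \<le> t} \<le> card ?Q" by (rule card_mono) (auto simp: P_def)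
    then have "real (card {i\<in>?S'. real (fst i * snd i) \<le> t}) \<le> real (card ?Q)" by simp
    also have "\<dots> \<le> 360 * LLx * t / (1 + ln t)"
      unfolding LLx_def using t Xx LL by (intro card_prime_pairs_le) auto
    finally show "real (card {i\<in>?S'. real (fst i * snd i) \<le> t}) \<le> 360 * LLx * t / (1 + ln t)" .
  next
    fix i assume i: "i \<in> ?S'"
    obtain q r where qr: "i = (q, r)" by (cases i)
    have pr: "prime q" "prime r" "q \<noteq> r" using i qr by (auto simp: P_def)
    then have "q * r > 0" using prime_gt_0_nat by simp
    then have a1: "real (fst i * snd i) \<ge> 1" unfolding qr fst_conv snd_conv by linarith
    show "1 \<le> real (fst i * snd i) \<and> real (fst i * snd i) \<le> X" using a1 i qr by auto
    show "\<bar>mertens_free (insert (snd i) (insert (fst i) T)) (X / real (fst i * snd i))\<bar> \<le> 1 + C * (X / real (fst i * snd i)) / ln (real p)"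
      using G1[OF a1, of "{snd i, fst i}"] by simp
    show "\<bar>mertens_free (insert (snd i) (insert (fst i) T)) (X / real (fst i * snd i))\<bar> \<le> C * (X / real (fst i * snd i)) / (ln (X / real (fst i * snd i)))\<^sup>2"
      if "v0 \<le> ln (X / real (fst i * snd i))"
      using G2[OF a1 that, of "{snd i, fst i}"] pr qr by (auto simp: card_insert_if)
  qed (use par finS' in auto)
  have "(\<Sum>(q,r)\<in>?S'. \<bar>mertens_free (insert r (insert q T)) (X / real (q * r))\<bar>)
      = (\<Sum>(q,r)\<in>?S. \<bar>mertens_free (insert r (insert q T)) (X / real (q * r))\<bar>)"
  proof (rule sum.mono_neutral_left)
    show "\<forall>i\<in>?S - ?S'. (case i of (q, r) \<Rightarrow> \<bar>mertens_free (insert r (insert q T)) (X / real (q * r))\<bar>) = 0"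
    proof
      fix i assume i: "i \<in> ?S - ?S'"
      obtain q r where qr: "i = (q, r)" by (cases i)
      have "real (q * r) > X" using i qr by auto
      then have "X / real (q * r) < 1" using X0 by simp
      then show "(case i of (q, r) \<Rightarrow> \<bar>mertens_free (insert r (insert q T)) (X / real (q * r))\<bar>) = 0"
        by (simp add: qr mertens_free_def free_upto_empty del: of_nat_mult)
    qed
  qed (use finS in auto)
  with B2' have B2: "(\<Sum>(q,r)\<in>?S. \<bar>mertens_free (insert r (insert q T)) (X / real (q * r))\<bar>) \<le> E"
    by (simp only:)
  \<comment> \<open>\<open>ln p \<ge> 1/2\<close> gives \<open>v0 / ln p \<le> 192 * LLx\<close>,
    and \<open>776 = 4 * 192 + 8\<close>. One factor \<open>LLx\<close> comes from counting prime
    pairs, the other from the number of short scales.\<close>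
  have Eb: "E \<le> exp 1 * (360 * LLx) * X / (ln x / 2) * ((2 + 776 * C) * LLx)"
    unfolding E_def
  proof (rule mult_mono)
    show "exp 1 * (360 * LLx) * X / ln X \<le> exp 1 * (360 * LLx) * X / (ln x / 2)"
      using lX lx LL1 X0 X1' by (intro divide_left_mono mult_pos_pos mult_nonneg_nonneg) (auto | linarith)+
    have "v0 / ln (real p) = 64 * LLx * (1 + 1 / ln (real p))" unfolding v0_def using lp by (simp add: field_simps)
    also have "\<dots> \<le> 64 * LLx * (1 + 2)" using lp LL1 by (intro mult_left_mono add_left_mono) (auto simp: field_simps)
    finally have v: "v0 / ln (real p) \<le> 192 * LLx" by simp
    have "2 + 4 * C * (v0 / ln (real p)) + 8 * C \<le> 2 + 4 * C * (192 * LLx) + 8 * C"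
      using v C by (intro add_mono mult_left_mono) auto
    also have "\<dots> \<le> 2 * LLx + 4 * C * (192 * LLx) + 8 * C * LLx"
      using LL1 C mult_left_mono[of 1 LLx "8 * C"] by simp
    also have "\<dots> = (2 + 776 * C) * LLx" by (simp add: algebra_simps)
    finally show "2 + 4 * C * (v0 / ln (real p)) + 8 * C \<le> (2 + 776 * C) * LLx" .
  qed (use par lX lx LL1 X0 X1' C in auto)
  have "\<bar>\<Sum>n | 2 \<le> n \<and> real n \<le> x \<and> smallest_prime_factor n = p. of_int (moebius_mu n) * (real (omega n))\<^sup>2\<bar>
      = \<bar>mertens_free T X - 3 * (\<Sum>q\<in>P. mertens_free (insert q T) (X / real q))
      + (\<Sum>(q,r)\<in>?S. mertens_free (insert r (insert q T)) (X / real (q * r)))\<bar>"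
    unfolding sum_smallest_prime_factor_eq[OF p] P_def T_def X_def[symmetric] sum_moebius_omega_square_free by simp
  also have "\<dots> \<le> \<bar>mertens_free T X\<bar> + 3 * \<bar>\<Sum>q\<in>P. mertens_free (insert q T) (X / real q)\<bar>
      + \<bar>\<Sum>(q,r)\<in>?S. mertens_free (insert r (insert q T)) (X / real (q * r))\<bar>" by linarith
  also have "\<dots> \<le> E + 3 * E + E"
  proof (intro add_mono mult_left_mono B0)
    show "\<bar>\<Sum>q\<in>P. mertens_free (insert q T) (X / real q)\<bar> \<le> E" by (rule order_trans[OF sum_abs B1])
    show "\<bar>\<Sum>(q,r)\<in>?S. mertens_free (insert r (insert q T)) (X / real (q * r))\<bar> \<le> E"
      unfolding case_prod_beta by (rule order_trans[OF sum_abs B2[unfolded case_prod_beta]])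
  qed simp
  also have "E + 3 * E + E = 5 * E" by simp
  also have "5 * E \<le> 5 * (exp 1 * (360 * LLx) * X / (ln x / 2) * ((2 + 776 * C) * LLx))" using Eb by simp
  also have "5 * (exp 1 * (360 * LLx) * X / (ln x / 2) * ((2 + 776 * C) * LLx))
      = 3600 * exp 1 * (2 + 776 * C) * (ln (ln x))\<^sup>2 * x / (ln x) * (1 / real p)"
    unfolding X_def LLx_def by (simp add: power2_eq_square mult_ac)
  finally show ?thesis by simp
qed

section \<open>Large smallest prime factors and the final summation\<close>

lemma omega_le:
  assumes "n \<in> rough y x" "y > 1"
  shows "real (omega n) \<le> ln x / ln y"
proof -
  have n: "squarefree n" "1 \<le> n" "real n \<le> x" "\<forall>p\<in>prime_factors n. y < real p" using assms by (auto simp: rough_def)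
  have "real (omega n) * ln y = (\<Sum>p\<in>prime_factors n. ln y)" by (simp add: omega_def)
  also have "\<dots> \<le> (\<Sum>p\<in>prime_factors n. ln (real p))"
    using n assms by (intro sum_mono ln_mono) (auto simp: less_imp_le prime_factors_gt_0_nat)
  also have "\<dots> \<le> ln (real n)" using n by (intro sum_ln_prime_factors_le) auto
  also have "\<dots> \<le> ln x" using n by (intro ln_mono) auto
  finally show ?thesis using assms by (simp add: field_simps)
qed

text \<open>The cut is at \<open>y = exp (ln x / (512 * LL))\<close>. Up to \<open>y\<close> the
  bound for a fixed smallest prime factor is summed by Mertens. Above \<open>y\<close> the
  squarefree \<open>n\<close> are rough: they have at most \<open>512 * LL\<close> prime factors,
  and their number is of order \<open>x * LL / ln x\<close>.\<close>

lemma M_omega_sq_bound_of_mertens: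
  assumes CM: "CM \<ge> 0" "\<And>t. t \<ge> 2 \<Longrightarrow> \<bar>mertens_free {} t\<bar> \<le> CM * t / (ln t) ^ 8"
  shows "\<exists>C::real. \<forall>\<^sub>F x in at_top. \<forall>j l::nat. \<bar>M_omega_sq x j l\<bar> \<le> C * (x * (ln (ln x)) ^ 5 / ln x)"
proof -
  define C where "C = 2 + 4 * exp 6 + 16 * exp 48 * (256 * CM + 1)"
  define D where "D = 3600 * exp 1 * (2 + 776 * C)"
  have D0: "D \<ge> 0" unfolding D_def C_def using CM by simp
  define C2 where "C2 = (2 + 4 * exp (6::real)) * 512 ^ 3"
  have "\<forall>\<^sub>F x::real in at_top. ln (ln x) \<ge> 1 \<and> 512 * ln (ln x) \<le> ln x \<and> x > 1"
    by (intro eventually_conj; real_asymp)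
  then have "\<forall>\<^sub>F x in at_top. \<forall>j l::nat. \<bar>M_omega_sq x j l\<bar> \<le> (9 * D + C2) * (x * (ln (ln x)) ^ 5 / ln x)"
  proof (eventually_elim, intro allI)
    fix x :: real and j l :: nat assume x: "ln (ln x) \<ge> 1 \<and> 512 * ln (ln x) \<le> ln x \<and> x > 1"
    define LL where "LL = ln (ln x)"
    have LL: "LL \<ge> 1" "512 * LL \<le> ln x" using x by (auto simp: LL_def)
    have lx: "ln x > 0" using x by simp
    \<comment> \<open>\<open>512 = 64 * 2 * 4\<close>: with \<open>ln y \<ge> 1\<close> one gets
      \<open>64 * LL * (ln p + 1) \<le> 128 * LL * ln y = ln x / 4\<close>, which is the condition
      for fixed \<open>p\<close>.\<close>
    define y where "y = exp (ln x / (512 * LL))"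
    have ly: "ln y = ln x / (512 * LL)" by (simp add: y_def)
    have ly1: "ln y \<ge> 1" unfolding ly using LL by (simp add: pos_le_divide_eq)
    have y2: "y \<ge> 2" 
    proof -
      have "exp 1 \<le> y" using ly1 unfolding y_def by simp
      then show ?thesis using exp_ge_add_one_self[of "1::real"] by linarith
    qed
    have lyx: "ln y \<le> ln x" unfolding ly using LL lx by (simp add: field_simps)
    then have yx: "y \<le> x" using y2 x by (subst (asm) ln_le_cancel_iff) auto
    define N where "N = {n. 2 \<le> n \<and> real n \<le> x \<and> [smallest_prime_factor n = j] (mod l)}"
    define N1 where "N1 = {n\<in>N. real (smallest_prime_factor n) \<le> y}"
    define N2 where "N2 = {n\<in>N. \<not> real (smallest_prime_factor n) \<le> y}"
    let ?f = "\<lambda>n. of_int (moebius_mu n) * (real (omega n))\<^sup>2 :: real"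
    let ?P = "{p::nat. prime p \<and> real p \<le> y}"
    let ?S = "\<lambda>p. (\<Sum>n | 2 \<le> n \<and> real n \<le> x \<and> smallest_prime_factor n = p. ?f n)"
    have finN: "finite N" unfolding N_def by (rule finite_subset[of _ "{..nat \<lfloor>x\<rfloor>}"]) (auto simp: le_nat_floor)
    have fin: "finite N1" "finite N2" using finN by (auto simp: N1_def N2_def)
    have split: "M_omega_sq x j l = (\<Sum>n\<in>N1. ?f n) + (\<Sum>n\<in>N2. ?f n)"
    proof -
      have "N = N1 \<union> N2" by (auto simp: N1_def N2_def)
      then have "M_omega_sq x j l = (\<Sum>n\<in>N1 \<union> N2. ?f n)" by (simp add: M_omega_sq_def N_def)
      also have "\<dots> = (\<Sum>n\<in>N1. ?f n) + (\<Sum>n\<in>N2. ?f n)"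
        using fin by (intro sum.union_disjoint) (auto simp: N1_def N2_def)
      finally show ?thesis .
    qed
    have spf: "prime (smallest_prime_factor n)" if "n \<in> N" for n
      using smallest_prime_factor_in[of n] that by (auto simp: N_def)
    have "(\<Sum>n\<in>N1. ?f n) = (\<Sum>p\<in>?P. \<Sum>n | n \<in> N1 \<and> smallest_prime_factor n = p. ?f n)"
      using fin spf by (intro sum.group[symmetric]) (auto simp: N1_def)
    then have "\<bar>\<Sum>n\<in>N1. ?f n\<bar> \<le> (\<Sum>p\<in>?P. \<bar>\<Sum>n | n \<in> N1 \<and> smallest_prime_factor n = p. ?f n\<bar>)" by (simp only: sum_abs)
    also have "\<dots> \<le> (\<Sum>p\<in>?P. D * LL\<^sup>2 * x / ln x * (1 / real p))"
    proof (rule sum_mono)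
      fix p assume p: "p \<in> ?P"
      have pp: "prime p" using p by auto
      have "ln (real p) \<le> ln y" using p prime_gt_0_nat[OF pp] by (intro ln_mono) auto
      then have "64 * LL * (ln (real p) + 1) \<le> 64 * LL * (ln y + ln y)" using ly1 LL by (intro mult_left_mono) auto
      also have "\<dots> = ln x / 4" unfolding ly using LL by simp
      finally have "\<bar>?S p\<bar> \<le> D * LL\<^sup>2 * x / ln x * (1 / real p)"
        unfolding D_def C_def LL_def using CM pp x by (intro sum_smallest_prime_factor_bound) auto
      \<comment> \<open>The congruence depends on \<open>p\<close> alone, so it keeps or discards
        the inner sum as a whole.\<close>
      moreover have "(\<Sum>n | n \<in> N1 \<and> smallest_prime_factor n = p. ?f n) = (if [p = j] (mod l) then ?S p else 0)"
      proof (cases "[p = j] (mod l)")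
        case True
        then have "{n. n \<in> N1 \<and> smallest_prime_factor n = p} = {n. 2 \<le> n \<and> real n \<le> x \<and> smallest_prime_factor n = p}"
          using p by (auto simp: N1_def N_def)
        then show ?thesis using True by simp
      next
        case False
        then have "{n. n \<in> N1 \<and> smallest_prime_factor n = p} = {}" by (auto simp: N1_def N_def)
        then show ?thesis using False by (simp only: sum.empty if_False)
      qed
      moreover have "D * LL\<^sup>2 * x / ln x * (1 / real p) \<ge> 0" using D0 x lx by simp
      ultimately show "\<bar>\<Sum>n | n \<in> N1 \<and> smallest_prime_factor n = p. ?f n\<bar> \<le> D * LL\<^sup>2 * x / ln x * (1 / real p)" by simp
    qed
    also have "\<dots> = D * LL\<^sup>2 * x / ln x * (\<Sum>p\<in>?P. 1 / real p)" by (simp add: sum_distrib_left)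
    also have "\<dots> \<le> D * LL\<^sup>2 * x / ln x * (9 * LL)"
    proof (rule mult_left_mono)
      have "ln (ln y) \<le> LL" unfolding LL_def by (rule ln_mono) (use lyx ly1 in linarith)+
      then show "(\<Sum>p\<in>?P. 1 / real p) \<le> 9 * LL" using sum_prime_recip_le[OF y2] LL by linarith
    qed (use D0 x lx in auto)
    also have "\<dots> = 9 * D * (x * LL ^ 3 / ln x)" by (simp add: power3_eq_cube power2_eq_square)
    finally have S1: "\<bar>\<Sum>n\<in>N1. ?f n\<bar> \<le> 9 * D * (x * LL ^ 3 / ln x)" .
    have "(\<Sum>n\<in>N2. ?f n) = (\<Sum>n\<in>{n\<in>N2. squarefree n}. ?f n)"
      using fin by (intro sum.mono_neutral_right) (auto simp: moebius_mu_def)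
    then have "\<bar>\<Sum>n\<in>N2. ?f n\<bar> \<le> (\<Sum>n\<in>{n\<in>N2. squarefree n}. \<bar>?f n\<bar>)" by (simp only: sum_abs)
    also have "\<dots> \<le> (\<Sum>n\<in>rough y x. (512 * LL)\<^sup>2)"
    proof (rule order_trans)
      have rough: "n \<in> rough y x" if n: "n \<in> N2" "squarefree n" for n
      proof -
        have "y < real p" if "p \<in> prime_factors n" for p
        proof -
          have "smallest_prime_factor n \<le> p" using that unfolding smallest_prime_factor_def by (intro Min_le) auto
          then show ?thesis using n by (auto simp: N2_def)
        qed
        then show ?thesis using n by (auto simp: rough_def N2_def N_def)
      qed
      show "(\<Sum>n\<in>{n\<in>N2. squarefree n}. \<bar>?f n\<bar>) \<le> (\<Sum>n\<in>{n\<in>N2. squarefree n}. (512 * LL)\<^sup>2)"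
      proof (rule sum_mono)
        fix n assume n: "n \<in> {n\<in>N2. squarefree n}"
        have "real (omega n) \<le> 512 * LL"
          using omega_le[of n y x] rough[of n] n y2 lx LL unfolding ly by simp
        then have "(real (omega n))\<^sup>2 \<le> (512 * LL)\<^sup>2" by (intro power_mono) auto
        moreover have "\<bar>of_int (moebius_mu n) :: real\<bar> \<le> 1" using abs_moebius_mu_le[of n] by linarith
        ultimately have "\<bar>of_int (moebius_mu n) :: real\<bar> * (real (omega n))\<^sup>2 \<le> 1 * (512 * LL)\<^sup>2"
          by (intro mult_mono) auto
        then show "\<bar>?f n\<bar> \<le> (512 * LL)\<^sup>2" by (simp add: abs_mult)
      qed
      show "(\<Sum>n\<in>{n\<in>N2. squarefree n}. (512 * LL)\<^sup>2) \<le> (\<Sum>n\<in>rough y x. (512 * LL)\<^sup>2)"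
        using rough by (intro sum_mono2) auto
    qed
    also have "\<dots> = real (card (rough y x)) * (512 * LL)\<^sup>2" by simp
    also have "\<dots> \<le> (2 + 4 * exp 6) * x / ln y * (512 * LL)\<^sup>2"
      using card_rough_le[OF y2 yx] by (intro mult_right_mono) auto
    also have "\<dots> = C2 * (x * LL ^ 3 / ln x)"
      unfolding ly C2_def using LL by (simp add: field_simps power2_eq_square power3_eq_cube)
    finally have S2: "\<bar>\<Sum>n\<in>N2. ?f n\<bar> \<le> C2 * (x * LL ^ 3 / ln x)" .
    have "\<bar>M_omega_sq x j l\<bar> \<le> (9 * D + C2) * (x * LL ^ 3 / ln x)"
      unfolding split distrib_right using S1 S2 by linarith
    \<comment> \<open>Both ranges give a cube of \<open>LL\<close>, and
      \<open>LL \<ge> 1\<close>.\<close>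
    also have "\<dots> \<le> (9 * D + C2) * (x * LL ^ 5 / ln x)"
      using LL D0 lx x unfolding C2_def
      by (intro mult_left_mono divide_right_mono power_increasing) auto
    finally show "\<bar>M_omega_sq x j l\<bar> \<le> (9 * D + C2) * (x * (ln (ln x)) ^ 5 / ln x)" by (simp add: LL_def)
  qed
  then show ?thesis by blast
qed

section \<open>The zeta function near the line of real part one\<close>

lemma norm_nat_powr: "norm (of_nat n powr z :: complex) = real n powr Re z"
  by (subst norm_powr_real_powr) auto

text \<open>For \<open>n \<ge> 1\<close> this is \<open>s - 1\<close> times the difference between
  \<open>n powr (- s)\<close> and the integral of \<open>u powr (- s)\<close> over the interval from
  \<open>n\<close> to \<open>n + 1\<close>, with the integral evaluated so that no quotient
  occurs.\<close>

definition zeta_term :: "nat \<Rightarrow> complex \<Rightarrow> complex" where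
  "zeta_term n s = of_nat (Suc n) powr (1 - s) - of_nat n powr (1 - s) + (s - 1) * of_nat n powr (- s)"

text \<open>The function \<open>(s - 1) * \<zeta>(s)\<close>, which has no pole. For
  \<open>Re s > 1\<close> the telescoping part of the series sums to -1, and the leading 1 cancels
  it.\<close>

definition zetaH :: "complex \<Rightarrow> complex" where
  "zetaH s = 1 + (\<Sum>n. zeta_term (Suc n) s)"

text \<open>The term is the first-order Taylor remainder of \<open>u powr (1 - s)\<close> between
  \<open>n\<close> and \<open>n + 1\<close>. The second derivative supplies the extra power of
  \<open>n\<close> that makes the series converge for \<open>Re s > 0\<close>.\<close>

lemma norm_zeta_term_le:
  assumes n: "n \<ge> 1" and s: "Re s > 0"
  shows "norm (zeta_term n s) \<le> norm s * norm (s - 1) * real n powr (- Re s - 1)"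
proof -
  define f :: "nat \<Rightarrow> complex \<Rightarrow> complex" where
    "f i u = (if i = 0 then u powr (1 - s) else if i = 1 then (1 - s) * u powr (- s) else (1 - s) * (- s) * u powr (- s - 1))" for i u
  define S where "S = closed_segment (of_nat n :: complex) (of_nat (Suc n))"
  have S: "\<exists>r. u = complex_of_real r \<and> r \<ge> real n" if u: "u \<in> S" for u
  proof -
    have "u \<in> closed_segment (complex_of_real (real n)) (complex_of_real (real (Suc n)))" using u unfolding S_def by simp
    then obtain r where "u = complex_of_real r" "r \<in> closed_segment (real n) (real (Suc n))"
      unfolding closed_segment_of_real by auto
    then show ?thesis by (auto simp: closed_segment_eq_real_ivl)
  qed
  have nz: "u \<notin> \<real>\<^sub>\<le>\<^sub>0" if u: "u \<in> S" for u
    using S[OF u] n by (auto simp: complex_nonpos_Reals_iff)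
  have "norm (f 0 (of_nat (Suc n)) - (\<Sum>i\<le>1. f i (of_nat n) * (of_nat (Suc n) - of_nat n) ^ i / fact i))
     \<le> (norm s * norm (s - 1) * real n powr (- Re s - 1)) * norm (of_nat (Suc n) - of_nat n :: complex) ^ (Suc 1) / fact 1"
  proof (rule complex_Taylor)
    show "convex S" unfolding S_def by (rule convex_closed_segment)
    show "of_nat n \<in> S" "of_nat (Suc n) \<in> S" unfolding S_def by auto
    show "(f i has_field_derivative f (Suc i) u) (at u within S)" if "u \<in> S" "i \<le> 1" for i u
    proof -
      have "i = 0 \<or> i = 1" using that by auto
      then have "(f i has_field_derivative f (Suc i) u) (at u)"
      proof
        assume i: "i = 0"
        have "((\<lambda>u. u powr (1 - s)) has_field_derivative ((1 - s) * u powr (1 - s - 1))) (at u)"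
          by (rule has_field_derivative_powr[OF nz[OF that(1)]])
        then show ?thesis unfolding i f_def by simp
      next
        assume i: "i = 1"
        have "((\<lambda>u. (1 - s) * u powr (- s)) has_field_derivative ((1 - s) * (- s * u powr (- s - 1)))) (at u)"
          by (intro DERIV_cmult has_field_derivative_powr nz that)
        then show ?thesis unfolding i f_def by (simp add: mult.assoc)
      qed
      then show ?thesis by (rule has_field_derivative_at_within)
    qed
    show "cmod (f (Suc 1) u) \<le> norm s * norm (s - 1) * real n powr (- Re s - 1)" if u: "u \<in> S" for u
    proof -
      obtain r where r: "u = complex_of_real r" "r \<ge> real n" using S[OF u] by auto
      have "norm (u powr (- s - 1)) = r powr (- Re s - 1)"
        using r n by (subst norm_powr_real_powr) auto
      also have "\<dots> \<le> real n powr (- Re s - 1)" using r n s by (intro powr_mono2') auto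
      finally have "norm (u powr (- s - 1)) \<le> real n powr (- Re s - 1)" .
      then show ?thesis by (simp add: f_def norm_mult norm_minus_commute mult_left_mono mult.commute[of "norm s"])
    qed
  qed
  moreover have "f 0 (of_nat (Suc n)) - (\<Sum>i\<le>1. f i (of_nat n) * (of_nat (Suc n) - of_nat n) ^ i / fact i) = zeta_term n s"
    by (simp add: f_def zeta_term_def algebra_simps)
  ultimately show ?thesis by simp
qed

lemma summable_zeta_bound: "a > 0 \<Longrightarrow> summable (\<lambda>n. real (Suc n) powr (- a - 1))"
  using summable_real_powr_iff[of "- a - 1"] summable_Suc_iff[of "\<lambda>n. real n powr (- a - 1)"] by simp

lemma summable_zeta_term:
  assumes "Re s > 0"
  shows "summable (\<lambda>n. zeta_term (Suc n) s)"
proof (rule summable_comparison_test'[where N = 0])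
  show "summable (\<lambda>n. norm s * norm (s - 1) * real (Suc n) powr (- Re s - 1))"
    using summable_zeta_bound[OF assms] by (intro summable_mult)
  show "norm (zeta_term (Suc n) s) \<le> norm s * norm (s - 1) * real (Suc n) powr (- Re s - 1)" for n
    using norm_zeta_term_le[of "Suc n" s] assms by simp
qed

lemma holomorphic_zeta_term: "n \<ge> 1 \<Longrightarrow> zeta_term n holomorphic_on A"
  unfolding zeta_term_def[abs_def] by (intro holomorphic_intros) auto

lemma holomorphic_zetaH: "zetaH holomorphic_on {s. Re s > 0}"
proof -
  let ?S = "{s::complex. Re s > 0}"
  have "(\<lambda>s. \<Sum>n. zeta_term (Suc n) s) holomorphic_on ?S"
  proof (rule holomorphic_uniform_sequence)
    show op: "open ?S" by (rule open_halfspace_Re_gt)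
    show "(\<lambda>s. \<Sum>n<N. zeta_term (Suc n) s) holomorphic_on ?S" for N
      by (intro holomorphic_intros holomorphic_zeta_term) auto
    show "\<exists>d>0. cball s d \<subseteq> ?S \<and> uniform_limit (cball s d) (\<lambda>N s. \<Sum>n<N. zeta_term (Suc n) s) (\<lambda>s. \<Sum>n. zeta_term (Suc n) s) sequentially"
      if "s \<in> ?S" for s
    proof (intro exI conjI)
      define d where "d = Re s / 2"
      show d0: "d > 0" using that by (simp add: d_def)
      have Re: "Re w \<ge> d" if "w \<in> cball s d" for w
      proof -
        have "\<bar>Re (s - w)\<bar> \<le> d" using that abs_Re_le_cmod[of "s - w"] by (simp add: dist_norm)
        then have "\<bar>Re s - Re w\<bar> \<le> Re s / 2" by (simp add: d_def)
        then show ?thesis unfolding d_def by linarith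
      qed
      then show "cball s d \<subseteq> ?S" using d0 by fastforce
      define K where "K = norm s + d"
      show "uniform_limit (cball s d) (\<lambda>N s. \<Sum>n<N. zeta_term (Suc n) s) (\<lambda>s. \<Sum>n. zeta_term (Suc n) s) sequentially"
      proof (rule Weierstrass_m_test)
        show "summable (\<lambda>n. K * (K + 1) * real (Suc n) powr (- d - 1))"
          using summable_zeta_bound[OF d0] by (intro summable_mult)
        fix n w assume w: "w \<in> cball s d"
        have nw: "norm w \<le> K" using w norm_triangle_sub[of w s] by (simp add: K_def dist_norm norm_minus_commute)
        have "norm (w - 1) \<le> K + 1" using nw norm_triangle_ineq4[of w 1] by simp
        then have 1: "norm w * norm (w - 1) \<le> K * (K + 1)" using nw by (intro mult_mono) (auto intro: order_trans[OF norm_ge_zero])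
        have "norm (zeta_term (Suc n) w) \<le> norm w * norm (w - 1) * real (Suc n) powr (- Re w - 1)"
          using Re[OF w] d0 by (intro norm_zeta_term_le) auto
        also have "\<dots> \<le> K * (K + 1) * real (Suc n) powr (- d - 1)"
        proof (rule mult_mono[OF 1])
          show "real (Suc n) powr (- Re w - 1) \<le> real (Suc n) powr (- d - 1)" using Re[OF w] by (intro powr_mono) auto
          show "0 \<le> K * (K + 1)" by (rule order_trans[OF _ 1]) simp
        qed simp
        finally show "norm (zeta_term (Suc n) w) \<le> K * (K + 1) * real (Suc n) powr (- d - 1)" .
      qed
    qed
  qed
  then show ?thesis unfolding zetaH_def[abs_def] by (intro holomorphic_intros)
qed

lemma summable_norm_nat_powr: "Re s > 1 \<Longrightarrow> summable (\<lambda>n. norm (of_nat n powr (- s) :: complex))"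
  unfolding norm_nat_powr using summable_real_powr_iff[of "- Re s"] by simp

lemma zetaH_eq:
  assumes "Re s > 1"
  shows "zetaH s = (s - 1) * (\<Sum>n. of_nat n powr (- s))"
proof -
  have sm: "summable (\<lambda>n. of_nat n powr (- s) :: complex)"
    using summable_norm_nat_powr[OF assms] by (rule summable_norm_cancel)
  have 0: "(\<lambda>n. of_nat (Suc n) powr (1 - s) :: complex) \<longlonglongrightarrow> 0"
  proof (rule tendsto_norm_zero_cancel)
    have "(\<lambda>n. real n powr (1 - Re s)) \<longlonglongrightarrow> 0" using assms by real_asymp
    from LIMSEQ_Suc[OF this] show "(\<lambda>n. norm (of_nat (Suc n) powr (1 - s) :: complex)) \<longlonglongrightarrow> 0"
      unfolding norm_nat_powr by simp
  qed
  have "(\<lambda>n. of_nat (Suc (Suc n)) powr (1 - s) - of_nat (Suc n) powr (1 - s) :: complex) sums (0 - of_nat (Suc 0) powr (1 - s))"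
    by (rule telescope_sums[OF 0])
  moreover have "(\<lambda>n. (s - 1) * of_nat (Suc n) powr (- s)) sums ((s - 1) * ((\<Sum>n. of_nat n powr (- s)) - of_nat 0 powr (- s)))"
    by (intro sums_mult, subst sums_Suc_iff) (use summable_sums[OF sm] in simp)
  ultimately have "(\<lambda>n. (of_nat (Suc (Suc n)) powr (1 - s) - of_nat (Suc n) powr (1 - s)) + (s - 1) * of_nat (Suc n) powr (- s))
     sums ((0 - of_nat (Suc 0) powr (1 - s)) + (s - 1) * ((\<Sum>n. of_nat n powr (- s)) - of_nat 0 powr (- s)))"
    by (rule sums_add)
  then have "(\<lambda>n. zeta_term (Suc n) s) sums (-1 + (s - 1) * (\<Sum>n. of_nat n powr (- s)))"
    by (simp add: zeta_term_def)
  then show ?thesis unfolding zetaH_def by (simp add: sums_iff)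
qed

section \<open>Upper bound for zeta near the line\<close>

lemma sum_powr_tail:
  assumes "N \<ge> 1"
  shows "summable (\<lambda>n. real (n + N) powr (- 3 / 2))" "(\<Sum>n. real (n + N) powr (- 3 / 2)) \<le> 4 / sqrt (real N)"
proof -
  show s: "summable (\<lambda>n. real (n + N) powr (- 3 / 2))"
    using summable_real_powr_iff[of "- 3 / 2"] summable_iff_shift[of "\<lambda>n. real n powr (- 3 / 2)" N] by simp
  have 0: "(\<lambda>n. 1 / sqrt (real (n + N))) \<longlonglongrightarrow> 0" by real_asymp
  have t: "(\<lambda>n. 1 / sqrt (real (n + N)) - 1 / sqrt (real (Suc n + N))) sums (1 / sqrt (real (0 + N)) - 0)"
    by (rule telescope_sums'[OF 0])
  \<comment> \<open>Comparison with a telescoping series: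
    \<open>1 / a - 1 / b = 1 / (a * b * (a + b))\<close>, and \<open>b \<le> 3/2 * a\<close> makes
    this at least a quarter of \<open>1 / a ^ 3\<close>.\<close>
  have "(\<Sum>n. real (n + N) powr (- 3 / 2)) \<le> (\<Sum>n. 4 * (1 / sqrt (real (n + N)) - 1 / sqrt (real (Suc n + N))))"
  proof (rule suminf_le[OF _ s])
    show "summable (\<lambda>n. 4 * (1 / sqrt (real (n + N)) - 1 / sqrt (real (Suc n + N))))"
      using t by (intro summable_mult) (simp add: sums_iff)
    fix n
    define a where "a = sqrt (real (n + N))"
    define b where "b = sqrt (real (Suc n + N))"
    have a: "a \<ge> 1" "a\<^sup>2 = real (n + N)" "b\<^sup>2 = a\<^sup>2 + 1" "b > 0" using assms unfolding a_def b_def by auto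
    have ab: "b \<le> (3/2) * a"
    proof (rule power2_le_imp_le)
      have "1 \<le> a\<^sup>2" using a(1) by simp
      then have "b\<^sup>2 \<le> 9/4 * a\<^sup>2" using a(3) by simp
      then show "b\<^sup>2 \<le> (3/2 * a)\<^sup>2" by (simp add: power_mult_distrib power2_eq_square)
    qed (use a in simp)
    have "real (n + N) powr (- 3 / 2) = 1 / a ^ 3"
    proof -
      have "real (n + N) = a powr 2" using a by simp
      then have "real (n + N) powr (- 3 / 2) = (a powr 2) powr (- 3 / 2)" by (simp only:)
      also have "\<dots> = a powr (- 3)" by (subst powr_powr) simp
      finally have "real (n + N) powr (- 3 / 2) = a powr (- 3)" .
      then show ?thesis using a(1) by (simp add: powr_minus inverse_eq_divide)
    qed
    also have "\<dots> \<le> 4 * (1 / (a * b * (a + b)))"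
    proof -
      have "a * b * (a + b) \<le> a * (3/2 * a) * (a + 3/2 * a)" using ab a by (intro mult_mono) auto
      also have "\<dots> \<le> 4 * a ^ 3" using a by (simp add: power3_eq_cube)
      finally have "4 / (4 * a ^ 3) \<le> 4 / (a * b * (a + b))" using a
        by (intro divide_left_mono mult_pos_pos) auto
      then show ?thesis by simp
    qed
    also have "1 / (a * b * (a + b)) = 1 / a - 1 / b"
    proof -
      have "(b - a) * (a + b) = 1" using a(3) by (simp add: algebra_simps power2_eq_square)
      then have "1 / (a * b * (a + b)) = (b - a) * (a + b) / (a * b * (a + b))" by simp
      also have "\<dots> = (b - a) / (a * b)" using a by simp
      also have "\<dots> = 1 / a - 1 / b" using a by (simp add: field_simps)
      finally show ?thesis .
    qed
    finally show "real (n + N) powr (- 3 / 2) \<le> 4 * (1 / sqrt (real (n + N)) - 1 / sqrt (real (Suc n + N)))"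
      by (simp add: a_def b_def)
  qed
  also have "\<dots> = 4 * (1 / sqrt (real N))" using t by (subst suminf_mult) (auto simp: sums_iff)
  finally show "(\<Sum>n. real (n + N) powr (- 3 / 2)) \<le> 4 / sqrt (real N)" by simp
qed

text \<open>Cutting the series at \<open>N\<close> collapses the telescoping part to one power of
  \<open>N\<close> and leaves a Dirichlet polynomial, plus a tail that can be controlled by taking
  \<open>N\<close> of the size of the square of the imaginary part.\<close>

lemma zetaH_split:
  assumes "Re s > 0" "N \<ge> 1"
  shows "zetaH s = of_nat N powr (1 - s) + (s - 1) * (\<Sum>n=1..<N. of_nat n powr (- s)) + (\<Sum>n. zeta_term (n + N) s)"
proof -
  have "zetaH s = 1 + (\<Sum>n<N - 1. zeta_term (Suc n) s) + (\<Sum>n. zeta_term (Suc (n + (N - 1))) s)"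
    unfolding zetaH_def using suminf_split_initial_segment[OF summable_zeta_term[OF assms(1)], of "N - 1"] by simp
  also have "(\<lambda>n. zeta_term (Suc (n + (N - 1))) s) = (\<lambda>n. zeta_term (n + N) s)" using assms by simp
  also have "(\<Sum>n<N - 1. zeta_term (Suc n) s) = of_nat N powr (1 - s) - 1 + (s - 1) * (\<Sum>n=1..<N. of_nat n powr (- s))"
    using assms(2)
  proof (induction N rule: dec_induct)
    case (step N)
    have "(\<Sum>n<Suc N - 1. zeta_term (Suc n) s) = (\<Sum>n<N - 1. zeta_term (Suc n) s) + zeta_term N s"
      using step by (cases N) auto
    also have "\<dots> = of_nat (Suc N) powr (1 - s) - 1 + (s - 1) * ((\<Sum>n=1..<N. of_nat n powr (- s)) + of_nat N powr (- s))"
      unfolding step.IH by (simp add: zeta_term_def algebra_simps del: of_nat_Suc)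
    finally show ?case using step by simp
  qed auto
  finally show ?thesis by simp
qed

definition zeta :: "complex \<Rightarrow> complex" where
  "zeta s = zetaH s / (s - 1)"

lemma sum_inverse_le_ln: "n \<ge> 1 \<Longrightarrow> (\<Sum>k=1..n. 1 / real k) \<le> 1 + ln (real n)"
proof (induction n rule: dec_induct)
  case (step n)
  have "ln (real n / real (Suc n)) \<le> real n / real (Suc n) - 1" using step by (intro ln_le_minus_one) auto
  then have "1 / real (Suc n) \<le> ln (real (Suc n)) - ln (real n)" using step by (simp add: ln_div field_simps)
  then show ?case using step by simp
qed auto

text \<open>In this region \<open>n powr (1 - Re s)\<close> is bounded for all
  \<open>n \<le> N\<close>, because \<open>ln N\<close> is at most three times the logarithm in the
  statement; so the Dirichlet polynomial costs only a harmonic sum. The region reaches to the left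
  of the line so that Cauchy's estimate can be applied around points on it.\<close>

lemma norm_zeta_le:
  assumes t: "\<bar>Im s\<bar> \<ge> 1" and \<sigma>: "Re s \<le> 3" "Re s \<ge> 1 - 1 / (2 * ln (\<bar>Im s\<bar> + 3))"
  shows "norm (zeta s) \<le> 29 * ln (\<bar>Im s\<bar> + 3)"
proof -
  define u where "u = \<bar>Im s\<bar> + 3"
  define L where "L = ln u"
  \<comment> \<open>About \<open>u\<^sup>2\<close> terms make the tail, at most
    \<open>4 * norm s * norm (s - 1) / sqrt N\<close>, no larger than
    \<open>4 * norm (s - 1)\<close>. A perfect square keeps \<open>sqrt N\<close> explicit.\<close>
  define N where "N = (nat \<lceil>u\<rceil>)\<^sup>2"
  have u: "u \<ge> 4" using t by (simp add: u_def)
  have L1: "L \<ge> 1"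
  proof -
    have "exp 1 \<le> (3::real)" using e_less_272 by simp
    then have "exp 1 \<le> u" using u by simp
    then have "ln (exp 1) \<le> ln u" by (intro ln_mono) auto
    then show ?thesis by (simp add: L_def)
  qed
  have \<sigma>2: "Re s \<ge> 1 - 1 / (2 * L)" using \<sigma> by (simp add: L_def u_def)
  have half: "Re s \<ge> 1/2"
  proof -
    have "1 / (2 * L) \<le> 1 / 2" using L1 by (simp add: field_simps)
    then show ?thesis using \<sigma>2 by linarith
  qed
  have sqN: "sqrt (real N) = real (nat \<lceil>u\<rceil>)" by (simp add: N_def)
  have sN: "sqrt (real N) \<ge> u" unfolding sqN by linarith
  have N1: "N \<ge> 1" using u by (simp add: N_def Suc_le_eq)
  have Nu: "real N \<le> u ^ 3"
  proof -
    have "real (nat \<lceil>u\<rceil>) \<le> u + 1" using u by linarith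
    then have "real N \<le> (u + 1)\<^sup>2" unfolding N_def of_nat_power by (intro power_mono) auto
    also have "\<dots> \<le> (5/4 * u)\<^sup>2" using u by (intro power_mono) auto
    also have "\<dots> = 25/16 * u\<^sup>2" by (simp add: power_mult_distrib power2_eq_square)
    also have "\<dots> \<le> u * u\<^sup>2" using u by (intro mult_right_mono) auto
    finally show ?thesis by (simp add: power3_eq_cube power2_eq_square)
  qed
  have lnN: "ln (real N) \<le> 3 * L" "ln (real N) \<ge> 0"
  proof -
    have "ln (real N) \<le> ln (u ^ 3)" using Nu N1 by (intro ln_mono) auto
    then show "ln (real N) \<le> 3 * L" using u by (simp add: L_def ln_realpow)
  qed (use N1 in simp)
  have exp5: "exp (3/2::real) \<le> 5"
  proof -
    have "exp (3/2::real) ^ 2 = exp 3" by (simp add: power2_eq_square mult_exp_exp)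
    also have "\<dots> = exp 1 ^ 3" using exp_of_nat_mult[of 3 "1::real"] by simp
    also have "\<dots> \<le> (272/100) ^ 3" using e_less_272 by (intro power_mono) auto
    also have "\<dots> \<le> (5::real) ^ 2" by (simp add: power3_eq_cube)
    finally show ?thesis by (rule power2_le_imp_le) simp
  qed
  have pow: "real n powr (1 - Re s) \<le> 5" if n: "n \<ge> 1" "n \<le> N" for n
  proof -
    have "(1 - Re s) * ln (real n) \<le> 1 / (2 * L) * ln (real n)"
      using \<sigma>2 n by (intro mult_right_mono) auto
    also have "\<dots> \<le> 1 / (2 * L) * (3 * L)"
    proof (intro mult_left_mono)
      have "ln (real n) \<le> ln (real N)" using n by (intro ln_mono) auto
      then show "ln (real n) \<le> 3 * L" using lnN by linarith
    qed (use L1 in auto)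
    also have "\<dots> = 3/2" using L1 by simp
    finally have "exp ((1 - Re s) * ln (real n)) \<le> exp (3/2)" by (simp only: exp_le_cancel_iff)
    moreover have "real n powr (1 - Re s) = exp ((1 - Re s) * ln (real n))" using n by (simp add: powr_def)
    ultimately show ?thesis using exp5 by linarith
  qed
  have s1: "norm (s - 1) \<ge> 1" using abs_Im_le_cmod[of "s - 1"] t by simp
  have "norm s \<le> \<bar>Re s\<bar> + \<bar>Im s\<bar>" by (rule cmod_le)
  then have su: "norm s \<le> u" using \<sigma> half by (simp add: u_def)
  have A: "norm (of_nat N powr (1 - s) :: complex) \<le> 5" unfolding norm_nat_powr using pow[of N] N1 by simp
  have B: "norm (\<Sum>n=1..<N. of_nat n powr (- s) :: complex) \<le> 5 * (1 + 3 * L)"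
  proof -
    have "norm (\<Sum>n=1..<N. of_nat n powr (- s) :: complex) \<le> (\<Sum>n=1..<N. 5 * (1 / real n))"
    proof (rule sum_norm_le)
      fix n assume n: "n \<in> {1..<N}"
      have "norm (of_nat n powr (- s) :: complex) = real n powr (1 - Re s) * (1 / real n)"
        unfolding norm_nat_powr using n by (simp add: powr_diff powr_minus field_simps)
      also have "\<dots> \<le> 5 * (1 / real n)" using pow[of n] n by (intro mult_right_mono) auto
      finally show "norm (of_nat n powr (- s) :: complex) \<le> 5 * (1 / real n)" .
    qed
    also have "\<dots> \<le> (\<Sum>n=1..N. 5 * (1 / real n))" by (rule sum_mono2) auto
    also have "\<dots> = 5 * (\<Sum>n=1..N. 1 / real n)" by (rule sum_distrib_left[symmetric])
    also have "\<dots> \<le> 5 * (1 + 3 * L)" using sum_inverse_le_ln[OF N1] lnN by simp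
    finally show ?thesis .
  qed
  have C: "norm (\<Sum>n. zeta_term (n + N) s) \<le> 4 * norm (s - 1)"
  proof -
    have "norm (\<Sum>n. zeta_term (n + N) s) \<le> (\<Sum>n. norm s * norm (s - 1) * real (n + N) powr (- 3 / 2))"
    proof -
      have b: "norm (zeta_term (n + N) s) \<le> norm s * norm (s - 1) * real (n + N) powr (- 3 / 2)" for n
      proof -
        have "norm (zeta_term (n + N) s) \<le> norm s * norm (s - 1) * real (n + N) powr (- Re s - 1)"
          using N1 half by (intro norm_zeta_term_le) auto
        also have "\<dots> \<le> norm s * norm (s - 1) * real (n + N) powr (- 3 / 2)"
          using N1 half by (intro mult_left_mono powr_mono) auto
        finally show ?thesis .
      qed
      show ?thesis
        by (rule norm_suminf_le[OF b]) (intro summable_mult sum_powr_tail(1)[OF N1])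
    qed
    also have "\<dots> = norm s * norm (s - 1) * (\<Sum>n. real (n + N) powr (- 3 / 2))"
      by (rule suminf_mult[OF sum_powr_tail(1)[OF N1]])
    also have "\<dots> \<le> norm s * norm (s - 1) * (4 / sqrt (real N))"
      using sum_powr_tail(2)[OF N1] by (intro mult_left_mono) auto
    also have "\<dots> = norm s / sqrt (real N) * (4 * norm (s - 1))" by simp
    also have "\<dots> \<le> 1 * (4 * norm (s - 1))"
    proof (rule mult_right_mono)
      show "norm s / sqrt (real N) \<le> 1" using su sN u by (subst pos_divide_le_eq) linarith+
    qed simp
    finally show ?thesis by simp
  qed
  have "norm (zetaH s) \<le> 5 + norm (s - 1) * (5 * (1 + 3 * L)) + 4 * norm (s - 1)"
    unfolding zetaH_split[OF less_le_trans[OF _ half] N1, simplified]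
    using A C mult_left_mono[OF B norm_ge_zero[of "s - 1"]]
    by (intro norm_triangle_le add_mono) (auto simp: norm_mult)
  \<comment> \<open>\<open>norm (s - 1) \<ge> 1\<close> lets every term take this factor; then
    \<open>29 = 5 + 5 + 15 + 4\<close>.\<close>
  also have "\<dots> \<le> norm (s - 1) * (5 + 5 * (1 + 3 * L) + 4)" using s1 by (simp add: algebra_simps)
  also have "\<dots> \<le> norm (s - 1) * (29 * L)" using L1 by (intro mult_left_mono) auto
  finally have "norm (zetaH s) / norm (s - 1) \<le> 29 * L" using s1 by (subst pos_divide_le_eq) (linarith, simp add: mult_ac)
  then show ?thesis by (simp add: zeta_def norm_divide L_def u_def)
qed

section \<open>Dirichlet series over integers free of given primes, and the Euler product\<close>

definition free_dirichlet :: "(nat \<Rightarrow> complex) \<Rightarrow> nat set \<Rightarrow> complex \<Rightarrow> complex" where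
  "free_dirichlet c T s = (\<Sum>\<^sub>\<infinity>n\<in>free_of T. c n * of_nat n powr (- s))"

lemma free_dirichlet_summable:
  fixes c :: "nat \<Rightarrow> complex"
  assumes s: "Re s > 1" and c: "\<And>n. norm (c n) \<le> 1"
  shows "(\<lambda>n. c n * of_nat n powr (- s)) summable_on A"
proof -
  have "summable (\<lambda>n. norm (c n * of_nat n powr (- s)))"
  proof (rule summable_comparison_test'[where N = 0])
    show "summable (\<lambda>n. norm (of_nat n powr (- s) :: complex))" by (rule summable_norm_nat_powr[OF s])
    show "norm (norm (c n * of_nat n powr (- s))) \<le> norm (of_nat n powr (- s) :: complex)" for n
      using c[of n] mult_right_mono[of "norm (c n)" 1 "norm (of_nat n powr (- s) :: complex)"] by (simp add: norm_mult)
  qed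
  then have "(\<lambda>n. c n * of_nat n powr (- s)) summable_on UNIV" by (rule norm_summable_imp_summable_on)
  then show ?thesis by (rule summable_on_subset_banach) simp
qed

text \<open>The multiples of \<open>q\<close> are split off and rescaled. The coefficients
  \<open>c (q * m)\<close> stay open so that both the constant 1 and \<mu> can be inserted.\<close>

lemma free_dirichlet_insert_aux:
  fixes c :: "nat \<Rightarrow> complex"
  assumes s: "Re s > 1" and c: "\<And>n. norm (c n) \<le> 1" and q: "prime q" "q \<notin> T" and T: "\<And>r. r \<in> T \<Longrightarrow> prime r"
  shows "free_dirichlet c T s = free_dirichlet c (insert q T) s + of_nat q powr (- s) * (\<Sum>\<^sub>\<infinity>m\<in>free_of T. c (q * m) * of_nat m powr (- s))"
proof -
  have q0: "q > 0" using q prime_gt_0_nat by auto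
  have mult: "{n\<in>free_of T. q dvd n} = (*) q ` free_of T"
    using q T by (rule multiples_free_of)
  have A: "free_of T = free_of (insert q T) \<union> {n\<in>free_of T. q dvd n}" "free_of (insert q T) \<inter> {n\<in>free_of T. q dvd n} = {}"
    by (auto simp: free_of_def)
  have "free_dirichlet c T s = free_dirichlet c (insert q T) s + (\<Sum>\<^sub>\<infinity>n\<in>{n\<in>free_of T. q dvd n}. c n * of_nat n powr (- s))"
    unfolding free_dirichlet_def using infsum_Un_disjoint[OF free_dirichlet_summable[where c = c, OF s c] free_dirichlet_summable[where c = c, OF s c] A(2)]
    unfolding A(1)[symmetric] .
  also have "(\<Sum>\<^sub>\<infinity>n\<in>{n\<in>free_of T. q dvd n}. c n * of_nat n powr (- s))
      = (\<Sum>\<^sub>\<infinity>m\<in>free_of T. c (q * m) * of_nat (q * m) powr (- s))"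
    unfolding mult using q0 by (subst infsum_reindex) (auto simp: inj_on_def comp_def)
  also have "\<dots> = (\<Sum>\<^sub>\<infinity>m\<in>free_of T. of_nat q powr (- s) * (c (q * m) * of_nat m powr (- s)))"
    by (intro infsum_cong) (simp add: powr_times_real mult_ac)
  also have "\<dots> = of_nat q powr (- s) * (\<Sum>\<^sub>\<infinity>m\<in>free_of T. c (q * m) * of_nat m powr (- s))"
    by (rule infsum_cmult_right')
  finally show ?thesis .
qed

lemma free_dirichlet_one_insert:
  assumes s: "Re s > 1" and q: "prime q" "q \<notin> T" and T: "\<And>r. r \<in> T \<Longrightarrow> prime r"
  shows "free_dirichlet (\<lambda>_. 1) (insert q T) s = free_dirichlet (\<lambda>_. 1) T s * (1 - of_nat q powr (- s))"
  using free_dirichlet_insert_aux[OF s, of "\<lambda>_. 1" q T] q T by (simp add: free_dirichlet_def algebra_simps)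

abbreviation moebius_c :: "nat \<Rightarrow> complex" where "moebius_c n \<equiv> of_int (moebius_mu n)"

lemma norm_moebius_c_le: "norm (moebius_c n) \<le> 1"
  using abs_moebius_mu_le[of n] by (simp add: norm_of_int)

lemma free_dirichlet_mu_insert:
  assumes s: "Re s > 1" and q: "prime q" "q \<notin> T" and T: "\<And>r. r \<in> T \<Longrightarrow> prime r"
  shows "free_dirichlet moebius_c T s = free_dirichlet moebius_c (insert q T) s * (1 - of_nat q powr (- s))"
proof -
  have "(\<Sum>\<^sub>\<infinity>m\<in>free_of T. moebius_c (q * m) * of_nat m powr (- s)) = (\<Sum>\<^sub>\<infinity>m\<in>free_of (insert q T). - (moebius_c m * of_nat m powr (- s)))"
    by (rule infsum_cong_neutral) (use q in \<open>auto simp: free_of_def moebius_mu_prime_mult\<close>)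
  also have "\<dots> = - free_dirichlet moebius_c (insert q T) s" by (simp add: free_dirichlet_def infsum_uminus)
  finally show ?thesis using free_dirichlet_insert_aux[OF s norm_moebius_c_le q T] by (simp add: algebra_simps)
qed

text \<open>The same Euler factors enter the two series in opposite directions, so the product of
  both series does not depend on \<open>T\<close>.\<close>

lemma free_dirichlet_prod:
  assumes s: "Re s > 1" and "finite T" and T: "\<And>r. r \<in> T \<Longrightarrow> prime r"
  shows "free_dirichlet (\<lambda>_. 1) T s = free_dirichlet (\<lambda>_. 1) {} s * (\<Prod>q\<in>T. 1 - of_nat q powr (- s))"
        "free_dirichlet moebius_c {} s = free_dirichlet moebius_c T s * (\<Prod>q\<in>T. 1 - of_nat q powr (- s))"
proof -
  have "free_dirichlet (\<lambda>_. 1) T s = free_dirichlet (\<lambda>_. 1) {} s * (\<Prod>q\<in>T. 1 - of_nat q powr (- s)) \<and>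
        free_dirichlet moebius_c {} s = free_dirichlet moebius_c T s * (\<Prod>q\<in>T. 1 - of_nat q powr (- s))"
    using assms(2) T
  proof (induction T rule: finite_induct)
    case (insert q T)
    have q: "prime q" "q \<notin> T" "\<And>r. r \<in> T \<Longrightarrow> prime r" using insert by auto
    show ?case
      using insert free_dirichlet_one_insert[OF s q] free_dirichlet_mu_insert[OF s q] by (auto simp: mult_ac)
  qed auto
  then show "free_dirichlet (\<lambda>_. 1) T s = free_dirichlet (\<lambda>_. 1) {} s * (\<Prod>q\<in>T. 1 - of_nat q powr (- s))"
        "free_dirichlet moebius_c {} s = free_dirichlet moebius_c T s * (\<Prod>q\<in>T. 1 - of_nat q powr (- s))" by auto
qed

lemma nat_powr_tail_tendsto:
  assumes "a > 1"
  shows "(\<lambda>N. \<Sum>\<^sub>\<infinity>n\<in>{N<..}. real n powr (- a)) \<longlonglongrightarrow> 0"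
proof -
  have s: "summable (\<lambda>n. real n powr (- a))" using summable_real_powr_iff[of "- a"] assms by simp
  have so: "(\<lambda>n. real n powr (- a)) summable_on A" for A
    by (rule summable_on_subset_banach[OF norm_summable_imp_summable_on]) (use s in auto)
  have "(\<Sum>\<^sub>\<infinity>n\<in>{N<..}. real n powr (- a)) = (\<Sum>n. real n powr (- a)) - (\<Sum>n\<le>N. real n powr (- a))" for N
  proof -
    have U: "{..N} \<union> {N<..} = UNIV" "{..N} \<inter> {N<..} = {}" by auto
    have "(\<Sum>\<^sub>\<infinity>n. real n powr (- a)) = (\<Sum>\<^sub>\<infinity>n\<in>{..N}. real n powr (- a)) + (\<Sum>\<^sub>\<infinity>n\<in>{N<..}. real n powr (- a))"
      using infsum_Un_disjoint[OF so so U(2)] unfolding U(1) .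
    moreover have "(\<Sum>\<^sub>\<infinity>n. real n powr (- a)) = (\<Sum>n. real n powr (- a))"
    proof -
      have "((\<lambda>n. real n powr (- a)) has_sum (\<Sum>n. real n powr (- a))) UNIV"
        by (rule norm_summable_imp_has_sum) (use s summable_sums[OF s] in auto)
      then show ?thesis by (rule infsumI)
    qed
    ultimately show ?thesis by simp
  qed
  moreover have "(\<lambda>N. (\<Sum>n. real n powr (- a)) - (\<Sum>n\<le>N. real n powr (- a))) \<longlonglongrightarrow> (\<Sum>n. real n powr (- a)) - (\<Sum>n. real n powr (- a))"
    using summable_LIMSEQ'[OF s] by (intro tendsto_diff tendsto_const)
  ultimately show ?thesis by simp
qed

text \<open>Apart from 1, an integer without prime factors up to \<open>N\<close> exceeds
  \<open>N\<close>, so only the tail of an absolutely convergent series remains.\<close>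

lemma free_dirichlet_tendsto:
  fixes c :: "nat \<Rightarrow> complex"
  assumes s: "Re s > 1" and c: "\<And>n. norm (c n) \<le> 1"
  shows "(\<lambda>N. free_dirichlet c {q. prime q \<and> q \<le> N} s) \<longlonglongrightarrow> c 1"
proof -
  let ?T = "\<lambda>N. {q::nat. prime q \<and> q \<le> N}"
  have so: "(\<lambda>n. real n powr (- Re s)) summable_on A" for A
    by (rule summable_on_subset_banach[OF norm_summable_imp_summable_on])
       (use s summable_real_powr_iff[of "- Re s"] in auto)
  have bound: "norm (free_dirichlet c (?T N) s - c 1) \<le> (\<Sum>\<^sub>\<infinity>n\<in>{N<..}. real n powr (- Re s))" for N
  proof -
    define B where "B = free_of (?T N) - {1}"
    have 1: "free_of (?T N) = {1} \<union> B" "{1} \<inter> B = {}"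
      using not_prime_1 by (auto simp: B_def free_of_def)
    have BN: "B \<subseteq> {N<..}"
    proof
      fix n assume n: "n \<in> B"
      then obtain p where p: "prime p" "p dvd n" using prime_factor_nat[of n] by (auto simp: B_def)
      have "n > 0" using n by (auto simp: B_def free_of_def)
      then have "p \<le> n" using p by (auto intro: dvd_imp_le)
      moreover have "\<not> p \<le> N" using n p by (auto simp: B_def free_of_def)
      ultimately show "n \<in> {N<..}" by simp
    qed
    have "free_dirichlet c (?T N) s = (\<Sum>\<^sub>\<infinity>n\<in>{1}. c n * of_nat n powr (- s)) + (\<Sum>\<^sub>\<infinity>n\<in>B. c n * of_nat n powr (- s))"
      unfolding free_dirichlet_def 1(1) by (rule infsum_Un_disjoint[OF free_dirichlet_summable[OF s c] free_dirichlet_summable[OF s c] 1(2)])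
    then have "free_dirichlet c (?T N) s - c 1 = (\<Sum>\<^sub>\<infinity>n\<in>B. c n * of_nat n powr (- s))" by simp
    also have "norm \<dots> \<le> (\<Sum>\<^sub>\<infinity>n\<in>{N<..}. real n powr (- Re s))"
    proof (rule order_trans)
      have sB: "(\<lambda>n. norm (c n * of_nat n powr (- s))) summable_on B"
      proof (rule summable_on_comparison_test[OF so])
        show "norm (c n * of_nat n powr (- s)) \<le> real n powr (- Re s)" for n
          using mult_right_mono[OF c[of n], of "real n powr (- Re s)"] by (simp add: norm_mult norm_nat_powr)
      qed auto
      show "norm (\<Sum>\<^sub>\<infinity>n\<in>B. c n * of_nat n powr (- s)) \<le> (\<Sum>\<^sub>\<infinity>n\<in>B. norm (c n * of_nat n powr (- s)))"
        by (rule norm_infsum_bound[OF sB])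
      have "(\<Sum>\<^sub>\<infinity>n\<in>B. norm (c n * of_nat n powr (- s))) \<le> (\<Sum>\<^sub>\<infinity>n\<in>B. real n powr (- Re s))"
      proof (rule infsum_mono[OF sB so])
        show "norm (c n * of_nat n powr (- s)) \<le> real n powr (- Re s)" for n
          using mult_right_mono[OF c[of n], of "real n powr (- Re s)"] by (simp add: norm_mult norm_nat_powr)
      qed
      also have "\<dots> \<le> (\<Sum>\<^sub>\<infinity>n\<in>{N<..}. real n powr (- Re s))"
        by (rule infsum_mono2[OF so so BN]) simp
      finally show "(\<Sum>\<^sub>\<infinity>n\<in>B. norm (c n * of_nat n powr (- s))) \<le> (\<Sum>\<^sub>\<infinity>n\<in>{N<..}. real n powr (- Re s))" .
    qed
    finally show ?thesis .
  qed
  have "(\<lambda>N. free_dirichlet c (?T N) s - c 1) \<longlonglongrightarrow> 0"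
    by (rule Lim_null_comparison[OF _ nat_powr_tail_tendsto[OF s]]) (use bound in auto)
  then show ?thesis by (simp add: LIM_zero_iff)
qed

lemma free_dirichlet_one_eq_zeta:
  assumes "Re s > 1"
  shows "free_dirichlet (\<lambda>_. 1) {} s = zeta s"
proof -
  have "((\<lambda>n. of_nat n powr (- s)) has_sum (\<Sum>n. of_nat n powr (- s))) (UNIV :: nat set)"
    using summable_norm_nat_powr[OF assms] by (intro norm_summable_imp_has_sum summable_sums) (auto intro: summable_norm_cancel)
  then have "(\<Sum>\<^sub>\<infinity>n::nat. of_nat n powr (- s)) = (\<Sum>n. of_nat n powr (- s))" by (rule infsumI)
  moreover have "(\<Sum>\<^sub>\<infinity>n::nat. of_nat n powr (- s)) = free_dirichlet (\<lambda>_. 1) {} s"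
    unfolding free_dirichlet_def by (rule infsum_cong_neutral) (auto simp: free_of_def)
  moreover have "s \<noteq> 1" using assms by auto
  ultimately show ?thesis using zetaH_eq[OF assms] by (simp add: zeta_def)
qed

text \<open>The product of the two series is unchanged when the primes up to \<open>N\<close> are
  removed from both, and then each of them tends to 1. This replaces the multiplication of Dirichlet
  series.\<close>

lemma zeta_mult_free_dirichlet_mu:
  assumes "Re s > 1"
  shows "free_dirichlet moebius_c {} s * zeta s = 1"
proof -
  let ?T = "\<lambda>N. {q::nat. prime q \<and> q \<le> N}"
  have fin: "finite (?T N)" for N by simp
  have "free_dirichlet moebius_c {} s * zeta s = free_dirichlet moebius_c (?T N) s * free_dirichlet (\<lambda>_. 1) (?T N) s" for N
    using free_dirichlet_prod[OF assms fin[of N]] by (simp add: free_dirichlet_one_eq_zeta[OF assms])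
  moreover have "(\<lambda>N. free_dirichlet moebius_c (?T N) s * free_dirichlet (\<lambda>_. 1) (?T N) s) \<longlonglongrightarrow> moebius_c 1 * 1"
    by (intro tendsto_mult free_dirichlet_tendsto assms norm_moebius_c_le) auto
  ultimately have "(\<lambda>N::nat. free_dirichlet moebius_c {} s * zeta s) \<longlonglongrightarrow> moebius_c 1 * 1" by simp
  then show ?thesis by (simp add: LIMSEQ_const_iff moebius_mu_def)
qed

lemma euler_prod_tendsto:
  assumes "Re s > 1"
  shows "(\<lambda>N. zeta s * (\<Prod>q | prime q \<and> q \<le> N. 1 - of_nat q powr (- s))) \<longlonglongrightarrow> 1"
proof -
  have fin: "finite {q::nat. prime q \<and> q \<le> N}" for N by simp
  show ?thesis
    using free_dirichlet_tendsto[OF assms, of "\<lambda>_. 1"] free_dirichlet_prod(1)[OF assms fin] by (simp add: free_dirichlet_one_eq_zeta[OF assms])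
qed

text \<open>\<open>ln (norm (1 - v))\<close> is minus the sum of \<open>Re (v ^ n) / n\<close>, and
  with \<open>c = Re (w ^ n)\<close> the combination is
  \<open>3 + 4 * c + (2 * c\<^sup>2 - 1) = 2 * (1 + c)\<^sup>2\<close>. Working with a single Euler
  factor avoids a logarithm of zeta.\<close>

lemma three_four_one_factor:
  fixes w :: complex and r :: real
  assumes r: "0 \<le> r" "r < 1" and w: "norm w = 1"
  shows "norm (1 - of_real r :: complex) ^ 3 * norm (1 - of_real r * w) ^ 4 * norm (1 - of_real r * w\<^sup>2) \<le> 1"
proof -
  have ser: "(\<lambda>n. - Re (v ^ n) / real n) sums ln (norm (1 - v))" if v: "norm v < 1" for v :: complex
  proof -
    have "1 - v \<noteq> 0" using v by auto
    moreover have "(\<lambda>n. - ((-(-v))^n) / of_nat n) sums ln (1 + (- v))" by (rule Ln_series') (use v in simp)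
    ultimately show ?thesis using sums_Re by (fastforce simp: Re_divide_of_nat)
  qed
  have n: "norm (of_real r :: complex) < 1" "norm (of_real r * w) < 1" "norm (of_real r * w\<^sup>2) < 1"
    using r w by (auto simp: norm_mult norm_power)
  have S: "(\<lambda>n. 3 * (- Re (of_real r ^ n) / real n) + 4 * (- Re ((of_real r * w) ^ n) / real n) + (- Re ((of_real r * w\<^sup>2) ^ n) / real n))
     sums (3 * ln (norm (1 - of_real r :: complex)) + 4 * ln (norm (1 - of_real r * w)) + ln (norm (1 - of_real r * w\<^sup>2)))"
    by (intro sums_add sums_mult ser n)
  have neg: "3 * (- Re (of_real r ^ n) / real n) + 4 * (- Re ((of_real r * w) ^ n) / real n) + (- Re ((of_real r * w\<^sup>2) ^ n) / real n) \<le> 0" for n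
  proof -
    define c where "c = Re (w ^ n)"
    have e: "(Re (w ^ n))\<^sup>2 + (Im (w ^ n))\<^sup>2 = 1" using w by (simp add: cmod_power2[symmetric] norm_power)
    have "(w\<^sup>2) ^ n = (w ^ n)\<^sup>2" by (simp add: power_mult[symmetric] mult.commute)
    then have "Re ((w\<^sup>2) ^ n) = c\<^sup>2 - (Im (w ^ n))\<^sup>2" by (simp add: power2_eq_square c_def)
    then have w2: "Re ((w\<^sup>2) ^ n) = 2 * c\<^sup>2 - 1" using e unfolding c_def by linarith
    have sc: "Re (of_real r ^ n) = r ^ n" "Re ((of_real r * w) ^ n) = r ^ n * c" "Re ((of_real r * w\<^sup>2) ^ n) = r ^ n * (2 * c\<^sup>2 - 1)"
      unfolding power_mult_distrib of_real_power[symmetric] by (simp_all add: w2 c_def)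
    have "3 * (- Re (of_real r ^ n) / real n) + 4 * (- Re ((of_real r * w) ^ n) / real n) + (- Re ((of_real r * w\<^sup>2) ^ n) / real n)
       = - (r ^ n / real n) * (2 * (1 + c)\<^sup>2)"
      unfolding sc by (simp add: power2_eq_square algebra_simps add_divide_distrib diff_divide_distrib)
    also have "\<dots> \<le> 0" using r by (simp add: mult_nonneg_nonneg)
    finally show ?thesis .
  qed
  have le: "3 * ln (norm (1 - of_real r :: complex)) + 4 * ln (norm (1 - of_real r * w)) + ln (norm (1 - of_real r * w\<^sup>2)) \<le> 0"
    by (rule sums_le[OF neg S sums_zero])
  have pos: "norm (1 - of_real r :: complex) > 0" "norm (1 - of_real r * w) > 0" "norm (1 - of_real r * w\<^sup>2) > 0" using n by auto
  have "ln (norm (1 - of_real r :: complex) ^ 3 * norm (1 - of_real r * w) ^ 4 * norm (1 - of_real r * w\<^sup>2))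
     = 3 * ln (norm (1 - of_real r :: complex)) + 4 * ln (norm (1 - of_real r * w)) + ln (norm (1 - of_real r * w\<^sup>2))"
  proof -
    have "ln (a ^ 3 * b ^ 4 * c) = 3 * ln a + 4 * ln b + ln c" if "a > 0" "b > 0" "c > 0" for a b c :: real
      using that by (simp add: ln_mult ln_realpow)
    from this[OF pos] show ?thesis .
  qed
  then have "ln (norm (1 - of_real r :: complex) ^ 3 * norm (1 - of_real r * w) ^ 4 * norm (1 - of_real r * w\<^sup>2)) \<le> ln 1" using le by simp
  then show ?thesis using pos by (subst (asm) ln_le_cancel_iff) (auto intro!: mult_pos_pos)
qed

text \<open>The finite Euler products \<open>P N\<close> satisfy the opposite inequality factor by
  factor, while \<open>zeta s * P N s\<close> tends to 1 at each of the three points; the 1 on the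
  left is the limit of their combination.\<close>

lemma three_four_one:
  assumes "\<sigma> > 1"
  shows "1 \<le> norm (zeta (of_real \<sigma>)) ^ 3 * norm (zeta (Complex \<sigma> t)) ^ 4 * norm (zeta (Complex \<sigma> (2 * t)))"
proof -
  define P where "P N s = (\<Prod>q | prime q \<and> q \<le> N. 1 - (of_nat q :: complex) powr (- s))" for N :: nat and s
  define Z where "Z = norm (zeta (of_real \<sigma>)) ^ 3 * norm (zeta (Complex \<sigma> t)) ^ 4 * norm (zeta (Complex \<sigma> (2 * t)))"
  have lim: "(\<lambda>N. norm (zeta (of_real \<sigma>) * P N (of_real \<sigma>)) ^ 3 * norm (zeta (Complex \<sigma> t) * P N (Complex \<sigma> t)) ^ 4
      * norm (zeta (Complex \<sigma> (2 * t)) * P N (Complex \<sigma> (2 * t)))) \<longlonglongrightarrow> norm (1::complex) ^ 3 * norm (1::complex) ^ 4 * norm (1::complex)"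
    unfolding P_def by (intro tendsto_intros euler_prod_tendsto) (use assms in auto)
  have le: "norm (P N (of_real \<sigma>)) ^ 3 * norm (P N (Complex \<sigma> t)) ^ 4 * norm (P N (Complex \<sigma> (2 * t))) \<le> 1" for N
  proof -
    have "norm (P N (of_real \<sigma>)) ^ 3 * norm (P N (Complex \<sigma> t)) ^ 4 * norm (P N (Complex \<sigma> (2 * t)))
      = (\<Prod>q | prime q \<and> q \<le> N. norm (1 - (of_nat q :: complex) powr (- of_real \<sigma>)) ^ 3
            * norm (1 - (of_nat q :: complex) powr (- Complex \<sigma> t)) ^ 4 * norm (1 - (of_nat q :: complex) powr (- Complex \<sigma> (2 * t))))"
      by (simp add: P_def prod_norm[symmetric] prod.distrib prod_power_distrib)
    also have "\<dots> \<le> 1"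
    proof (intro prod_le_1 conjI)
      fix q :: nat assume "q \<in> {q. prime q \<and> q \<le> N}"
      then have q: "real q \<ge> 2" using prime_ge_2_nat by force
      define w where "w = exp (\<i> * of_real (- t * ln (real q)))"
      define r where "r = real q powr (- \<sigma>)"
      have w: "norm w = 1" by (simp add: w_def)
      have r: "0 \<le> r" "r < 1" using q assms by (auto simp: r_def intro: powr_less_one)
      have lnq: "Ln (of_nat q) = of_real (ln (real q))" using q Ln_of_real[of "real q"] by simp
      have e: "(of_nat q :: complex) powr (- Complex \<sigma> u) = of_real r * exp (\<i> * of_real (- u * ln (real q)))" for u
      proof -
        have "(of_nat q :: complex) powr (- Complex \<sigma> u) = exp (of_real (- \<sigma> * ln (real q)) + \<i> * of_real (- u * ln (real q)))"
          using q by (simp add: powr_def lnq complex_eq_iff Re_exp Im_exp)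
        also have "\<dots> = of_real (exp (- \<sigma> * ln (real q))) * exp (\<i> * of_real (- u * ln (real q)))"
          by (simp only: exp_add exp_of_real)
        finally show ?thesis using q by (simp add: r_def powr_def)
      qed
      have 1: "(of_nat q :: complex) powr (- of_real \<sigma>) = of_real r" 
        using e[of 0] by (simp add: Complex_eq)
      have 2: "(of_nat q :: complex) powr (- Complex \<sigma> t) = of_real r * w" using e[of t] by (simp add: w_def)
      have 3: "(of_nat q :: complex) powr (- Complex \<sigma> (2 * t)) = of_real r * w\<^sup>2"
        using e[of "2 * t"] by (simp add: w_def exp_double[symmetric] mult_ac)
      show "norm (1 - (of_nat q :: complex) powr (- of_real \<sigma>)) ^ 3
            * norm (1 - (of_nat q :: complex) powr (- Complex \<sigma> t)) ^ 4 * norm (1 - (of_nat q :: complex) powr (- Complex \<sigma> (2 * t))) \<le> 1"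
        unfolding 1 2 3 by (rule three_four_one_factor[OF r w])
    qed auto
    finally show ?thesis .
  qed
  have "norm (zeta (of_real \<sigma>) * P N (of_real \<sigma>)) ^ 3 * norm (zeta (Complex \<sigma> t) * P N (Complex \<sigma> t)) ^ 4
      * norm (zeta (Complex \<sigma> (2 * t)) * P N (Complex \<sigma> (2 * t))) \<le> Z" for N
  proof -
    have "norm (zeta (of_real \<sigma>) * P N (of_real \<sigma>)) ^ 3 * norm (zeta (Complex \<sigma> t) * P N (Complex \<sigma> t)) ^ 4
      * norm (zeta (Complex \<sigma> (2 * t)) * P N (Complex \<sigma> (2 * t)))
      = Z * (norm (P N (of_real \<sigma>)) ^ 3 * norm (P N (Complex \<sigma> t)) ^ 4 * norm (P N (Complex \<sigma> (2 * t))))"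
      unfolding Z_def norm_mult power_mult_distrib by (simp only: mult_ac)
    also have "\<dots> \<le> Z * 1" using le[of N] by (intro mult_left_mono) (auto simp: Z_def)
    finally show ?thesis by simp
  qed
  then have "norm (1::complex) ^ 3 * norm (1::complex) ^ 4 * norm (1::complex) \<le> Z"
    by (intro LIMSEQ_le_const2[OF lim]) auto
  then show ?thesis by (simp add: Z_def)
qed

section \<open>Lower bound for zeta near the line\<close>

definition logt :: "complex \<Rightarrow> real" where
  "logt s = ln (\<bar>Im s\<bar> + 3)"

lemma logt_ge_1: "logt s \<ge> 1"
proof -
  have "exp 1 \<le> (3::real)" using e_less_272 by simp
  then have "exp 1 \<le> \<bar>Im s\<bar> + 3" by simp
  then have "ln (exp 1) \<le> ln (\<bar>Im s\<bar> + 3)" by (intro ln_mono) auto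
  then show ?thesis by (simp add: logt_def)
qed

lemma logt_le_double:
  assumes "\<bar>Im w\<bar> \<le> 2 * \<bar>Im s\<bar> + 1"
  shows "logt w \<le> 2 * logt s"
proof -
  have "(\<bar>Im s\<bar> + 3)\<^sup>2 = Im s * Im s + 6 * \<bar>Im s\<bar> + 9" by (simp add: power2_eq_square algebra_simps)
  then have "\<bar>Im w\<bar> + 3 \<le> (\<bar>Im s\<bar> + 3)\<^sup>2" using assms zero_le_square[of "Im s"] by linarith
  then have "ln (\<bar>Im w\<bar> + 3) \<le> ln ((\<bar>Im s\<bar> + 3)\<^sup>2)" by (intro ln_mono) auto
  then show ?thesis unfolding logt_def by (simp add: ln_realpow)
qed

lemma holomorphic_zeta: "zeta holomorphic_on {s. Re s > 0} - {1}"
  unfolding zeta_def[abs_def]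
  by (intro holomorphic_intros holomorphic_on_subset[OF holomorphic_zetaH]) auto

text \<open>Cauchy's estimate on a disc of radius \<open>1 / (8 * logt s)\<close>, which stays in
  the region of \<open>norm_zeta_le\<close> because \<open>logt\<close> at most doubles on it; hence
  \<open>464 = 8 * 58\<close>.\<close>

lemma norm_deriv_zeta_le:
  assumes t: "\<bar>Im s\<bar> \<ge> 2" and \<sigma>: "Re s \<le> 2" "Re s \<ge> 1 - 1 / (8 * logt s)"
  shows "norm (deriv zeta s) \<le> 464 * (logt s)\<^sup>2"
proof -
  define L where "L = logt s"
  define r where "r = 1 / (8 * L)"
  have L: "L \<ge> 1" using logt_ge_1 by (simp add: L_def)
  have r: "r > 0" "r \<le> 1/8" using L by (auto simp: r_def field_simps)
  have W: "Re w \<le> 3 \<and> Re w \<ge> 1 - 1 / (2 * logt w) \<and> \<bar>Im w\<bar> \<ge> 1 \<and> logt w \<le> 2 * L" if w: "dist s w \<le> r" for w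
  proof -
    have d: "\<bar>Re s - Re w\<bar> \<le> r" "\<bar>Im s - Im w\<bar> \<le> r"
      using w abs_Re_le_cmod[of "s - w"] abs_Im_le_cmod[of "s - w"] by (auto simp: dist_norm)
    have lw: "logt w \<le> 2 * L" unfolding L_def using d r by (intro logt_le_double) linarith
    have "1 / (4 * L) \<le> 1 / (2 * logt w)" using lw logt_ge_1[of w] L by (intro divide_left_mono mult_pos_pos) auto
    moreover have "1 / (8 * L) + r = 1 / (4 * L)" by (simp add: r_def)
    moreover have "Re s \<ge> 1 - 1 / (8 * L)" using \<sigma> by (simp add: L_def)
    ultimately have "Re w \<ge> 1 - 1 / (2 * logt w)" using d by linarith
    moreover have "Re w \<le> 3" "\<bar>Im w\<bar> \<ge> 1" using d r t \<sigma> by linarith+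
    ultimately show ?thesis using lw by simp
  qed
  have sub: "cball s r \<subseteq> {s. Re s > 0} - {1}"
  proof
    fix w assume "w \<in> cball s r"
    then have w: "Re w \<ge> 1 - 1 / (2 * logt w)" "\<bar>Im w\<bar> \<ge> 1" using W by auto
    have "1 / (2 * logt w) \<le> 1 / 2" using logt_ge_1[of w] by (intro divide_left_mono) auto
    then show "w \<in> {s. Re s > 0} - {1}" using w by auto
  qed
  have "norm ((deriv ^^ 1) zeta s) \<le> fact 1 * (58 * L) / r ^ 1"
  proof (rule Cauchy_inequality)
    show "zeta holomorphic_on ball s r"
      by (rule holomorphic_on_subset[OF holomorphic_zeta]) (use sub ball_subset_cball in blast)
    show "continuous_on (cball s r) zeta"
      by (rule holomorphic_on_imp_continuous_on, rule holomorphic_on_subset[OF holomorphic_zeta sub])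
    show "0 < r" by fact
    fix w assume "norm (s - w) = r"
    then have w: "Re w \<le> 3 \<and> Re w \<ge> 1 - 1 / (2 * logt w) \<and> \<bar>Im w\<bar> \<ge> 1 \<and> logt w \<le> 2 * L"
      by (intro W) (simp add: dist_norm)
    then have "norm (zeta w) \<le> 29 * logt w" unfolding logt_def by (intro norm_zeta_le) auto
    then show "norm (zeta w) \<le> 58 * L" using w by linarith
  qed
  also have "fact 1 * (58 * L) / r ^ 1 = 464 * L\<^sup>2" using L by (simp add: r_def power2_eq_square)
  finally show ?thesis by (simp add: L_def)
qed

text \<open>The pole at 1 is simple, since \<open>zetaH\<close> is bounded on the compact segment
  from 1 to 2.\<close>

lemma zeta_real_bound:
  obtains B where "B \<ge> 1" "\<And>\<sigma>. 1 < \<sigma> \<Longrightarrow> \<sigma> \<le> 2 \<Longrightarrow> norm (zeta (of_real \<sigma>)) \<le> B / (\<sigma> - 1)"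
proof -
  have c1: "compact (of_real ` {1..2::real} :: complex set)"
    by (rule compact_continuous_image[OF continuous_on_of_real[OF continuous_on_id] compact_Icc])
  have c2: "continuous_on (of_real ` {1..2::real} :: complex set) zetaH"
    by (rule continuous_on_subset[OF holomorphic_on_imp_continuous_on[OF holomorphic_zetaH]]) auto
  have "bounded (zetaH ` of_real ` {1..2::real})"
    by (rule compact_imp_bounded[OF compact_continuous_image[OF c2 c1]])
  then obtain B0 where B0: "\<And>z. z \<in> zetaH ` of_real ` {1..2::real} \<Longrightarrow> norm z \<le> B0" unfolding bounded_iff by blast
  show ?thesis
  proof (rule that)
    show "max B0 1 \<ge> 1" by simp
    fix \<sigma> :: real assume \<sigma>: "1 < \<sigma>" "\<sigma> \<le> 2"
    have "norm (zetaH (of_real \<sigma>)) \<le> max B0 1" using B0[of "zetaH (of_real \<sigma>)"] \<sigma> by auto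
    moreover have "norm (of_real \<sigma> - 1 :: complex) = \<sigma> - 1"
      using \<sigma> by (metis abs_of_pos diff_gt_0_iff_gt norm_of_real of_real_1 of_real_diff)
    ultimately show "norm (zeta (of_real \<sigma>)) \<le> max B0 1 / (\<sigma> - 1)"
      using \<sigma> by (simp add: zeta_def norm_divide divide_right_mono)
  qed
qed

text \<open>The lower bound is first obtained at distance of order \<open>1 / (logt s) ^ 9\<close> to the right of the
  line and then transported by the bound for the derivative.\<close>

lemma norm_zeta_ge:
  obtains a where "0 < a" "a \<le> 1/8"
    "\<And>s. \<bar>Im s\<bar> \<ge> 2 \<Longrightarrow> Re s \<le> 2 \<Longrightarrow> Re s \<ge> 1 - a / (logt s) ^ 9 \<Longrightarrow> norm (zeta s) \<ge> 928 * a / (logt s) ^ 7"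
proof -
  obtain B where B: "B \<ge> 1" "\<And>\<sigma>. 1 < \<sigma> \<Longrightarrow> \<sigma> \<le> 2 \<Longrightarrow> norm (zeta (of_real \<sigma>)) \<le> B / (\<sigma> - 1)"
    using zeta_real_bound by blast
  define D where "D = B ^ 3 * 58"
  \<comment> \<open>This solves \<open>a ^ 3 / D = (1856 * a) ^ 4\<close>. The lower bound
    \<open>1856 * a / L ^ 7\<close> found to the right of the line is then twice the possible change
    \<open>464 * L\<^sup>2 * (2 * \<eta>)\<close> on the way to \<open>s\<close>. The exponent 9 of
    \<eta> balances the fourth root of \<open>\<eta> ^ 3 / L\<close> against
    \<open>\<eta> * L\<^sup>2\<close>.\<close>
  define a where "a = 1 / (D * 1856 ^ 4)"
  have "B ^ 3 \<ge> 1" using B by simp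
  then have D1: "D \<ge> 1" unfolding D_def by simp
  have a0: "a > 0" unfolding a_def using D1 by simp
  have a18: "a \<le> 1/8"
  proof -
    have "8 \<le> D * 1856 ^ 4" using D1 by simp
    then show ?thesis unfolding a_def by (intro divide_left_mono) auto
  qed
  have right: "norm (zeta s) \<ge> 1856 * a / L ^ 7"
    if t: "\<bar>Im s\<bar> \<ge> 2" and \<sigma>: "Re s \<le> 2" "Re s \<ge> 1 + a / L ^ 9" and L: "L = logt s" for s L
  proof -
    have L1: "L \<ge> 1" using L logt_ge_1 by simp
    define \<eta> where "\<eta> = a / L ^ 9"
    have \<eta>: "\<eta> > 0" unfolding \<eta>_def using a0 L1 by simp
    have s1: "Re s > 1" using \<sigma> \<eta> unfolding \<eta>_def by linarith
    have z1: "norm (zeta (of_real (Re s))) \<le> B / \<eta>"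
    proof -
      have "norm (zeta (of_real (Re s))) \<le> B / (Re s - 1)" using s1 \<sigma> by (intro B) auto
      also have "\<dots> \<le> B / \<eta>" using \<sigma> \<eta> B s1 unfolding \<eta>_def[symmetric] by (intro divide_left_mono mult_pos_pos) auto
      finally show ?thesis .
    qed
    have z2: "norm (zeta (Complex (Re s) (2 * Im s))) \<le> 58 * L"
    proof -
      have "norm (zeta (Complex (Re s) (2 * Im s))) \<le> 29 * logt (Complex (Re s) (2 * Im s))"
      proof -
        define z where "z = Complex (Re s) (2 * Im s)"
        have "Re z = Re s" "Im z = 2 * Im s" "0 \<le> 1 / (2 * ln (\<bar>Im z\<bar> + 3))" by (simp_all add: z_def)
        then show ?thesis unfolding logt_def z_def[symmetric]
          by (intro norm_zeta_le) (use t \<sigma> s1 in linarith)+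
      qed
      also have "\<dots> \<le> 29 * (2 * L)" unfolding L by (intro mult_left_mono logt_le_double) auto
      finally show ?thesis by simp
    qed
    have "1 \<le> norm (zeta (of_real (Re s))) ^ 3 * norm (zeta (Complex (Re s) (Im s))) ^ 4 * norm (zeta (Complex (Re s) (2 * Im s)))"
      by (rule three_four_one[OF s1])
    also have "\<dots> \<le> (B / \<eta>) ^ 3 * norm (zeta s) ^ 4 * (58 * L)"
      using z1 z2 B \<eta> by (intro mult_mono power_mono) auto
    also have "\<dots> = D * L / \<eta> ^ 3 * norm (zeta s) ^ 4" by (simp add: D_def power_divide)
    finally have "\<eta> ^ 3 \<le> D * L * norm (zeta s) ^ 4" using \<eta> by (simp add: field_simps)
    then have "a ^ 3 / L ^ 27 \<le> D * L * norm (zeta s) ^ 4" by (simp add: \<eta>_def power_divide power_mult[symmetric])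
    then have "a ^ 3 / L ^ 27 / (D * L) \<le> norm (zeta s) ^ 4" using D1 L1 by (simp add: field_simps)
    moreover have "a ^ 3 / L ^ 27 / (D * L) = (1856 * a / L ^ 7) ^ 4"
    proof -
      have "L ^ 28 = L ^ 27 * L" by (simp add: power_Suc[symmetric] mult.commute del: power_Suc)
      moreover have "a ^ 3 / D = (1856 * a) ^ 4"
        using D1 by (simp add: a_def power_divide power_mult_distrib power3_eq_cube power4_eq_xxxx)
      ultimately show ?thesis using D1 L1 by (simp add: power_divide power_mult[symmetric] field_simps)
    qed
    ultimately have le: "(1856 * a / L ^ 7) ^ 4 \<le> norm (zeta s) ^ 4" by (simp only:)
    have pre: "0 \<le> 1856 * a / L ^ 7" using a0 L1 by simp
    show ?thesis using le unfolding power_mono_iff[OF pre norm_ge_zero zero_less_numeral] .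
  qed
  show ?thesis
  proof (rule that[OF a0 a18])
    fix s assume t: "\<bar>Im s\<bar> \<ge> 2" and \<sigma>: "Re s \<le> 2" "Re s \<ge> 1 - a / (logt s) ^ 9"
    define L where "L = logt s"
    have L1: "L \<ge> 1" using logt_ge_1 by (simp add: L_def)
    define \<eta> where "\<eta> = a / L ^ 9"
    have \<eta>: "\<eta> > 0" unfolding \<eta>_def using a0 L1 by simp
    have \<eta>L: "\<eta> \<le> 1 / (8 * L)"
    proof -
      have "L \<le> L ^ 9" using L1 by (intro self_le_power) auto
      then have "8 * a * L \<le> 1 * L ^ 9" using a18 a0 L1 by (intro mult_mono) auto
      then show ?thesis unfolding \<eta>_def using L1 by (simp add: field_simps)
    qed
    show "norm (zeta s) \<ge> 928 * a / (logt s) ^ 7"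
    proof (cases "Re s \<ge> 1 + \<eta>")
      case True
      then have "norm (zeta s) \<ge> 1856 * a / L ^ 7" using t \<sigma> L_def unfolding \<eta>_def by (intro right) auto
      moreover have "a / L ^ 7 \<ge> 0" using a0 L1 by simp
      ultimately show ?thesis unfolding L_def[symmetric] by simp
    next
      case False
      \<comment> \<open>The point of the same height at which the first bound already holds; it is
        within \<open>2 * \<eta>\<close> of \<open>s\<close>.\<close>
      define s' where "s' = Complex (1 + \<eta>) (Im s)"
      have Ls': "logt s' = L" by (simp add: logt_def s'_def L_def)
      have e1: "1 / (8 * L) \<le> 1 / 8" using L1 by (intro divide_left_mono) auto
      have z': "norm (zeta s') \<ge> 1856 * a / L ^ 7"
        using t \<eta>L e1 Ls' by (intro right) (auto simp: s'_def \<eta>_def)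
      have "norm (zeta s' - zeta s) \<le> 464 * L\<^sup>2 * norm (s' - s)"
      proof (rule field_differentiable_bound)
        show "convex (closed_segment s s')" by (rule convex_closed_segment)
        fix w assume w: "w \<in> closed_segment s s'"
        have Imw: "Im w = Im s"
        proof -
          obtain u where u: "w = (1 - u) *\<^sub>R s + u *\<^sub>R s'" using w by (auto simp: closed_segment_def)
          have "Im w = (1 - u) * Im s + u * Im s'" by (simp add: u)
          then show ?thesis by (simp add: s'_def algebra_simps)
        qed
        have Rew: "Re s \<le> Re w" "Re w \<le> 1 + \<eta>"
        proof -
          obtain u where u: "0 \<le> u" "u \<le> 1" "w = (1 - u) *\<^sub>R s + u *\<^sub>R s'" using w by (auto simp: closed_segment_def)
          have Rw: "Re w = Re s + u * (1 + \<eta> - Re s)" by (simp add: u s'_def algebra_simps)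
          define v where "v = u * (1 + \<eta> - Re s)"
          have "v \<le> 1 * (1 + \<eta> - Re s)" unfolding v_def using u False by (intro mult_right_mono) auto
          then have v: "v \<le> 1 + \<eta> - Re s" by simp
          have "v \<ge> 0" unfolding v_def using u False by simp
          then show "Re s \<le> Re w" "Re w \<le> 1 + \<eta>" using Rw v unfolding v_def[symmetric] by linarith+
        qed
        have Lw: "logt w = L" by (simp add: logt_def Imw L_def)
        have "w \<in> {s. Re s > 0} - {1}" using Rew \<sigma> \<eta>L e1 t Imw by (auto simp: \<eta>_def L_def)
        moreover have "open ({s::complex. Re s > 0} - {1})" by (intro open_Diff open_halfspace_Re_gt) auto
        ultimately have "(zeta has_field_derivative deriv zeta w) (at w)"
          by (intro holomorphic_derivI[OF holomorphic_zeta])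
        then show "(zeta has_field_derivative deriv zeta w) (at w within closed_segment s s')"
          by (rule has_field_derivative_at_within)
        show "norm (deriv zeta w) \<le> 464 * L\<^sup>2"
          unfolding Lw[symmetric] using Rew \<sigma> \<eta>L e1 t Imw Lw
          by (intro norm_deriv_zeta_le) (auto simp: \<eta>_def L_def)
      qed auto
      also have "\<dots> \<le> 464 * L\<^sup>2 * (2 * \<eta>)"
      proof (rule mult_left_mono)
        have "s' - s = of_real (1 + \<eta> - Re s)" by (simp add: s'_def complex_eq_iff)
        then have "norm (s' - s) = \<bar>1 + \<eta> - Re s\<bar>" by (metis norm_of_real)
        also have "\<dots> \<le> 2 * \<eta>" using False \<sigma> by (simp add: \<eta>_def L_def)
        finally show "norm (s' - s) \<le> 2 * \<eta>" .
      qed simp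
      also have "\<dots> = 928 * a / L ^ 7"
      proof -
        have "L ^ 9 = L ^ 7 * L\<^sup>2" by (simp add: power_add[symmetric])
        moreover have "464 * y * (2 * (a / (z * y))) = 928 * a / z" if "y \<noteq> 0" for y z :: real
          using that by simp
        moreover have "L\<^sup>2 \<noteq> 0" using L1 by simp
        ultimately show ?thesis unfolding \<eta>_def by (simp only:)
      qed
      finally have "norm (zeta s' - zeta s) \<le> 928 * a / L ^ 7" .
      moreover have "norm (zeta s') \<le> norm (zeta s) + norm (zeta s' - zeta s)" by (rule norm_triangle_sub)
      ultimately show ?thesis using z' unfolding L_def[symmetric] by simp
    qed
  qed
qed

section \<open>The reciprocal of the zeta function\<close>

lemma zetaH_1: "zetaH 1 = 1"
  by (simp add: zetaH_def zeta_term_def del: of_nat_Suc)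

lemma zeta_nonzero_right: "Re s > 1 \<Longrightarrow> zeta s \<noteq> 0"
  using zeta_mult_free_dirichlet_mu[of s] by auto

text \<open>A zero at \<open>s\<close> would make zeta of order \<open>e\<close> at
  \<open>s + e\<close>. Its fourth power beats the third power of the simple pole, so the right-hand
  side of the 3-4-1 inequality would tend to 0 with \<open>e\<close>.\<close>

lemma zeta_nonzero_line:
  assumes "Re s = 1" "s \<noteq> 1"
  shows "zeta s \<noteq> 0"
proof
  assume z0: "zeta s = 0"
  define t where "t = Im s"
  have t: "t \<noteq> 0" using assms by (auto simp: t_def complex_eq_iff)
  obtain B where B: "B \<ge> 1" "\<And>\<sigma>. 1 < \<sigma> \<Longrightarrow> \<sigma> \<le> 2 \<Longrightarrow> norm (zeta (of_real \<sigma>)) \<le> B / (\<sigma> - 1)"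
    using zeta_real_bound by blast
  have op: "open ({s::complex. Re s > 0} - {1})" by (intro open_Diff open_halfspace_Re_gt) auto
  define e where "e n = 1 / real (Suc n)" for n
  have e0: "e n > 0" "e n \<le> 1" for n by (auto simp: e_def)
  have elim: "e \<longlonglongrightarrow> 0" unfolding e_def by real_asymp
  have celim: "(\<lambda>n. complex_of_real (e n)) \<longlonglongrightarrow> 0" using tendsto_of_real[OF elim] by simp
  have "(zeta has_field_derivative deriv zeta s) (at s)"
    by (rule holomorphic_derivI[OF holomorphic_zeta op]) (use assms in auto)
  then have "((\<lambda>h. (zeta (s + h) - zeta s) / h) \<longlongrightarrow> deriv zeta s) (at 0)" by (rule DERIV_D)
  moreover have "filterlim (\<lambda>n. complex_of_real (e n)) (at 0) sequentially"
    using celim e0 by (auto simp: filterlim_at less_imp_neq[THEN not_sym] intro!: always_eventually)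
  ultimately have g: "(\<lambda>n. (zeta (s + of_real (e n)) - zeta s) / of_real (e n)) \<longlonglongrightarrow> deriv zeta s"
    by (rule filterlim_compose)
  have s2: "Complex 1 (2 * t) \<in> {s::complex. Re s > 0} - {1}" using t by (auto simp: complex_eq_iff)
  have "isCont zeta (Complex 1 (2 * t))"
    using holomorphic_on_imp_continuous_on[OF holomorphic_zeta] op s2 by (simp add: continuous_on_eq_continuous_at)
  then have h: "(\<lambda>n. zeta (Complex 1 (2 * t) + of_real (e n))) \<longlonglongrightarrow> zeta (Complex 1 (2 * t))"
    by (rule isCont_tendsto_compose) (use tendsto_add[OF tendsto_const celim, of "Complex 1 (2 * t)"] in simp)
  have "(\<lambda>n. B ^ 3 * norm ((zeta (s + of_real (e n)) - zeta s) / of_real (e n)) ^ 4 * norm (zeta (Complex 1 (2 * t) + of_real (e n))) * e n)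
     \<longlonglongrightarrow> B ^ 3 * norm (deriv zeta s) ^ 4 * norm (zeta (Complex 1 (2 * t))) * 0"
    by (intro tendsto_intros g h elim)
  moreover have "1 \<le> B ^ 3 * norm ((zeta (s + of_real (e n)) - zeta s) / of_real (e n)) ^ 4 * norm (zeta (Complex 1 (2 * t) + of_real (e n))) * e n" for n
  proof -
    have c: "Complex (1 + e n) t = s + of_real (e n)" "Complex (1 + e n) (2 * t) = Complex 1 (2 * t) + of_real (e n)"
      using assms by (auto simp: complex_eq_iff t_def)
    have "1 \<le> norm (zeta (of_real (1 + e n))) ^ 3 * norm (zeta (Complex (1 + e n) t)) ^ 4 * norm (zeta (Complex (1 + e n) (2 * t)))"
      using e0 by (intro three_four_one) simp
    also have "\<dots> \<le> (B / e n) ^ 3 * norm (zeta (Complex (1 + e n) t)) ^ 4 * norm (zeta (Complex (1 + e n) (2 * t)))"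
      using B(2)[of "1 + e n"] e0[of n] by (intro mult_right_mono power_mono) auto
    also have "\<dots> = B ^ 3 * (norm (zeta (s + of_real (e n))) / e n) ^ 4 * norm (zeta (Complex 1 (2 * t) + of_real (e n))) * e n"
      using e0[of n] unfolding c by (simp add: power_divide power3_eq_cube power4_eq_xxxx field_simps)
    finally show ?thesis using e0[of n] by (simp add: z0 norm_divide)
  qed
  ultimately have "1 \<le> B ^ 3 * norm (deriv zeta s) ^ 4 * norm (zeta (Complex 1 (2 * t))) * 0"
    by (intro LIMSEQ_le_const) auto
  then show False by simp
qed

lemma zetaH_nonzero:
  assumes "Re s \<ge> 1"
  shows "zetaH s \<noteq> 0"
proof (cases "s = 1")
  case False
  then have "zeta s \<noteq> 0" using assms zeta_nonzero_right zeta_nonzero_line by (cases "Re s = 1") auto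
  then show ?thesis by (auto simp: zeta_def)
qed (simp add: zetaH_1)

text \<open>Written through \<open>zetaH\<close> so that the reciprocal is holomorphic at 1, where
  zeta has its pole.\<close>

definition inv_zeta :: "complex \<Rightarrow> complex" where
  "inv_zeta s = (s - 1) / zetaH s"

text \<open>An open set around the closed half-plane \<open>Re s \<ge> 1\<close>, so that higher
  derivatives can be taken on the line itself.\<close>

definition inv_zeta_dom :: "complex set" where
  "inv_zeta_dom = {s. Re s > 0} \<inter> zetaH -` (- {0})"

lemma open_inv_zeta_dom: "open inv_zeta_dom"
  unfolding inv_zeta_dom_def
  by (intro continuous_open_preimage holomorphic_on_imp_continuous_on holomorphic_zetaH open_halfspace_Re_gt) auto

lemma holomorphic_inv_zeta: "inv_zeta holomorphic_on inv_zeta_dom"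
  unfolding inv_zeta_def[abs_def]
  by (intro holomorphic_intros holomorphic_on_subset[OF holomorphic_zetaH]) (auto simp: inv_zeta_dom_def)

lemma inv_zeta_eq: "s \<noteq> 1 \<Longrightarrow> inv_zeta s = 1 / zeta s"
  by (simp add: inv_zeta_def zeta_def)

lemma inv_zeta_eq_free_dirichlet:
  assumes "Re s > 1"
  shows "inv_zeta s = free_dirichlet moebius_c {} s"
proof -
  have "s \<noteq> 1" using assms by auto
  then show ?thesis using zeta_mult_free_dirichlet_mu[OF assms] zeta_nonzero_right[OF assms]
    by (simp add: inv_zeta_eq field_simps)
qed

text \<open>Cauchy's estimate on a disc of radius \<open>a / (512 * L ^ 9)\<close>: each derivative
  costs nine powers of \<open>L\<close>, the lower bound for zeta seven. The factors
  \<open>512 = 2 ^ 9\<close> and \<open>128 = 2 ^ 7\<close> allow for the doubling of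
  \<open>logt\<close> on the disc.\<close>

lemma higher_deriv_inv_zeta_large:
  obtains C where "C \<ge> 0"
    "\<And>s. \<bar>Im s\<bar> \<ge> 3 \<Longrightarrow> 1 \<le> Re s \<Longrightarrow> Re s \<le> 3/2 \<Longrightarrow> norm ((deriv ^^ k) inv_zeta s) \<le> C * (logt s) ^ (7 + 9 * k)"
proof -
  obtain a where a: "0 < a" "a \<le> 1/8"
    "\<And>s. \<bar>Im s\<bar> \<ge> 2 \<Longrightarrow> Re s \<le> 2 \<Longrightarrow> Re s \<ge> 1 - a / (logt s) ^ 9 \<Longrightarrow> norm (zeta s) \<ge> 928 * a / (logt s) ^ 7"
    using norm_zeta_ge by blast
  define C where "C = fact k * (128 / (928 * a)) * (512 / a) ^ k"
  show ?thesis
  proof (rule that[of C])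
    show "C \<ge> 0" unfolding C_def using a by simp
    fix s assume s: "\<bar>Im s\<bar> \<ge> 3" "1 \<le> Re s" "Re s \<le> 3/2"
    define L where "L = logt s"
    have L1: "L \<ge> 1" using logt_ge_1 by (simp add: L_def)
    define r where "r = a / (512 * L ^ 9)"
    have r0: "r > 0" unfolding r_def using a L1 by simp
    have r1: "r \<le> 1/8"
    proof -
      have "1 \<le> 512 * L ^ 9" using one_le_power[OF L1, of 9] by linarith
      then have "r \<le> a / 1" unfolding r_def using a L1 by (intro divide_left_mono) auto
      then show ?thesis using a by simp
    qed
    have W: "norm (zeta w) \<ge> 928 * a / (128 * L ^ 7) \<and> Re w > 0 \<and> w \<noteq> 1" if w: "dist s w \<le> r" for w
    proof -
      have d: "\<bar>Re s - Re w\<bar> \<le> r" "\<bar>Im s - Im w\<bar> \<le> r"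
        using w abs_Re_le_cmod[of "s - w"] abs_Im_le_cmod[of "s - w"] by (auto simp: dist_norm)
      have lw: "logt w \<le> 2 * L" unfolding L_def using d r1 by (intro logt_le_double) linarith
      have l1: "logt w \<ge> 1" by (rule logt_ge_1)
      have "(logt w) ^ 9 \<le> (2 * L) ^ 9" using lw l1 by (intro power_mono) auto
      then have "a / (2 * L) ^ 9 \<le> a / (logt w) ^ 9" using a l1 L1 by (intro divide_left_mono mult_pos_pos) auto
      moreover have "a / (2 * L) ^ 9 = r" by (simp add: r_def power_mult_distrib)
      ultimately have "Re w \<ge> 1 - a / (logt w) ^ 9" using d s by linarith
      then have "norm (zeta w) \<ge> 928 * a / (logt w) ^ 7" using d s r1 by (intro a(3)) linarith+
      moreover have "928 * a / (128 * L ^ 7) \<le> 928 * a / (logt w) ^ 7"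
      proof (rule divide_left_mono)
        have "(logt w) ^ 7 \<le> (2 * L) ^ 7" using lw l1 by (intro power_mono) auto
        then show "(logt w) ^ 7 \<le> 128 * L ^ 7" by (simp add: power_mult_distrib)
      qed (use a l1 L1 in auto)
      moreover have "Re w > 0" using d s r1 by linarith
      moreover have "w \<noteq> 1" using d s r1 by auto
      ultimately show ?thesis by simp
    qed
    have sub: "cball s r \<subseteq> inv_zeta_dom"
    proof
      fix w assume "w \<in> cball s r"
      then have w: "norm (zeta w) \<ge> 928 * a / (128 * L ^ 7)" "Re w > 0" "w \<noteq> 1" using W by auto
      have "928 * a / (128 * L ^ 7) > 0" using a L1 by simp
      then have "zeta w \<noteq> 0" using w by auto
      then show "w \<in> inv_zeta_dom" using w by (auto simp: inv_zeta_dom_def zeta_def)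
    qed
    have "norm ((deriv ^^ k) inv_zeta s) \<le> fact k * (128 * L ^ 7 / (928 * a)) / r ^ k"
    proof (rule Cauchy_inequality)
      show "inv_zeta holomorphic_on ball s r"
        by (rule holomorphic_on_subset[OF holomorphic_inv_zeta]) (use sub ball_subset_cball in blast)
      show "continuous_on (cball s r) inv_zeta"
        by (rule holomorphic_on_imp_continuous_on, rule holomorphic_on_subset[OF holomorphic_inv_zeta sub])
      show "0 < r" by fact
      fix w assume "norm (s - w) = r"
      then have w: "norm (zeta w) \<ge> 928 * a / (128 * L ^ 7)" "w \<noteq> 1" using W[of w] by (auto simp: dist_norm)
      have p: "928 * a / (128 * L ^ 7) > 0" using a L1 by simp
      have "norm (inv_zeta w) = 1 / norm (zeta w)" using w by (simp add: inv_zeta_eq norm_divide)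
      also have "\<dots> \<le> 1 / (928 * a / (128 * L ^ 7))" using w p by (intro divide_left_mono mult_pos_pos) auto
      finally show "norm (inv_zeta w) \<le> 128 * L ^ 7 / (928 * a)" by simp
    qed
    also have "\<dots> = C * L ^ (7 + 9 * k)"
      by (simp add: C_def r_def power_divide power_mult_distrib power_add power_mult)
    finally show "norm ((deriv ^^ k) inv_zeta s) \<le> C * (logt s) ^ (7 + 9 * k)" by (simp add: L_def)
  qed
qed

lemma higher_deriv_inv_zeta_bound:
  obtains C where "C \<ge> 0"
    "\<And>s. 1 \<le> Re s \<Longrightarrow> Re s \<le> 3/2 \<Longrightarrow> norm ((deriv ^^ k) inv_zeta s) \<le> C * (logt s) ^ (7 + 9 * k)"
proof -
  obtain C1 where C1: "C1 \<ge> 0" "\<And>s. \<bar>Im s\<bar> \<ge> 3 \<Longrightarrow> 1 \<le> Re s \<Longrightarrow> Re s \<le> 3/2 \<Longrightarrow> norm ((deriv ^^ k) inv_zeta s) \<le> C1 * (logt s) ^ (7 + 9 * k)"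
    using higher_deriv_inv_zeta_large by blast
  let ?K = "cbox (Complex 1 (-3)) (Complex (3/2) 3)"
  have "?K \<subseteq> inv_zeta_dom"
    using zetaH_nonzero by (auto simp: inv_zeta_dom_def in_cbox_complex_iff)
  moreover have "(deriv ^^ k) inv_zeta holomorphic_on inv_zeta_dom"
    by (rule holomorphic_higher_deriv[OF holomorphic_inv_zeta open_inv_zeta_dom])
  ultimately have "continuous_on ?K ((deriv ^^ k) inv_zeta)"
    using continuous_on_subset holomorphic_on_imp_continuous_on by blast
  then have "bounded ((deriv ^^ k) inv_zeta ` ?K)"
    by (intro compact_imp_bounded compact_continuous_image compact_cbox)
  then obtain C2 where C2: "\<And>z. z \<in> (deriv ^^ k) inv_zeta ` ?K \<Longrightarrow> norm z \<le> C2" unfolding bounded_iff by blast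
  define C where "C = max C1 C2"
  show ?thesis
  proof (rule that[of C])
    show "C \<ge> 0" using C1 by (simp add: C_def)
    fix s assume s: "1 \<le> Re s" "Re s \<le> 3/2"
    have l: "(logt s) ^ (7 + 9 * k) \<ge> 1" by (rule one_le_power[OF logt_ge_1])
    show "norm ((deriv ^^ k) inv_zeta s) \<le> C * (logt s) ^ (7 + 9 * k)"
    proof (cases "\<bar>Im s\<bar> \<ge> 3")
      case True
      have "norm ((deriv ^^ k) inv_zeta s) \<le> C1 * (logt s) ^ (7 + 9 * k)" by (rule C1(2)[OF True s])
      also have "\<dots> \<le> C * (logt s) ^ (7 + 9 * k)" using l by (intro mult_right_mono) (auto simp: C_def)
      finally show ?thesis .
    next
      case False
      then have "s \<in> ?K" using s by (auto simp: in_cbox_complex_iff)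
      then have "norm ((deriv ^^ k) inv_zeta s) \<le> C2" by (intro C2) auto
      also have "\<dots> \<le> C * 1" by (simp add: C_def)
      also have "\<dots> \<le> C * (logt s) ^ (7 + 9 * k)" using l C1 by (intro mult_left_mono) (auto simp: C_def)
      finally show ?thesis .
    qed
  qed
qed

section \<open>Derivatives of the Dirichlet series of the reciprocal\<close>

lemma higher_deriv_dirichlet_poly:
  fixes c :: "nat \<Rightarrow> complex"
  shows
  "(deriv ^^ k) (\<lambda>s. \<Sum>n<N. c n * of_nat n powr (- s)) = (\<lambda>s. \<Sum>n<N. c n * of_real ((- ln (real n)) ^ k) * of_nat n powr (- s))"
proof (induction k)
  case (Suc k)
  have d: "((\<lambda>s. of_nat n powr (- s)) has_field_derivative of_real (- ln (real n)) * of_nat n powr (- s)) (at s)" for n :: nat and s :: complex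
  proof (cases "n = 0")
    case False
    then have "Ln (of_nat n) = of_real (ln (real n))" using Ln_of_real[of "real n"] by simp
    moreover have "((\<lambda>s. of_nat n powr (- s)) has_field_derivative Ln (of_nat n) * of_nat n powr (- s) * (- 1)) (at s)"
      using False by (intro DERIV_chain2[OF has_field_derivative_powr_right DERIV_minus[OF DERIV_ident]]) simp
    ultimately show ?thesis by simp
  qed simp
  have "((\<lambda>s. \<Sum>n<N. c n * of_real ((- ln (real n)) ^ k) * of_nat n powr (- s)) has_field_derivative
         (\<Sum>n<N. c n * of_real ((- ln (real n)) ^ k) * (of_real (- ln (real n)) * of_nat n powr (- s)))) (at s)" for s
    by (intro DERIV_sum DERIV_cmult d)
  from DERIV_imp_deriv[OF this] show ?case
    unfolding funpow.simps o_apply Suc by (auto simp: fun_eq_iff mult_ac)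
qed simp

text \<open>The series converges uniformly on an open half-plane that contains \<open>s\<close>, so
  all derivatives of its partial sums converge to those of the limit.\<close>

lemma dirichlet_series_higher_deriv:
  assumes s: "Re s > 1"
  shows "(\<lambda>N. \<Sum>n<N. moebius_c n * of_real ((- ln (real n)) ^ k) * of_nat n powr (- s)) \<longlonglongrightarrow> (deriv ^^ k) inv_zeta s"
proof -
  define b where "b = (1 + Re s) / 2"
  have b: "b > 1" "Re s > b" using s by (auto simp: b_def)
  let ?A = "{s::complex. Re s > b}"
  have op: "open ?A" by (rule open_halfspace_Re_gt)
  define g where "g z = (\<Sum>n. moebius_c n * of_nat n powr (- z))" for z
  have "uniform_limit ?A (\<lambda>N z. \<Sum>n<N. moebius_c n * of_nat n powr (- z)) g sequentially"
    unfolding g_def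
  proof (rule Weierstrass_m_test)
    show "summable (\<lambda>n. real n powr (- b))" using summable_real_powr_iff[of "- b"] b by simp
    fix n z assume z: "z \<in> ?A"
    have "norm (moebius_c n * of_nat n powr (- z)) \<le> 1 * norm (of_nat n powr (- z) :: complex)"
      unfolding norm_mult by (intro mult_right_mono norm_moebius_c_le) auto
    also have "\<dots> \<le> real n powr (- b)"
    proof (cases "n = 0")
      case False
      then show ?thesis unfolding norm_nat_powr using z by (auto intro!: powr_mono)
    qed simp
    finally show "norm (moebius_c n * of_nat n powr (- z)) \<le> real n powr (- b)" .
  qed
  then have "(\<lambda>N. (deriv ^^ k) (\<lambda>s. \<Sum>n<N. moebius_c n * of_nat n powr (- s)) s) \<longlonglongrightarrow> (deriv ^^ k) g s"
  proof (rule higher_deriv_complex_uniform_limit)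
    show "\<forall>\<^sub>F N in sequentially. (\<lambda>z. \<Sum>n<N. moebius_c n * of_nat n powr (- z)) holomorphic_on ?A"
    proof (intro always_eventually allI holomorphic_on_sum holomorphic_on_mult holomorphic_on_const)
      fix n :: nat show "(\<lambda>z. of_nat n powr (- z) :: complex) holomorphic_on ?A"
        by (cases "n = 0") (auto intro!: holomorphic_intros)
    qed
  qed (use op b in auto)
  moreover have "(deriv ^^ k) g s = (deriv ^^ k) inv_zeta s"
  proof (rule higher_deriv_cong_ev)
    have "g z = inv_zeta z" if "z \<in> ?A" for z
    proof -
      have z: "Re z > 1" using that b by simp
      have "((\<lambda>n. moebius_c n * of_nat n powr (- z)) has_sum g z) UNIV"
      proof (rule norm_summable_imp_has_sum)
        show nm: "summable (\<lambda>n. norm (moebius_c n * of_nat n powr (- z)))"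
        proof (rule summable_comparison_test'[where N = 0])
          show "summable (\<lambda>n. norm (of_nat n powr (- z) :: complex))" by (rule summable_norm_nat_powr[OF z])
          show "norm (norm (moebius_c n * of_nat n powr (- z))) \<le> norm (of_nat n powr (- z) :: complex)" for n
            using norm_moebius_c_le[of n] mult_right_mono[of "norm (moebius_c n)" 1 "norm (of_nat n powr (- z) :: complex)"] by (simp add: norm_mult)
        qed
        show "(\<lambda>n. moebius_c n * of_nat n powr (- z)) sums g z"
          unfolding g_def by (rule summable_sums[OF summable_norm_cancel[OF nm]])
      qed
      then have "g z = (\<Sum>\<^sub>\<infinity>n. moebius_c n * of_nat n powr (- z))" by (rule infsumI[symmetric])
      also have "\<dots> = free_dirichlet moebius_c {} z" unfolding free_dirichlet_def by (rule infsum_cong_neutral) (auto simp: free_of_def)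
      finally show ?thesis using inv_zeta_eq_free_dirichlet[OF z] by simp
    qed
    then show "\<forall>\<^sub>F z in nhds s. g z = inv_zeta z"
      using eventually_nhds_in_open[OF op, of s] b by (auto elim!: eventually_mono)
  qed simp
  ultimately show ?thesis by (simp add: higher_deriv_dirichlet_poly)
qed

section \<open>Summatory function of the Moebius function\<close>

definition exp_law :: "real \<Rightarrow> real measure" where
  "exp_law c = density lborel (exponential_density c)"

lemma real_distribution_exp_law:
  assumes "c > 0"
  shows "real_distribution (exp_law c)"
proof -
  interpret prob_space "exp_law c" unfolding exp_law_def by (rule prob_space_exponential_density[OF assms])
  show ?thesis by unfold_locales (simp add: exp_law_def)
qed

lemma cdf_exp_law:
  assumes "c > 0"
  shows "cdf (exp_law c) u = (if 0 \<le> u then 1 - exp (- c * u) else 0)"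
  unfolding cdf_def measure_def exp_law_def emeasure_erlang_density[OF assms] erlang_CDF_0
  using assms by simp

lemma exp_law_null:
  assumes "c > 0"
  shows "measure (exp_law c) {u} = 0"
proof -
  have "absolutely_continuous lborel (exp_law c)" unfolding exp_law_def
    by (rule absolutely_continuousI_density) simp
  moreover have "{u} \<in> null_sets lborel" by (rule countable_imp_null_set_lborel) simp
  ultimately have "{u} \<in> null_sets (exp_law c)" unfolding absolutely_continuous_def by blast
  then show ?thesis by (simp add: measure_def null_setsD1)
qed

lemma exp_law_Ioc:
  assumes "c > 0" "u < v"
  shows "measure (exp_law c) {u<..v} = cdf (exp_law c) v - cdf (exp_law c) u"
proof -
  interpret real_distribution "exp_law c" by (rule real_distribution_exp_law[OF assms(1)])
  show ?thesis using cdf_diff_eq[OF assms(2)] by simp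
qed

text \<open>At \<open>s = c - \<i> * t\<close> this is the kernel \<open>c / s\<close> on the
  vertical line \<open>Re s = c\<close>; Levy's inversion theorem for this law will act as Perron's
  formula.\<close>

lemma char_exp_law:
  assumes c: "c > 0"
  shows "char (exp_law c) t = of_real c / (of_real c - \<i> * of_real t)"
proof -
  interpret real_distribution "exp_law c" by (rule real_distribution_exp_law[OF c])
  define w where "w = \<i> * of_real t - (of_real c :: complex)"
  have w: "w \<noteq> 0" using c by (auto simp: w_def complex_eq_iff)
  have "char (exp_law c) t = (CLBINT x. exponential_density c x *\<^sub>R iexp (t * x))"
    unfolding char_def exp_law_def using c by (subst integral_density) auto
  also have "\<dots> = (CLBINT x. indicator {0<..} x *\<^sub>R (of_real c * exp (w * of_real x)))"
  proof (rule integral_cong_AE)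
    show "AE x in lborel. exponential_density c x *\<^sub>R iexp (t * x) = indicator {0<..} x *\<^sub>R (of_real c * exp (w * of_real x))"
    proof (rule AE_mp[OF AE_lborel_singleton[of 0]], intro AE_I2 impI)
      fix x :: real assume "x \<noteq> 0"
      then show "exponential_density c x *\<^sub>R iexp (t * x) = indicator {0<..} x *\<^sub>R (of_real c * exp (w * of_real x))"
        by (auto simp: exponential_density_def indicator_def w_def scaleR_conv_of_real exp_of_real[symmetric] mult_exp_exp algebra_simps)
    qed
  qed auto
  also have "\<dots> = (CLBINT x=0..\<infinity>. of_real c * exp (w * of_real x))"
    unfolding interval_lebesgue_integral_0_infty set_lebesgue_integral_def by (rule refl)
  also have "\<dots> = 0 - of_real c / w"
  proof (rule interval_integral_FTC_integrable)
    let ?F = "\<lambda>x::real. of_real c / w * exp (w * of_real x)"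
    show "(0::ereal) < \<infinity>" by simp
    show "(?F has_vector_derivative of_real c * exp (w * of_real x)) (at x)" for x
    proof -
      have "((\<lambda>z. of_real c / w * exp (w * z)) has_field_derivative of_real c * exp (w * of_real x)) (at (of_real x))"
        using w by (auto intro!: derivative_eq_intros)
      then show ?thesis by (rule has_vector_derivative_real_field)
    qed
    show "isCont (\<lambda>x::real. of_real c * exp (w * of_real x)) x" for x by (intro continuous_intros)
    show "set_integrable lborel (einterval 0 \<infinity>) (\<lambda>x::real. of_real c * exp (w * of_real x))"
    proof -
      have "integrable lborel (exponential_density c)"
      proof (rule integrableI_nonneg)
        have "(\<integral>\<^sup>+ x. ennreal (exponential_density c x) \<partial>lborel) = emeasure (exp_law c) (space (exp_law c))"
          unfolding exp_law_def by (subst emeasure_density) (auto intro!: nn_integral_cong)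
        also have "\<dots> = 1" by (rule emeasure_space_1)
        finally show "(\<integral>\<^sup>+ x. ennreal (exponential_density c x) \<partial>lborel) < \<infinity>" by simp
      qed (use c in auto)
      then have "integrable lborel (\<lambda>x. indicator {0<..} x *\<^sub>R (of_real c * exp (w * of_real x) :: complex))"
      proof (rule Bochner_Integration.integrable_bound)
        show "AE x in lborel. norm (indicator {0<..} x *\<^sub>R (of_real c * exp (w * of_real x) :: complex)) \<le> norm (exponential_density c x)"
          using c by (intro AE_I2) (auto simp: exponential_density_def indicator_def norm_mult w_def)
      qed auto
      then show ?thesis by (simp add: set_integrable_def zero_ereal_def)
    qed
    show "((?F \<circ> real_of_ereal) \<longlongrightarrow> of_real c / w) (at_right 0)"
    proof -
      have "(?F \<longlongrightarrow> of_real c / w * exp (w * of_real 0)) (at_right 0)" by (intro tendsto_intros)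
      then show ?thesis unfolding zero_ereal_def by (simp add: ereal_tendsto_simps)
    qed
    show "((?F \<circ> real_of_ereal) \<longlongrightarrow> 0) (at_left \<infinity>)"
    proof -
      have "(?F \<longlongrightarrow> 0) at_top"
      proof (rule tendsto_norm_zero_cancel)
        have "((\<lambda>x. norm (of_real c / w) * exp (- c * x)) \<longlongrightarrow> 0) at_top" using c by real_asymp
        moreover have "norm (?F x) = norm (of_real c / w) * exp (- c * x)" for x
        proof -
          have "norm (exp (w * of_real x)) = exp (- c * x)" by (simp add: w_def)
          then show ?thesis unfolding norm_mult by (simp only:)
        qed
        ultimately show "((\<lambda>x. norm (?F x)) \<longlongrightarrow> 0) at_top" by (simp only:)
      qed
      then show ?thesis by (simp add: ereal_tendsto_simps)
    qed
  qed
  also have "\<dots> = of_real c / (of_real c - \<i> * of_real t)"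
    unfolding w_def by (metis diff_0 minus_diff_eq minus_divide_right)
  finally show ?thesis .
qed

text \<open>Essentially the geometric mean of the bounds \<open>h\<close> and
  \<open>2 / \<bar>t\<bar>\<close>. The half power of \<open>t\<close> makes the integral converge
  absolutely together with the decay of \<open>char\<close>, and half a power of \<open>h\<close> is
  kept for the smoothing.\<close>

lemma levy_kernel_norm_le:
  fixes h t :: real
  assumes h: "0 < h" "h \<le> 1"
  shows "norm ((iexp (t * h) - 1) / (\<i> * of_real t)) \<le> 2 * sqrt h / sqrt (1 + \<bar>t\<bar>)"
proof (cases "t = 0")
  case False
  have b1: "norm ((iexp (t * h) - 1) / (\<i> * of_real t)) \<le> h"
    using Levy_Inversion_aux2[of 0 h t] h False by simp
  have "norm (iexp (t * h) - 1) \<le> norm (iexp (t * h)) + norm (1::complex)" by (rule norm_triangle_ineq4)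
  then have n2: "norm (iexp (t * h) - 1) \<le> 2" by simp
  have b2: "norm ((iexp (t * h) - 1) / (\<i> * of_real t)) \<le> 2 / \<bar>t\<bar>"
    unfolding norm_divide norm_mult using n2 by (simp add: divide_right_mono)
  define m where "m = norm ((iexp (t * h) - 1) / (\<i> * of_real t))"
  have m0: "m \<ge> 0" by (simp add: m_def)
  have "m\<^sup>2 * (1 + \<bar>t\<bar>) \<le> 4 * h"
  proof -
    have "m\<^sup>2 \<le> h * h" unfolding power2_eq_square using b1 m0 unfolding m_def[symmetric] by (intro mult_mono) auto
    also have "\<dots> \<le> h * 1" using h by (intro mult_left_mono) auto
    finally have 1: "m\<^sup>2 \<le> h" by simp
    have "m\<^sup>2 \<le> h * (2 / \<bar>t\<bar>)" unfolding power2_eq_square using b1 b2 m0 h unfolding m_def[symmetric] by (intro mult_mono) auto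
    then have 2: "m\<^sup>2 * \<bar>t\<bar> \<le> 2 * h" using False by (simp add: field_simps)
    show ?thesis using 1 2 h by (simp add: algebra_simps)
  qed
  then have "m\<^sup>2 \<le> 4 * h / (1 + \<bar>t\<bar>)" by (subst pos_le_divide_eq) auto
  then have "sqrt (m\<^sup>2) \<le> sqrt (4 * h / (1 + \<bar>t\<bar>))" by (rule real_sqrt_le_mono)
  then have "m \<le> 2 * sqrt h / sqrt (1 + \<bar>t\<bar>)" using m0 by (simp add: real_sqrt_divide real_sqrt_mult)
  then show ?thesis unfolding m_def .
qed (use h in simp)

text \<open>The bound is free of \<open>T\<close>, so it survives the limit in the inversion
  formula. It is twice \<open>4 * K\<close>, from the antiderivative
  \<open>- 4 * K * (1 + t) powr (-1/4)\<close> on each side of 0.\<close>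

lemma interval_integral_decay:
  fixes f :: "real \<Rightarrow> complex"
  assumes int: "interval_lebesgue_integrable lborel (ereal (-T)) (ereal T) f" and T: "T > 0"
    and K: "K \<ge> 0" "\<And>t. norm (f t) \<le> K * (1 + \<bar>t\<bar>) powr (-5/4)"
  shows "norm (CLBINT t=-T..T. f t) \<le> 8 * K"
proof -
  let ?g = "\<lambda>t. K * (1 + \<bar>t\<bar>) powr (-5/4)"
  have cont: "continuous_on A ?g" for A by (intro continuous_intros) auto
  have gi: "interval_lebesgue_integrable lborel (ereal a) (ereal b) ?g" if "a \<le> b" for a b
    using that by (intro interval_integrable_continuous_on cont)
  have "norm (CLBINT t=-T..T. f t) \<le> (LBINT t=-T..T. norm (f t))"
    using int T by (intro interval_integral_norm) auto
  also have "\<dots> \<le> (LBINT t=-T..T. ?g t)"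
  proof -
    have "set_integrable lborel (einterval (-T) T) (\<lambda>t. norm (f t))"
      using int T by (simp add: interval_lebesgue_integrable_def set_integrable_norm)
    moreover have "set_integrable lborel (einterval (-T) T) ?g"
      using gi[of "-T" T] T by (simp add: interval_lebesgue_integrable_def)
    ultimately have "(LBINT t:einterval (-T) T. norm (f t)) \<le> (LBINT t:einterval (-T) T. ?g t)"
      by (rule set_integral_mono) (rule K(2))
    moreover have "ereal (-T) \<le> ereal T" using T by simp
    ultimately show ?thesis unfolding interval_lebesgue_integral_def by (simp only: if_True)
  qed
  also have "\<dots> = (LBINT t=-T..(0::real). ?g t) + (LBINT t=(0::real)..T. ?g t)"
    using gi T by (intro interval_integral_sum[symmetric]) (simp add: min_absorb1 max_absorb2)
  also have "(LBINT t=(0::real)..T. ?g t) = (- 4 * K * (1 + T) powr (-1/4)) - (- 4 * K * (1 + 0) powr (-1/4))"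
  proof (rule interval_integral_FTC_finite[OF cont])
    fix t assume t: "min 0 T \<le> t" "t \<le> max 0 T"
    then have t0: "t \<ge> 0" using T by simp
    have "((\<lambda>t. - 4 * K * (1 + t) powr (-1/4)) has_real_derivative K * (1 + t) powr (-5/4)) (at t within {min 0 T..max 0 T})"
      using t0 by (auto intro!: derivative_eq_intros)
    then show "((\<lambda>t. - 4 * K * (1 + t) powr (-1/4)) has_vector_derivative ?g t) (at t within {min 0 T..max 0 T})"
      using t0 by (simp add: has_real_derivative_iff_has_vector_derivative)
  qed
  also have "(LBINT t=-T..(0::real). ?g t) = (4 * K * (1 - 0) powr (-1/4)) - (4 * K * (1 - (-T)) powr (-1/4))"
  proof (rule interval_integral_FTC_finite[OF cont])
    fix t assume t: "min (-T) 0 \<le> t" "t \<le> max (-T) 0"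
    then have t0: "t \<le> 0" using T by simp
    have "((\<lambda>t. 4 * K * (1 - t) powr (-1/4)) has_real_derivative K * (1 - t) powr (-5/4)) (at t within {min (-T) 0..max (-T) 0})"
      using t0 by (auto intro!: derivative_eq_intros)
    then show "((\<lambda>t. 4 * K * (1 - t) powr (-1/4)) has_vector_derivative ?g t) (at t within {min (-T) 0..max (-T) 0})"
      using t0 by (simp add: has_real_derivative_iff_has_vector_derivative)
  qed
  also have "(4 * K * (1 - 0) powr (-1/4)) - (4 * K * (1 - (-T)) powr (-1/4)) + ((- 4 * K * (1 + T) powr (-1/4)) - (- 4 * K * (1 + 0) powr (-1/4)))
      \<le> 8 * K" using K by simp
  finally show ?thesis .
qed

lemma ln_power_le_powr:
  assumes u: "u \<ge> 1" and e: "e > 0" and k: "k > 0"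
  shows "(ln u) ^ k \<le> (real k / e) ^ k * u powr e"
proof -
  have "ln u \<le> u powr (e / real k) / (e / real k)" using u e k by (intro ln_powr_bound) auto
  then have "(ln u) ^ k \<le> (u powr (e / real k) / (e / real k)) ^ k" using u by (intro power_mono) auto
  also have "\<dots> = (real k / e) ^ k * (u powr (e / real k)) ^ k" by (simp add: power_divide power_mult_distrib field_simps)
  also have "(u powr (e / real k)) ^ k = u powr e" using u k by (simp add: powr_realpow[symmetric] powr_powr)
  finally show ?thesis .
qed

text \<open>Powers of \<open>logt\<close> are given up for a small power of the height. The exponent
  1/4 is below the 1/2 to spare: the later integrand has exponent
  \<open>1/4 - 1 - 1/2 = - 5/4\<close>.\<close>

lemma inv_zeta_deriv_growth:
  obtains C where "C \<ge> 0"
    "\<And>s. 1 \<le> Re s \<Longrightarrow> Re s \<le> 3/2 \<Longrightarrow> norm ((deriv ^^ k) inv_zeta s) \<le> C * (1 + \<bar>Im s\<bar>) powr (1/4)"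
proof -
  obtain C where C: "C \<ge> 0" "\<And>s. 1 \<le> Re s \<Longrightarrow> Re s \<le> 3/2 \<Longrightarrow> norm ((deriv ^^ k) inv_zeta s) \<le> C * (logt s) ^ (7 + 9 * k)"
    using higher_deriv_inv_zeta_bound by blast
  define E where "E = (real (7 + 9 * k) / (1/4)) ^ (7 + 9 * k)"
  have E: "E \<ge> 0" by (simp add: E_def)
  show ?thesis
  proof (rule that[of "C * (E * 3)"])
    show "C * (E * 3) \<ge> 0" using C E by simp
    fix s assume s: "1 \<le> Re s" "Re s \<le> 3/2"
    have "(logt s) ^ (7 + 9 * k) \<le> E * (\<bar>Im s\<bar> + 3) powr (1/4)"
      unfolding logt_def E_def by (rule ln_power_le_powr) auto
    also have "\<dots> \<le> E * (3 * (1 + \<bar>Im s\<bar>) powr (1/4))"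
    proof (rule mult_left_mono[OF _ E])
      have "(\<bar>Im s\<bar> + 3) powr (1/4) \<le> (3 * (1 + \<bar>Im s\<bar>)) powr (1/4)" by (intro powr_mono2) auto
      also have "\<dots> = 3 powr (1/4) * (1 + \<bar>Im s\<bar>) powr (1/4)" by (rule powr_mult)
      also have "\<dots> \<le> 3 powr 1 * (1 + \<bar>Im s\<bar>) powr (1/4)" by (intro mult_right_mono powr_mono) auto
      finally show "(\<bar>Im s\<bar> + 3) powr (1/4) \<le> 3 * (1 + \<bar>Im s\<bar>) powr (1/4)" by simp
    qed
    finally have "C * (logt s) ^ (7 + 9 * k) \<le> C * (E * (3 * (1 + \<bar>Im s\<bar>) powr (1/4)))" using C by (intro mult_left_mono) auto
    then show "norm ((deriv ^^ k) inv_zeta s) \<le> C * (E * 3) * (1 + \<bar>Im s\<bar>) powr (1/4)" using C(2)[OF s] by simp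
  qed
qed

section \<open>Perron's formula for the coefficients of the derivatives\<close>

lemma summable_ln_power_powr:
  assumes "c > 1"
  shows "summable (\<lambda>n. \<bar>ln (real n)\<bar> ^ k * real n powr (- c))"
proof (cases "k = 0")
  case True
  then show ?thesis using summable_real_powr_iff[of "- c"] assms by simp
next
  case False
  define e where "e = (c - 1) / 2"
  have e: "e > 0" "- c + e < - 1" using assms by (auto simp: e_def field_simps)
  show ?thesis
  proof (rule summable_comparison_test'[where N = 1])
    show "summable (\<lambda>n. (real k / e) ^ k * real n powr (- c + e))"
      using summable_real_powr_iff[of "- c + e"] e by (intro summable_mult) simp
    fix n :: nat assume n: "n \<ge> 1"
    have "\<bar>ln (real n)\<bar> ^ k * real n powr (- c) \<le> ((real k / e) ^ k * real n powr e) * real n powr (- c)"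
      using ln_power_le_powr[of "real n" e k] n e False by (intro mult_right_mono) auto
    also have "\<dots> = (real k / e) ^ k * real n powr (- c + e)" unfolding powr_add by (simp only: mult_ac)
    finally show "norm (\<bar>ln (real n)\<bar> ^ k * real n powr (- c)) \<le> (real k / e) ^ k * real n powr (- c + e)" by simp
  qed
qed

text \<open>The coefficients of the \<open>k\<close>-th derivative of the reciprocal of zeta. Index
  0 is harmless in later sums, because \<open>moebius_mu 0 = 0\<close>.\<close>

definition mu_ln :: "nat \<Rightarrow> nat \<Rightarrow> real" where
  "mu_ln k n = of_int (moebius_mu n) * (- ln (real n)) ^ k"

lemma abs_mu_ln_le: "\<bar>mu_ln k n\<bar> \<le> \<bar>ln (real n)\<bar> ^ k"
proof -
  have "\<bar>of_int (moebius_mu n) :: real\<bar> \<le> 1" using abs_moebius_mu_le[of n] by linarith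
  then have "\<bar>of_int (moebius_mu n) :: real\<bar> * \<bar>ln (real n)\<bar> ^ k \<le> 1 * \<bar>ln (real n)\<bar> ^ k" by (intro mult_right_mono) auto
  then show ?thesis by (simp add: mu_ln_def abs_mult power_abs)
qed

text \<open>Finite sums are wanted because they commute with the integral. On the line
  \<open>Re s = c\<close> the tail of the series is below 1 uniformly, so \<open>N0\<close> depends
  on \<open>c\<close> but not on \<open>s\<close>. The constant \<open>C\<close> must not depend on
  \<open>c\<close>, which will tend to 1.\<close>

lemma dirichlet_poly_bound:
  obtains C where "C \<ge> 0"
    "\<And>c. 1 < c \<Longrightarrow> c \<le> 3/2 \<Longrightarrow> \<exists>N0. \<forall>N\<ge>N0. \<forall>s. Re s = c \<longrightarrow>
       norm (\<Sum>n<N. of_real (mu_ln k n) * of_nat n powr (- s) :: complex) \<le> C * (1 + \<bar>Im s\<bar>) powr (1/4)"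
proof -
  obtain C where C: "C \<ge> 0" "\<And>s. 1 \<le> Re s \<Longrightarrow> Re s \<le> 3/2 \<Longrightarrow> norm ((deriv ^^ k) inv_zeta s) \<le> C * (1 + \<bar>Im s\<bar>) powr (1/4)"
    using inv_zeta_deriv_growth by blast
  show ?thesis
  proof (rule that[of "C + 1"])
    show "C + 1 \<ge> 0" using C by simp
    fix c :: real assume c: "1 < c" "c \<le> 3/2"
    define g where "g n = \<bar>ln (real n)\<bar> ^ k * real n powr (- c)" for n :: nat
    have gs: "summable g" unfolding g_def by (rule summable_ln_power_powr[OF c(1)])
    have g0: "g n \<ge> 0" for n by (simp add: g_def)
    obtain N0 where N0: "\<And>n. n \<ge> N0 \<Longrightarrow> norm (\<Sum>i. g (i + n)) < 1"
      using suminf_exist_split[OF zero_less_one gs] by blast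
    show "\<exists>N0. \<forall>N\<ge>N0. \<forall>s. Re s = c \<longrightarrow>
       norm (\<Sum>n<N. of_real (mu_ln k n) * of_nat n powr (- s) :: complex) \<le> (C + 1) * (1 + \<bar>Im s\<bar>) powr (1/4)"
    proof (intro exI allI impI)
      fix N s assume N: "N0 \<le> N" and s: "Re s = c"
      define D where "D M = (\<Sum>n<M. of_real (mu_ln k n) * of_nat n powr (- s) :: complex)" for M
      have lim: "D \<longlonglongrightarrow> (deriv ^^ k) inv_zeta s"
        using dirichlet_series_higher_deriv[of s k] s c unfolding D_def mu_ln_def by (simp add: mult_ac)
      have tail: "norm (D M - D N) \<le> 1" if M: "M \<ge> N" for M
      proof -
        have "D M - D N = (\<Sum>n=N..<M. of_real (mu_ln k n) * of_nat n powr (- s))"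
          unfolding D_def lessThan_atLeast0 using M by (subst sum_diff_nat_ivl) auto
        also have "norm \<dots> \<le> (\<Sum>n=N..<M. g n)"
        proof (rule sum_norm_le)
          fix n show "norm (of_real (mu_ln k n) * of_nat n powr (- s) :: complex) \<le> g n"
            using abs_mu_ln_le[of k n] s by (simp add: norm_mult norm_nat_powr g_def mult_right_mono)
        qed
        also have "\<dots> = (\<Sum>i<M - N. g (i + N))"
          using M by (subst sum.atLeastLessThan_shift_0) (simp add: lessThan_atLeast0 add.commute)
        also have "\<dots> \<le> (\<Sum>i. g (i + N))"
          using gs g0 by (intro sum_le_suminf) (auto simp: summable_iff_shift)
        also have "\<dots> \<le> 1" using N0[OF N] by simp
        finally show ?thesis .
      qed
      have "norm ((deriv ^^ k) inv_zeta s - D N) \<le> 1"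
        by (rule Lim_bounded[OF tendsto_norm[OF tendsto_diff[OF lim tendsto_const]], of N]) (use tail in auto)
      then have "norm (D N) \<le> norm ((deriv ^^ k) inv_zeta s) + 1"
        using norm_triangle_sub[of "D N" "(deriv ^^ k) inv_zeta s"] by (simp add: norm_minus_commute)
      also have "\<dots> \<le> C * (1 + \<bar>Im s\<bar>) powr (1/4) + (1 + \<bar>Im s\<bar>) powr (1/4)"
        using C(2)[of s] s c by (intro add_mono ge_one_powr_ge_zero) auto
      finally show "norm (\<Sum>n<N. of_real (mu_ln k n) * of_nat n powr (- s) :: complex) \<le> (C + 1) * (1 + \<bar>Im s\<bar>) powr (1/4)"
        by (simp add: D_def algebra_simps)
    qed
  qed
qed

text \<open>Perron's formula in probabilistic form: the weight of \<open>n\<close> is the probability that an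
  exponential variable of rate \<open>c\<close> falls into \<open>{V - ln n - h<..V - ln n}\<close>, which is proportional to
  \<open>n powr c\<close> as long as \<open>ln n \<le> V - h\<close>.\<close>

lemma weighted_sum_bound:
  obtains K where "K \<ge> 0"
    "\<And>c h V. 1 < c \<Longrightarrow> c \<le> 3/2 \<Longrightarrow> 0 < h \<Longrightarrow> h \<le> 1 \<Longrightarrow>
      \<exists>N0. \<forall>N\<ge>N0. \<bar>\<Sum>n<N. mu_ln k n * real n powr (- c) * measure (exp_law c) {V - ln (real n) - h<..V - ln (real n)}\<bar> \<le> K * sqrt h"
proof -
  obtain C where C: "C \<ge> 0" "\<And>c. 1 < c \<Longrightarrow> c \<le> 3/2 \<Longrightarrow> \<exists>N0. \<forall>N\<ge>N0. \<forall>s. Re s = c \<longrightarrow>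
       norm (\<Sum>n<N. of_real (mu_ln k n) * of_nat n powr (- s) :: complex) \<le> C * (1 + \<bar>Im s\<bar>) powr (1/4)"
    using dirichlet_poly_bound by blast
  show ?thesis
  proof (rule that[of "8 * (6 * C)"])
    show "8 * (6 * C) \<ge> 0" using C by simp
    fix c h V :: real assume c: "1 < c" "c \<le> 3/2" and h: "0 < h" "h \<le> 1"
    interpret real_distribution "exp_law c" by (rule real_distribution_exp_law) (use c in simp)
    obtain N0 where N0: "\<And>N s. N \<ge> N0 \<Longrightarrow> Re s = c \<Longrightarrow>
       norm (\<Sum>n<N. of_real (mu_ln k n) * of_nat n powr (- s) :: complex) \<le> C * (1 + \<bar>Im s\<bar>) powr (1/4)"
      using C(2)[OF c] by blast
    show "\<exists>N0. \<forall>N\<ge>N0. \<bar>\<Sum>n<N. mu_ln k n * real n powr (- c) * measure (exp_law c) {V - ln (real n) - h<..V - ln (real n)}\<bar> \<le> 8 * (6 * C) * sqrt h"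
    proof (intro exI allI impI)
      fix N assume N: "N0 \<le> N"
      define b where "b n = V - ln (real n)" for n :: nat
      define \<phi> where "\<phi> t = char (exp_law c) t" for t
      \<comment> \<open>The integrand of Levy's inversion formula for
        \<open>{b n - h<..b n}\<close>; the end points carry no mass, as that formula
        demands.\<close>
      define G where "G n t = (iexp (-(t * (b n - h))) - iexp (-(t * b n))) / (\<i> * of_real t) * \<phi> t" for n :: nat and t :: real
      define w where "w n = (of_real (mu_ln k n * real n powr (- c)) :: complex)" for n :: nat
      have phi: "\<phi> t = of_real c / (of_real c - \<i> * of_real t)" for t
        unfolding \<phi>_def using c by (intro char_exp_law) simp
      have lev: "(\<lambda>T. 1 / (2 * pi) * (CLBINT t=-T..T. G n t)) \<longlonglongrightarrow> measure (exp_law c) {b n - h<..b n}" for n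
        unfolding G_def \<phi>_def using h c by (intro Levy_Inversion exp_law_null) auto
      have lev': "(\<lambda>T. complex_of_real (1 / (2 * pi)) * (CLBINT t=-real T..real T. G n t)) \<longlonglongrightarrow> measure (exp_law c) {b n - h<..b n}" for n
        using lev[of n] by simp
      have meas: "G n \<in> borel_measurable borel" for n unfolding G_def phi by measurable
      have Gb: "norm (G n t) \<le> h" for n t
      proof (cases "t = 0")
        case False
        have "norm ((iexp (-(t * (b n - h))) - iexp (-(t * b n))) / (\<i> * of_real t)) \<le> h"
        proof -
          have le: "- b n \<le> - (b n - h)" using h by simp
          from Levy_Inversion_aux2[OF le False] show ?thesis unfolding mult_minus_right by linarith
        qed
        moreover have "norm (\<phi> t) \<le> 1" unfolding \<phi>_def by (rule cmod_char_le_1)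
        ultimately show ?thesis unfolding G_def norm_mult using mult_mono[of _ h _ 1] h by fastforce
      qed (use h in \<open>simp add: G_def\<close>)
      have int: "interval_lebesgue_integrable lborel (ereal (- T)) (ereal T) (G n)" if "T > 0" for n T
        using that meas Gb unfolding interval_lebesgue_integrable_def set_integrable_def
        by (auto intro!: integrableI_bounded_set_indicator[where B = h])
      have sumint: "interval_lebesgue_integrable lborel (ereal (- T)) (ereal T) (\<lambda>t. \<Sum>n<M. w n * G n t) \<and>
          (CLBINT t=-T..T. (\<Sum>n<M. w n * G n t)) = (\<Sum>n<M. w n * (CLBINT t=-T..T. G n t))" if T: "T > 0" for T M
      proof (induction M)
        case (Suc M)
        have "interval_lebesgue_integrable lborel (ereal (- T)) (ereal T) (\<lambda>t. w M * G M t)"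
          using int[OF T] by (intro interval_lebesgue_integrable_mult_right) auto
        then show ?case using Suc by simp
      qed (simp add: interval_lebesgue_integrable_def set_integrable_def)
      have key: "norm (\<Sum>n<N. w n * G n t) \<le> (6 * C * sqrt h) * (1 + \<bar>t\<bar>) powr (-5/4)" for t
      proof -
        define s where "s = of_real c - \<i> * of_real t"
        have Rs: "Re s = c" "Im s = - t" by (auto simp: s_def)
        \<comment> \<open>The dependence on \<open>n\<close> separates: the weight
          \<open>n powr (- c)\<close> and the shift by \<open>ln n\<close> combine to
          \<open>n powr (- s)\<close> at \<open>s = c - \<i> * t\<close>, and the rest is a kernel
          common to all \<open>n\<close>.\<close>
        have tm: "w n * G n t = ((iexp (t * h) - 1) / (\<i> * of_real t) * iexp (- (t * V)) * \<phi> t) * (of_real (mu_ln k n) * of_nat n powr (- s))" for n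
        proof (cases "n = 0")
          case False
          then have lnn: "Ln (of_nat n) = of_real (ln (real n))" using Ln_of_real[of "real n"] by simp
          have "of_nat n powr (- s) = exp (of_real (- c * ln (real n)) + \<i> * of_real (t * ln (real n)))"
            using False by (simp add: powr_def lnn s_def algebra_simps)
          also have "\<dots> = exp (of_real (- c * ln (real n))) * iexp (t * ln (real n))" by (rule exp_add)
          also have "exp (of_real (- c * ln (real n)) :: complex) = of_real (real n powr (- c))"
            using False by (simp only: exp_of_real powr_def) simp
          finally have np: "of_nat n powr (- s) = of_real (real n powr (- c)) * iexp (t * ln (real n))" .
          have e1: "iexp (-(t * (b n - h))) = iexp (- (t * V)) * iexp (t * ln (real n)) * iexp (t * h)"
            unfolding b_def by (simp add: mult_exp_exp algebra_simps)
          have e2: "iexp (-(t * b n)) = iexp (- (t * V)) * iexp (t * ln (real n))"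
            unfolding b_def by (simp add: mult_exp_exp algebra_simps)
          show ?thesis unfolding G_def e1 e2 np w_def by (simp add: algebra_simps diff_divide_distrib)
        qed (simp add: w_def)
        have "norm (\<Sum>n<N. w n * G n t) = norm ((iexp (t * h) - 1) / (\<i> * of_real t)) * norm (\<phi> t) * norm (\<Sum>n<N. of_real (mu_ln k n) * of_nat n powr (- s) :: complex)"
          unfolding tm sum_distrib_left[symmetric] norm_mult norm_exp_i_times by simp
        \<comment> \<open>The decay is 1/2 from the Levy kernel and 1 from \<phi>, against growth
          1/4 of the Dirichlet polynomial.\<close>
        also have "\<dots> \<le> (2 * sqrt h / sqrt (1 + \<bar>t\<bar>)) * (3 / (1 + \<bar>t\<bar>)) * (C * (1 + \<bar>t\<bar>) powr (1/4))"
        proof (intro mult_mono levy_kernel_norm_le h)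
          have "c \<le> norm (of_real c - \<i> * of_real t)" "\<bar>t\<bar> \<le> norm (of_real c - \<i> * of_real t)"
            using abs_Re_le_cmod[of "of_real c - \<i> * of_real t"] abs_Im_le_cmod[of "of_real c - \<i> * of_real t"] c by auto
          moreover have "(1 + u) / 2 \<le> X" if "c \<le> X" "u \<le> X" for u X :: real
            using that c by simp
          ultimately have "(1 + \<bar>t\<bar>) / 2 \<le> norm (of_real c - \<i> * of_real t)" by blast
          then have "norm (\<phi> t) \<le> c / ((1 + \<bar>t\<bar>) / 2)"
            unfolding phi norm_divide using c by (simp only: norm_of_real) (intro frac_le, auto)
          also have "\<dots> \<le> 3 / (1 + \<bar>t\<bar>)" using c by (simp add: divide_right_mono)
          finally show "norm (\<phi> t) \<le> 3 / (1 + \<bar>t\<bar>)" .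
          show "norm (\<Sum>n<N. of_real (mu_ln k n) * of_nat n powr (- s) :: complex) \<le> C * (1 + \<bar>t\<bar>) powr (1/4)"
            using N0[OF N Rs(1)] Rs by simp
        qed (use h C in auto)
        also have "\<dots> = (6 * C * sqrt h) * ((1 + \<bar>t\<bar>) powr (1/4) * (1 + \<bar>t\<bar>) powr (- 1) * (1 + \<bar>t\<bar>) powr (-1/2))"
          by (simp add: powr_minus powr_half_sqrt divide_simps)
        also have "(1 + \<bar>t\<bar>) powr (1/4) * (1 + \<bar>t\<bar>) powr (- 1) * (1 + \<bar>t\<bar>) powr (-1/2) = (1 + \<bar>t\<bar>) powr (-5/4)"
          unfolding powr_add[symmetric] by simp
        finally show ?thesis .
      qed
      have fin: "norm (1 / (2 * pi) * (CLBINT t=-T..T. (\<Sum>n<N. w n * G n t))) \<le> 8 * (6 * C * sqrt h)" if T: "T > 0" for T :: real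
      proof -
        have "norm (CLBINT t=-T..T. (\<Sum>n<N. w n * G n t)) \<le> 8 * (6 * C * sqrt h)"
          by (rule interval_integral_decay) (use sumint[OF T] T key C h in auto)
        moreover have "norm (1 / (2 * pi) :: complex) \<le> 1"
          using pi_gt3 by (simp add: norm_divide)
        ultimately show ?thesis unfolding norm_mult using mult_mono[of "norm (1 / (2 * pi) :: complex)" 1 _ "8 * (6 * C * sqrt h)"] by simp
      qed
      have "(\<lambda>T::nat. \<Sum>n<N. w n * (1 / (2 * pi) * (CLBINT t=-real T..real T. G n t))) \<longlonglongrightarrow> (\<Sum>n<N. w n * of_real (measure (exp_law c) {b n - h<..b n}))"
        by (intro tendsto_sum tendsto_mult tendsto_const lev')
      moreover have "\<forall>\<^sub>F T in sequentially. norm (\<Sum>n<N. w n * (1 / (2 * pi) * (CLBINT t=-real T..real T. G n t))) \<le> 8 * (6 * C * sqrt h)"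
        using eventually_gt_at_top[of 0]
      proof eventually_elim
        case (elim T)
        have "(\<Sum>n<N. w n * (1 / (2 * pi) * (CLBINT t=-real T..real T. G n t))) = 1 / (2 * pi) * (CLBINT t=-real T..real T. (\<Sum>n<N. w n * G n t))"
          using sumint[of "real T" N] elim by (simp add: sum_distrib_left mult_ac)
        then show ?case using fin[of "real T"] elim by simp
      qed
      ultimately have "norm (\<Sum>n<N. w n * of_real (measure (exp_law c) {b n - h<..b n})) \<le> 8 * (6 * C * sqrt h)"
        by (intro Lim_norm_ubound[OF sequentially_bot]) auto
      moreover have "(\<Sum>n<N. w n * of_real (measure (exp_law c) {b n - h<..b n})) = of_real (\<Sum>n<N. mu_ln k n * real n powr (- c) * measure (exp_law c) {b n - h<..b n})"
        by (simp add: w_def)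
      ultimately show "\<bar>\<Sum>n<N. mu_ln k n * real n powr (- c) * measure (exp_law c) {V - ln (real n) - h<..V - ln (real n)}\<bar> \<le> 8 * (6 * C) * sqrt h"
        unfolding b_def by (simp only: norm_of_real)
    qed
  qed
qed

section \<open>Removal of the smooth and of the logarithmic weights\<close>

lemma exp_law_measure_le:
  assumes c: "c > 1" and h: "h > 0" and d: "d < 0"
  shows "measure (exp_law c) {d<..d + h} \<le> (if d + h < 0 then 0 else 1 - exp (- c * h))"
proof -
  have c0: "c > 0" using c by simp
  have m: "measure (exp_law c) {d<..d + h} = cdf (exp_law c) (d + h) - cdf (exp_law c) d"
    using h by (intro exp_law_Ioc c0) simp
  show ?thesis
  proof (cases "d + h < 0")
    case False
    have "exp (- c * h) \<le> exp (- c * (d + h))" using c d by (simp add: algebra_simps mult_nonneg_nonpos)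
    then show ?thesis using d False unfolding m cdf_exp_law[OF c0] by simp
  qed (use d in \<open>simp add: m cdf_exp_law[OF c0]\<close>)
qed

lemma exp_law_measure_eq:
  assumes c: "c > 1" and h: "h > 0" and d: "d \<ge> 0"
  shows "measure (exp_law c) {d<..d + h} = exp (- c * d) * (1 - exp (- c * h))"
proof -
  have c0: "c > 0" using c by simp
  have m: "measure (exp_law c) {d<..d + h} = cdf (exp_law c) (d + h) - cdf (exp_law c) d"
    using h by (intro exp_law_Ioc c0) simp
  have "exp (- c * (d + h)) = exp (- c * d) * exp (- c * h)" by (simp add: mult_exp_exp algebra_simps)
  then show ?thesis using d h unfolding m cdf_exp_law[OF c0] by (simp add: algebra_simps)
qed

lemma card_nat_between:
  assumes "0 \<le> a" "a \<le> b"
  shows "real (card {n::nat. a < real n \<and> real n \<le> b}) \<le> b - a + 1"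
proof -
  have "{n::nat. a < real n \<and> real n \<le> b} \<subseteq> {nat \<lfloor>a\<rfloor><..nat \<lfloor>b\<rfloor>}"
  proof
    fix n assume n: "n \<in> {n::nat. a < real n \<and> real n \<le> b}"
    then have "\<lfloor>a\<rfloor> < int n" "int n \<le> \<lfloor>b\<rfloor>" by (auto simp: floor_less_iff le_floor_iff)
    then have "nat \<lfloor>a\<rfloor> < n" "n \<le> nat \<lfloor>b\<rfloor>" using assms by linarith+
    then show "n \<in> {nat \<lfloor>a\<rfloor><..nat \<lfloor>b\<rfloor>}" by simp
  qed
  then have "card {n::nat. a < real n \<and> real n \<le> b} \<le> card {nat \<lfloor>a\<rfloor><..nat \<lfloor>b\<rfloor>}" by (intro card_mono) auto
  also have "\<dots> = nat \<lfloor>b\<rfloor> - nat \<lfloor>a\<rfloor>" by simp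
  finally have "real (card {n::nat. a < real n \<and> real n \<le> b}) \<le> real (nat \<lfloor>b\<rfloor> - nat \<lfloor>a\<rfloor>)" by (rule of_nat_mono)
  also have "nat \<lfloor>a\<rfloor> \<le> nat \<lfloor>b\<rfloor>" using assms by (intro nat_mono floor_mono)
  then have "real (nat \<lfloor>b\<rfloor> - nat \<lfloor>a\<rfloor>) = real (nat \<lfloor>b\<rfloor>) - real (nat \<lfloor>a\<rfloor>)" by simp
  also have "\<dots> \<le> b - a + 1" using assms by linarith
  finally show ?thesis .
qed

text \<open>With \<open>V = ln x + h\<close> the weight including \<open>n powr (- c)\<close> is
  constant for \<open>1 \<le> n \<le> x\<close>, vanishes for \<open>n > x * exp h\<close> and is no
  larger in between. The sharp sum thus differs from the smoothed one only by the at most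
  \<open>2 * x * h + 1\<close> integers in the transition.\<close>

lemma mu_ln_sum_smoothing:
  obtains K where "K \<ge> 0"
    "\<And>x h. exp 2 \<le> x \<Longrightarrow> 0 < h \<Longrightarrow> h \<le> 1 \<Longrightarrow>
      \<bar>\<Sum>n | real n \<le> x. mu_ln k n\<bar> \<le> K * x / sqrt h + (2 * x * h + 1) * (2 * ln x) ^ k"
proof -
  obtain K where K: "K \<ge> 0" "\<And>c h V. 1 < c \<Longrightarrow> c \<le> 3/2 \<Longrightarrow> 0 < h \<Longrightarrow> h \<le> 1 \<Longrightarrow>
      \<exists>N0. \<forall>N\<ge>N0. \<bar>\<Sum>n<N. mu_ln k n * real n powr (- c) * measure (exp_law c) {V - ln (real n) - h<..V - ln (real n)}\<bar> \<le> K * sqrt h"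
    using weighted_sum_bound by blast
  show ?thesis
  proof (rule that[of "K * exp 1 * 2"])
    show "K * exp 1 * 2 \<ge> 0" using K by simp
    fix x h :: real assume x: "exp 2 \<le> x" and h: "0 < h" "h \<le> 1"
    have x0: "x > 0" "x \<ge> 1" using x exp_gt_zero[of "2::real"] exp_ge_add_one_self[of "2::real"] by linarith+
    have lx: "ln x \<ge> 2" using x x0 by (simp add: ln_ge_iff)
    \<comment> \<open>The usual abscissa: it gives \<open>x powr c = exp 1 * x\<close> while the
      series still converges absolutely.\<close>
    define c where "c = 1 + 1 / ln x"
    have c: "1 < c" "c \<le> 3/2" unfolding c_def using lx by (auto simp: field_simps)
    \<comment> \<open>The mass of \<open>{0<..h}\<close>. Division by \<open>q \<ge> h / 2\<close>
      turns the bound \<open>sqrt h\<close> for the smoothed sum into \<open>1 / sqrt h\<close> for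
      the sharp one.\<close>
    define q where "q = 1 - exp (- c * h)"
    have q: "q \<ge> h / 2" "q > 0"
    proof -
      have "exp (- c * h) \<le> exp (- h)" using c h by simp
      moreover have "exp (- h) \<le> 1 - h / 2"
      proof -
        have "(1 + h) * (1 - h / 2) \<ge> 1" using h mult_left_mono[of h 1 h] by (simp add: algebra_simps)
        also have "(1 + h) * (1 - h / 2) \<le> exp h * (1 - h / 2)"
          using h by (intro mult_right_mono exp_ge_add_one_self) auto
        finally show ?thesis by (simp add: exp_minus field_simps)
      qed
      ultimately show "q \<ge> h / 2" unfolding q_def by linarith
      then show "q > 0" using h by linarith
    qed
    define V where "V = ln x + h"
    define m where "m n = measure (exp_law c) {V - ln (real n) - h<..V - ln (real n)}" for n :: nat
    obtain N0 where N0: "\<And>N. N \<ge> N0 \<Longrightarrow> \<bar>\<Sum>n<N. mu_ln k n * real n powr (- c) * m n\<bar> \<le> K * sqrt h"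
      using K(2)[OF c h, of V] unfolding m_def by blast
    define N where "N = max N0 (nat \<lceil>x * exp h\<rceil> + 1)"
    have Nx: "n < N" if "real n \<le> x * exp h" for n using that unfolding N_def by linarith
    have xh: "x \<le> x * exp h" using x0 h by simp
    let ?A = "{n. real n \<le> x}" and ?B = "{n. x < real n \<and> real n \<le> x * exp h}"
    have fin: "finite ?A" "finite ?B" by (rule finite_subset[of _ "{..<N}"]; use Nx xh in force)+
    have term0: "mu_ln k n * real n powr (- c) * m n = 0" if "n \<notin> ?A" "n \<notin> ?B" for n
    proof -
      have n: "real n > x * exp h" using that xh by auto
      then have "ln (real n) > ln (x * exp h)" using x0 xh by (subst ln_less_cancel_iff) (linarith | simp)+
      then have l: "ln (real n) > ln x + h" using x0 by (simp add: ln_mult)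
      have "m n \<le> 0" using exp_law_measure_le[OF c(1) h(1), of "ln x - ln (real n)"] l h
        by (simp add: m_def V_def algebra_simps)
      moreover have "m n \<ge> 0" by (simp add: m_def)
      ultimately show ?thesis by simp
    qed
    have termA: "mu_ln k n * real n powr (- c) * m n = x powr (- c) * q * mu_ln k n" if "n \<in> ?A" for n
    proof (cases "n = 0")
      case False
      have "ln (real n) \<le> ln x" using that False by (intro ln_mono) auto
      then have "m n = exp (- c * (ln x - ln (real n))) * q"
        using exp_law_measure_eq[OF c(1) h(1), of "ln x - ln (real n)"] by (simp add: m_def V_def q_def algebra_simps)
      moreover have "real n powr (- c) * exp (- c * (ln x - ln (real n))) = x powr (- c)"
        using False x0 by (simp add: powr_def mult_exp_exp algebra_simps)
      ultimately show ?thesis by (simp add: mult_ac)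
    qed (simp add: mu_ln_def moebius_mu_def)
    have termB: "\<bar>mu_ln k n * real n powr (- c) * m n\<bar> \<le> x powr (- c) * q * (2 * ln x) ^ k" if "n \<in> ?B" for n
    proof -
      have n: "x < real n" "real n \<le> x * exp h" using that by auto
      have "ln (real n) \<le> ln (x * exp h)" using n x0 by (intro ln_mono) auto
      then have l2: "ln (real n) \<le> 2 * ln x" using x0 h lx by (simp add: ln_mult)
      have l: "ln x < ln (real n)" using n x0 by (subst ln_less_cancel_iff) auto
      have "\<bar>mu_ln k n\<bar> \<le> \<bar>ln (real n)\<bar> ^ k" by (rule abs_mu_ln_le)
      also have "\<dots> \<le> (2 * ln x) ^ k" using l l2 lx by (intro power_mono) auto
      finally have 1: "\<bar>mu_ln k n\<bar> \<le> (2 * ln x) ^ k" .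
      have 2: "real n powr (- c) \<le> x powr (- c)" using n x0 c by (intro powr_mono2') auto
      have e: "{V - ln (real n) - h<..V - ln (real n)} = {ln x - ln (real n)<..ln x - ln (real n) + h}" by (simp add: V_def algebra_simps)
      have "m n \<le> (if ln x - ln (real n) + h < 0 then 0 else q)"
        unfolding m_def e q_def by (rule exp_law_measure_le[OF c(1) h(1)]) (use l in simp)
      then have 3: "m n \<le> q" "m n \<ge> 0" using q by (auto simp: m_def split: if_splits)
      have "\<bar>mu_ln k n\<bar> * real n powr (- c) * m n \<le> (2 * ln x) ^ k * x powr (- c) * q"
        using 1 2 3 lx by (intro mult_mono) auto
      then show ?thesis using 3 by (simp add: abs_mult mult_ac)
    qed
    have "(\<Sum>n<N. mu_ln k n * real n powr (- c) * m n) = (\<Sum>n\<in>?A \<union> ?B. mu_ln k n * real n powr (- c) * m n)"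
      by (rule sum.mono_neutral_right) (use Nx xh term0 in force)+
    also have "\<dots> = (\<Sum>n\<in>?A. mu_ln k n * real n powr (- c) * m n) + (\<Sum>n\<in>?B. mu_ln k n * real n powr (- c) * m n)"
      using fin by (intro sum.union_disjoint) auto
    also have "(\<Sum>n\<in>?A. mu_ln k n * real n powr (- c) * m n) = x powr (- c) * q * (\<Sum>n\<in>?A. mu_ln k n)"
      unfolding sum_distrib_left using termA by (intro sum.cong) auto
    finally have eq: "x powr (- c) * q * (\<Sum>n\<in>?A. mu_ln k n)
      = (\<Sum>n<N. mu_ln k n * real n powr (- c) * m n) - (\<Sum>n\<in>?B. mu_ln k n * real n powr (- c) * m n)" by simp
    have B: "\<bar>\<Sum>n\<in>?B. mu_ln k n * real n powr (- c) * m n\<bar> \<le> (2 * x * h + 1) * (x powr (- c) * q * (2 * ln x) ^ k)"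
    proof -
      have "\<bar>\<Sum>n\<in>?B. mu_ln k n * real n powr (- c) * m n\<bar> \<le> (\<Sum>n\<in>?B. x powr (- c) * q * (2 * ln x) ^ k)"
        by (rule order_trans[OF sum_abs sum_mono[OF termB]])
      also have "\<dots> = real (card ?B) * (x powr (- c) * q * (2 * ln x) ^ k)" by simp
      also have "\<dots> \<le> (2 * x * h + 1) * (x powr (- c) * q * (2 * ln x) ^ k)"
      proof (rule mult_right_mono)
        have "exp h \<le> 1 + 2 * h"
        proof -
          have "exp h \<le> 1 + h + h\<^sup>2" using h exp_bound[of h] by simp
          also have "\<dots> \<le> 1 + 2 * h" using h mult_left_mono[of h 1 h] by (simp add: power2_eq_square)
          finally show ?thesis .
        qed
        then have "x * exp h \<le> x * (1 + 2 * h)" using x0 by (intro mult_left_mono) auto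
        then show "real (card ?B) \<le> 2 * x * h + 1" using card_nat_between[of x "x * exp h"] x0 xh by (simp add: algebra_simps)
      qed (use q lx in auto)
      finally show ?thesis .
    qed
    have N': "\<bar>\<Sum>n<N. mu_ln k n * real n powr (- c) * m n\<bar> \<le> K * sqrt h" by (rule N0) (simp add: N_def)
    have pq: "x powr (- c) * q > 0" using x0 q by simp
    have "x powr (- c) * q * \<bar>\<Sum>n\<in>?A. mu_ln k n\<bar> = \<bar>x powr (- c) * q * (\<Sum>n\<in>?A. mu_ln k n)\<bar>"
      unfolding abs_mult[of "x powr (- c) * q"] abs_of_pos[OF pq] by (rule refl)
    also have "\<dots> \<le> K * sqrt h + (2 * x * h + 1) * (x powr (- c) * q * (2 * ln x) ^ k)"
      unfolding eq using N' B by linarith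
    also have "K * sqrt h \<le> x powr (- c) * q * (K * exp 1 * 2 * x / sqrt h)"
    proof -
      have "c * ln x = 1 + ln x" unfolding c_def using lx by (simp add: field_simps)
      then have xc: "x powr c = exp 1 * x" using x0 by (simp add: powr_def exp_add)
      have sh: "sqrt h * sqrt h = h" using h by simp
      have "K * sqrt h = K * (1 / sqrt h) * (h / 2) * 2" using h sh by (simp add: field_simps)
      also have "\<dots> \<le> K * (1 / sqrt h) * q * 2" using q K h by (intro mult_right_mono mult_left_mono) auto
      also have "\<dots> = x powr (- c) * x powr c * (K * (1 / sqrt h) * q * 2)" using x0 by (simp add: powr_minus)
      also have "\<dots> = x powr (- c) * q * (K * exp 1 * 2 * x / sqrt h)" unfolding xc by (simp add: mult_ac)
      finally show ?thesis .
    qed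
    finally have "x powr (- c) * q * \<bar>\<Sum>n\<in>?A. mu_ln k n\<bar> \<le> x powr (- c) * q * (K * exp 1 * 2 * x / sqrt h + (2 * x * h + 1) * (2 * ln x) ^ k)"
      by (simp add: algebra_simps)
    then show "\<bar>\<Sum>n\<in>?A. mu_ln k n\<bar> \<le> K * exp 1 * 2 * x / sqrt h + (2 * x * h + 1) * (2 * ln x) ^ k"
      using pq by (simp only: mult_le_cancel_left_pos)
  qed
qed

text \<open>Induction on the upper end for the difference from the boundary term: each step adds at
  most \<open>K * (b M - b (Suc M))\<close>, which telescopes because \<open>b\<close>
  decreases.\<close>

lemma abel_inequality:
  fixes a b :: "nat \<Rightarrow> real"
  assumes "m < N" and A: "\<And>n. m \<le> n \<Longrightarrow> n \<le> N \<Longrightarrow> \<bar>\<Sum>i\<le>n. a i\<bar> \<le> K"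
    and b: "\<And>n. m < n \<Longrightarrow> b n \<ge> 0" "\<And>n. m < n \<Longrightarrow> b (Suc n) \<le> b n"
  shows "\<bar>\<Sum>n\<in>{m<..N}. a n * b n\<bar> \<le> 2 * K * b (Suc m)"
proof -
  have "\<bar>(\<Sum>n\<in>{m<..M}. a n * b n) - (\<Sum>i\<le>M. a i) * b M\<bar> \<le> K * (2 * b (Suc m) - b M)" if "Suc m \<le> M" "M \<le> N" for M
    using that
  proof (induction M rule: dec_induct)
    case base
    have "{m<..Suc m} = {Suc m}" by auto
    then have "(\<Sum>n\<in>{m<..Suc m}. a n * b n) - (\<Sum>i\<le>Suc m. a i) * b (Suc m) = - ((\<Sum>i\<le>m. a i) * b (Suc m))"
      by (simp add: algebra_simps)
    then have "\<bar>(\<Sum>n\<in>{m<..Suc m}. a n * b n) - (\<Sum>i\<le>Suc m. a i) * b (Suc m)\<bar> = \<bar>\<Sum>i\<le>m. a i\<bar> * b (Suc m)"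
      using b(1)[of "Suc m"] by (simp add: abs_mult)
    also have "\<dots> \<le> K * b (Suc m)" using A[of m] assms(1) b(1)[of "Suc m"] by (intro mult_right_mono) auto
    finally show ?case by simp
  next
    case (step M)
    have "{m<..Suc M} = insert (Suc M) {m<..M}" using step by auto
    then have "(\<Sum>n\<in>{m<..Suc M}. a n * b n) - (\<Sum>i\<le>Suc M. a i) * b (Suc M)
       = ((\<Sum>n\<in>{m<..M}. a n * b n) - (\<Sum>i\<le>M. a i) * b M) + (\<Sum>i\<le>M. a i) * (b M - b (Suc M))"
      by (simp add: algebra_simps)
    moreover have "\<bar>(\<Sum>i\<le>M. a i) * (b M - b (Suc M))\<bar> \<le> K * (b M - b (Suc M))"
      unfolding abs_mult using A[of M] b(2)[of M] step by (intro mult_mono) auto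
    moreover have "\<bar>(\<Sum>n\<in>{m<..M}. a n * b n) - (\<Sum>i\<le>M. a i) * b M\<bar> \<le> K * (2 * b (Suc m) - b M)"
      using step by simp
    ultimately show ?case by (simp add: algebra_simps)
  qed
  from this[of N] have 1: "\<bar>(\<Sum>n\<in>{m<..N}. a n * b n) - (\<Sum>i\<le>N. a i) * b N\<bar> \<le> K * (2 * b (Suc m) - b N)" using assms(1) by simp
  have "\<bar>(\<Sum>i\<le>N. a i) * b N\<bar> \<le> K * b N"
    unfolding abs_mult using A[of N] b(1)[of N] assms(1) by (intro mult_mono) auto
  then show ?thesis using 1 by (simp add: algebra_simps)
qed

text \<open>The choice \<open>h = 1 / (ln x) ^ 8\<close> balances the two errors for twelve
  derivatives: \<open>1 / sqrt h\<close> and \<open>h * (ln x) ^ 12\<close> are both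
  \<open>(ln x) ^ 4\<close>. Against the trivial bound this saves eight powers.\<close>

lemma mu_ln_sum_bound:
  obtains C where "C \<ge> 0" "\<And>x. exp 2 \<le> x \<Longrightarrow> \<bar>\<Sum>n | real n \<le> x. mu_ln 12 n\<bar> \<le> C * x * (ln x) ^ 4"
proof -
  obtain K where K: "K \<ge> 0" "\<And>x h. exp 2 \<le> x \<Longrightarrow> 0 < h \<Longrightarrow> h \<le> 1 \<Longrightarrow>
      \<bar>\<Sum>n | real n \<le> x. mu_ln 12 n\<bar> \<le> K * x / sqrt h + (2 * x * h + 1) * (2 * ln x) ^ 12"
    using mu_ln_sum_smoothing by blast
  show ?thesis
  proof (rule that[of "K + 4096 * (2 + 8 ^ 8)"])
    show "K + 4096 * (2 + 8 ^ 8) \<ge> 0" using K by simp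
    fix x :: real assume x: "exp 2 \<le> x"
    have x0: "x > 0" "x \<ge> 1" using x exp_gt_zero[of "2::real"] exp_ge_add_one_self[of "2::real"] by linarith+
    define l where "l = ln x"
    have l: "l \<ge> 2" unfolding l_def using x x0 by (simp add: ln_ge_iff)
    define h where "h = 1 / l ^ 8"
    have h: "0 < h" "h \<le> 1" unfolding h_def using l one_le_power[of l 8] by (auto simp: divide_le_eq_1)
    have sh: "sqrt h = 1 / l ^ 4"
    proof -
      have "h = (1 / l ^ 4)\<^sup>2" by (simp add: h_def power_divide power_mult[symmetric])
      moreover have "1 / l ^ 4 \<ge> 0" using l by simp
      ultimately show ?thesis by (simp only: real_sqrt_abs abs_of_nonneg)
    qed
    have p8: "l ^ 8 \<le> 8 ^ 8 * x" unfolding l_def using ln_power_le_powr[of x 1 8] x0 by simp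
    have "\<bar>\<Sum>n | real n \<le> x. mu_ln 12 n\<bar> \<le> K * x / sqrt h + (2 * x * h + 1) * (2 * l) ^ 12"
      unfolding l_def by (rule K(2)[OF x h])
    also have "\<dots> = K * x * l ^ 4 + 4096 * (2 * x + l ^ 8) * l ^ 4"
    proof -
      have "l ^ 12 = l ^ 8 * l ^ 4" by (simp add: power_add[symmetric])
      then have "(2 * x * h + 1) * (2 * l) ^ 12 = 4096 * ((2 * x * h + 1) * l ^ 8) * l ^ 4" by (simp add: power_mult_distrib)
      also have "(2 * x * h + 1) * l ^ 8 = 2 * x + l ^ 8" unfolding h_def using l by (simp add: algebra_simps)
      finally show ?thesis using sh l by simp
    qed
    also have "\<dots> \<le> K * x * l ^ 4 + 4096 * (2 * x + 8 ^ 8 * x) * l ^ 4"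
      using p8 l by (intro add_left_mono mult_right_mono mult_left_mono) auto
    also have "\<dots> = (K + 4096 * (2 + 8 ^ 8)) * x * l ^ 4" by (simp add: algebra_simps)
    finally show "\<bar>\<Sum>n | real n \<le> x. mu_ln 12 n\<bar> \<le> (K + 4096 * (2 + 8 ^ 8)) * x * (ln x) ^ 4" by (simp add: l_def)
  qed
qed

text \<open>Dividing by \<open>(ln n) ^ 12\<close> through Abel's inequality turns
  \<open>t * (ln t) ^ 4\<close> into \<open>t / (ln t) ^ 8\<close>. Starting at
  \<open>sqrt t\<close> keeps \<open>ln n \<ge> ln t / 2\<close>, and the part below is bounded
  trivially.\<close>

lemma moebius_sum_bound:
  obtains CM where "CM \<ge> 0" "\<And>t. t \<ge> 2 \<Longrightarrow> \<bar>mertens_free {} t\<bar> \<le> CM * t / (ln t) ^ 8"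
proof -
  obtain C where C: "C \<ge> 0" "\<And>x. exp 2 \<le> x \<Longrightarrow> \<bar>\<Sum>n | real n \<le> x. mu_ln 12 n\<bar> \<le> C * x * (ln x) ^ 4"
    using mu_ln_sum_bound by blast
  define CM where "CM = 8192 * C + 16 ^ 8 + 6 ^ 8"
  show ?thesis
  proof (rule that[of CM])
    show "CM \<ge> 0" unfolding CM_def using C by simp
    fix t :: real assume t: "t \<ge> 2"
    have lt: "ln t > 0" using t by simp
    have trivial: "\<bar>mertens_free {} u\<bar> \<le> u" if "u \<ge> 0" for u by (rule abs_mertens_free_le[OF that])
    show "\<bar>mertens_free {} t\<bar> \<le> CM * t / (ln t) ^ 8"
    \<comment> \<open>\<open>ln t \<ge> 6\<close> ensures
      \<open>sqrt t \<ge> exp 3 \<ge> exp 2 + 1\<close>, so that even \<open>m\<close> lies in the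
      range of the bound for \<open>mu_ln 12\<close>. Smaller \<open>t\<close> are absorbed by the
      summand \<open>6 ^ 8\<close>.\<close>
    proof (cases "ln t \<ge> 6")
      case False
      have "(ln t) ^ 8 \<le> 6 ^ 8" using False lt by (intro power_mono) auto
      also have "\<dots> \<le> CM" unfolding CM_def using C by simp
      finally have "t * (ln t) ^ 8 \<le> t * CM" using t by (intro mult_left_mono) auto
      then have "t \<le> CM * t / (ln t) ^ 8" using lt by (simp add: field_simps)
      then show ?thesis using trivial[of t] t by linarith
    next
      case True
      define m where "m = nat \<lfloor>sqrt t\<rfloor>"
      define N where "N = nat \<lfloor>t\<rfloor>"
      have st: "sqrt t \<ge> exp 3"
      proof -
        have "ln (sqrt t) \<ge> 3" using True t by (simp add: ln_sqrt)
        then show ?thesis using t by (simp add: ln_ge_iff)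
      qed
      have e3: "exp (3::real) \<ge> exp 2 + 1"
      proof -
        have "exp (3::real) = exp 2 * exp 1" by (simp add: mult_exp_exp)
        moreover have "exp (2::real) * exp 1 \<ge> exp 2 * 2" using exp_ge_add_one_self[of "1::real"] by (intro mult_left_mono) auto
        moreover have "exp (2::real) \<ge> 1" by simp
        ultimately show ?thesis by linarith
      qed
      have m: "real m \<le> sqrt t" "sqrt t < real m + 1" "real m \<ge> exp 2" "m \<ge> 2"
      proof -
        show 1: "real m \<le> sqrt t" "sqrt t < real m + 1" unfolding m_def using t by (simp, linarith)
        then show 2: "real m \<ge> exp 2" using st e3 by linarith
        have "exp (2::real) \<ge> 3" using exp_ge_add_one_self[of "2::real"] by simp
        then show "m \<ge> 2" using 2 by linarith
      qed
      have Nt: "real N \<le> t" unfolding N_def using t by simp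
      have mN: "m < N"
      proof -
        have "sqrt t * 3 \<le> sqrt t * sqrt t"
          using st exp_ge_add_one_self[of "3::real"] t by (intro mult_left_mono) auto
        then have "sqrt t + 2 \<le> t" using t st exp_ge_add_one_self[of "3::real"] by simp
        then have "real m < t - 1" using m by linarith
        then show ?thesis unfolding N_def by linarith
      qed
      define b where "b n = 1 / (ln (real n)) ^ 12" for n :: nat
      have fl: "real n \<le> u \<longleftrightarrow> n \<le> nat \<lfloor>u\<rfloor>" if "u \<ge> 0" for n and u :: real
        using that le_nat_floor[of n u] of_nat_floor[of u] by (meson of_nat_mono order_trans)
      have "free_upto {} t = {1..N}" "free_upto {} (sqrt t) = {1..m}"
        using t by (auto simp: free_upto_def fl m_def N_def)
      then have "free_upto {} t = free_upto {} (sqrt t) \<union> {m<..N}" "free_upto {} (sqrt t) \<inter> {m<..N} = {}"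
        using mN by auto
      then have split: "mertens_free {} t = mertens_free {} (sqrt t) + (\<Sum>n\<in>{m<..N}. of_int (moebius_mu n))"
        unfolding mertens_free_def by (metis (no_types, lifting) finite_free_upto finite_greaterThanAtMost sum.union_disjoint)
      \<comment> \<open>The exponent 12 is even, so the minus sign in \<open>- ln n\<close>
        disappears and the weight cancels exactly.\<close>
      have "(\<Sum>n\<in>{m<..N}. of_int (moebius_mu n)) = (\<Sum>n\<in>{m<..N}. mu_ln 12 n * b n)"
      proof (rule sum.cong)
        fix n assume "n \<in> {m<..N}"
        then have "ln (real n) > 0" using m by simp
        then show "of_int (moebius_mu n) = mu_ln 12 n * b n" by (simp add: mu_ln_def b_def)
      qed simp
      also have "\<bar>\<dots>\<bar> \<le> 2 * (C * t * (ln t) ^ 4) * b (Suc m)"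
      proof (rule abel_inequality[OF mN])
        fix n assume n: "m \<le> n" "n \<le> N"
        have "{..n} = {i. real i \<le> real n}" by auto
        then have "\<bar>\<Sum>i\<le>n. mu_ln 12 i\<bar> \<le> C * real n * (ln (real n)) ^ 4"
          using C(2)[of "real n"] m n by simp
        also have "\<dots> \<le> C * t * (ln t) ^ 4"
        proof -
          have "real n \<le> t" "real n \<ge> 2" using n m Nt by linarith+
          then show ?thesis using C lt by (intro mult_mono power_mono ln_mono) auto
        qed
        finally show "\<bar>\<Sum>i\<le>n. mu_ln 12 i\<bar> \<le> C * t * (ln t) ^ 4" .
      next
        fix n assume n: "m < n"
        have l: "ln (real n) > 0" "ln (real n) \<le> ln (real (Suc n))" using n m by auto
        show "b n \<ge> 0" unfolding b_def using l by simp
        show "b (Suc n) \<le> b n" unfolding b_def using l n by (intro divide_left_mono power_mono mult_pos_pos zero_less_power) auto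
      qed
      also have "b (Suc m) \<le> 4096 / (ln t) ^ 12"
      proof -
        have "ln (sqrt t) \<le> ln (real (Suc m))" using m t by (intro ln_mono) auto
        then have "ln t / 2 \<le> ln (real (Suc m))" using t by (simp add: ln_sqrt)
        then have "(ln t / 2) ^ 12 \<le> (ln (real (Suc m))) ^ 12" using lt by (intro power_mono) auto
        then have "b (Suc m) \<le> 1 / (ln t / 2) ^ 12" unfolding b_def using lt m
          by (intro divide_left_mono mult_pos_pos zero_less_power) auto
        then show ?thesis by (simp add: power_divide)
      qed
      finally have S: "\<bar>\<Sum>n\<in>{m<..N}. of_int (moebius_mu n) :: real\<bar> \<le> 2 * (C * t * (ln t) ^ 4) * (4096 / (ln t) ^ 12)"
        using C t lt by (simp add: mult_left_mono)
      have e12: "(ln t) ^ 12 = (ln t) ^ 8 * (ln t) ^ 4" by (simp add: power_add[symmetric])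
      have S': "2 * (C * t * (ln t) ^ 4) * (4096 / (ln t) ^ 12) = 8192 * C * t / (ln t) ^ 8"
      proof -
        have "2 * (C * t * z) * (4096 / (y * z)) = 8192 * C * t / y" if "z \<noteq> 0" for y z :: real
          using that by simp
        moreover have "(ln t) ^ 4 \<noteq> 0" using lt by simp
        ultimately show ?thesis unfolding e12 by blast
      qed
      have "(ln t) ^ 8 \<le> 16 ^ 8 * sqrt t"
        using ln_power_le_powr[of t "1/2" 8] t by (simp add: powr_half_sqrt)
      then have "sqrt t * (ln t) ^ 8 \<le> sqrt t * (16 ^ 8 * sqrt t)" using t by (intro mult_left_mono) auto
      also have "\<dots> = 16 ^ 8 * t" using t by simp
      finally have R: "sqrt t \<le> 16 ^ 8 * t / (ln t) ^ 8" using lt by (simp add: field_simps)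
      have "\<bar>mertens_free {} t\<bar> \<le> sqrt t + 8192 * C * t / (ln t) ^ 8"
        using split trivial[of "sqrt t"] S S' t by simp
      also have "\<dots> \<le> 16 ^ 8 * t / (ln t) ^ 8 + 8192 * C * t / (ln t) ^ 8" using R by simp
      also have "\<dots> \<le> CM * t / (ln t) ^ 8"
      proof -
        have "16 ^ 8 * t + 8192 * C * t \<le> CM * t" unfolding CM_def using t by (simp add: algebra_simps)
        then show ?thesis using lt by (simp add: add_divide_distrib[symmetric] divide_right_mono)
      qed
      finally show ?thesis .
    qed
  qed
qed

theorem theorem4p1:
  fixes l :: nat
  shows "\<exists>C::real. \<forall>\<^sub>F x in at_top. \<forall>j::nat. 1 \<le> j \<and> j \<le> l \<and> coprime j l \<longrightarrow>
           \<bar>M_omega_sq x j l\<bar> \<le> C * (x * (ln (ln x)) ^ 5 / ln x)"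
proof -
  obtain CM where CM: "CM \<ge> 0" "\<And>t. t \<ge> 2 \<Longrightarrow> \<bar>mertens_free {} t\<bar> \<le> CM * t / (ln t) ^ 8"
    using moebius_sum_bound by blast
  obtain C where "\<forall>\<^sub>F x in at_top. \<forall>j l::nat. \<bar>M_omega_sq x j l\<bar> \<le> C * (x * (ln (ln x)) ^ 5 / ln x)"
    using M_omega_sq_bound_of_mertens[OF CM] by blast
  then have "\<forall>\<^sub>F x in at_top. \<forall>j::nat. 1 \<le> j \<and> j \<le> l \<and> coprime j l \<longrightarrow>
           \<bar>M_omega_sq x j l\<bar> \<le> C * (x * (ln (ln x)) ^ 5 / ln x)"
    by (auto elim!: eventually_mono)
  then show ?thesis by blast
qed

end
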